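(* Let $n\ge 1$. For a set $S\subset b_n$ and $k$-subspaces $J\subseteq M$ of $b_n$ with $S\subseteq M$, say that $S$ is a basis of $M$ modulo $J$ if the elements of $S$ are linearly independent modulo $J$ and $\mathrm{span}_k(S)+J=M$. Then, for every integer $m$ with $|m|\le n$ and $m\equiv n\pmod2$: (1) if $m\in\{0,1\}$, then $S_{(n,m)}$ is a $k$-basis of the left ideal $b_nS_{(n,m)}$; (2) if $m=-1$, then $S_{(n,m)}$ is a basis of $b_nS_{(n,m)}+J$ modulo $J=b_nS_{(n,1)}$; (3) if $m\ge2$, then $S_{(n,m)}$ is a basis of $b_nS_{(n,m)}+J$ modulo $J=b_nE_{m-2}(n)b_n$; (4) if $m<-1$, then $S_{(n,m)}$ is a basis of $b_nS_{(n,m)}+J$ modulo $J=b_nS_{(n,-m)}+b_nE_{|m|-2}(n)b_n$; (5) $S^2_{(n,m)}$ is a basis of $b_nS^2_{(n,m)}b_n+J_m$ modulo $J_m$, where $J_m$ is the sum of the two-sided ideals of $b_n$ generated by the sets $S^2_{(n,m')}$ with $m'\equiv n\pmod 2$ and either $|m'|<|m|$ or ($m<0$ and $m'=-m$). Moreover, (6) $S^2_{(n)}:=\bigcup_m S^2_{(n,m)}$ (union over all $m$ with $|m|\le n$, $m\equiv n\pmod 2$) is a $k$-basis of $b_n$.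
   Context: Algebra. Let $K$ be a commutative ring with $1$, $x\in K$ invertible, $q=x^2$, and $\gamma,\delta_e\in K$. For $n\ge 1$, $b_n^K$ is the unital associative $K$-algebra with generators $e,U_1,\ldots,U_{n-1}$ and relations $U_iU_i=(q+q^{-1})U_i$; $U_iU_{i\pm1}U_i=U_i$ (whenever both indices lie in $\{1,\dots,n-1\}$); $U_iU_j=U_jU_i$ if $|i-j|\ne 1$; $U_1eU_1=\gamma U_1$; $ee=\delta_e e$; $U_ie=eU_i$ if $i\ne 1$. For $k$ a field which is a $K$-algebra, $b_n=k\otimes_K b_n^K$. For $0\le m\le n$, $m\equiv n\pmod 2$: $E_m(n)=U_1U_3\cdots U_{n-m-1}$ ($=1$ if $m=n$). For $0<m\le n$, $m\equiv n\pmod 2$: $E_{m+}(n)=E_m(n)\,e\,U_2U_4\cdots U_{n-m}\,E_m(n)$ ($=e$ if $m=n$). For $a\in b_n$, $a^o$ is the image of $a$ under the $k$-linear anti-automorphism of $b_n$ fixing the generators $e,U_1,\ldots,U_{n-1}$. $b_nS$ and $b_nSb_n$ denote the left, respectively two-sided, ideal generated by $S$. Paths. Vertices of the Pascal triangle are pairs (level, weight) in $\mathbb Z_{\ge0}\times\mathbb Z$; edges join $(j,l)$ to $(j+1,l\pm1)$. $S_{n,m}$ is the set of descending walks from $(0,0)$ to $(n,m)$. Each edge is assigned a word $w(\text{edge})$: (i) $w((j,l),(j+1,l+1))=1$ if $l>0$, and $w((j,l),(j+1,l-1))=1$ if $l<0$; (ii) if $l\ne0$ and the edge goes from $(j,l)$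 to $(j+1,l')$ with $|l'|=|l|-1$, then $w=U_jU_{j-1}\cdots U_1$; (iii) $w((j,0),(j+1,1))=e\,(U_jU_{j-2}\cdots U_2)(U_{j-1}U_{j-3}\cdots U_1)$ ($j$ is even; empty products are $1$, so this is $e$ for $j=0$); (iv) $w((j,0),(j+1,-1))=1$. For a walk $p$ with successive edges $p_1,\ldots,p_n$ put $w(p)=w(p_1)\cdots w(p_n)$, and $S_{(n,m)}=\{w(p):p\in S_{n,m}\}$, regarded as a set of elements of $b_n$. The set $S^2_{(n,m)}$. Put $F_{n,m}=E_{m+}(n)$ if $m>0$ and $F_{n,m}=E_{-m}(n)$ if $m\le0$. Every element of $S_{(n,m)}$ equals, in the algebra, $aF_{n,m}$ for some word $a$ in the generators; $s(n,m)$ denotes a set of words with $S_{(n,m)}=\{aF_{n,m}: a\in s(n,m)\}$. Define $S^2_{(n,m)}=\{a\,F_{n,m}\,b^o: a,b\in s(n,m)\}$, as a set of elements of $b_n$. (For example $S_{(3,1)}=\{U_1eU_2U_1,\ e(U_1eU_2U_1),\ U_2(U_1eU_2U_1)\}$, with $s(3,1)=\{1,e,U_2\}$.) *)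

theory Defs
  imports "HOL-Algebra.QuotRing" "HOL-Algebra.Module"
begin

text \<open>
  Coefficient rings are types; algebras over them are records of type
  \<^typ>\<open>('k, 'a) module\<close>, whose \<open>smult\<close> field is the action of the scalars. They are not
  assumed commutative.
\<close>

definition monoid_basis :: "'m \<Rightarrow> 'm \<Rightarrow> 'k::comm_ring_1" where
  "monoid_basis a = (\<lambda>b. if b = a then 1 else 0)"

definition monoid_algebra :: "('m, 'z) monoid_scheme \<Rightarrow> ('k::comm_ring_1, 'm \<Rightarrow> 'k) module" where
  "monoid_algebra M =
    \<lparr>carrier = {f. finite {a. f a \<noteq> 0} \<and> {a. f a \<noteq> 0} \<subseteq> carrier M},
     mult = (\<lambda>f g c. \<Sum>(a, b) \<in> {(a, b). f a \<noteq> 0 \<and> g b \<noteq> 0 \<and> a \<otimes>\<^bsub>M\<^esub> b = c}. f a * g b),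
     one = monoid_basis \<one>\<^bsub>M\<^esub>,
     zero = (\<lambda>_. 0),
     add = (\<lambda>f g a. f a + g a),
     smult = (\<lambda>c f a. c * f a)\<rparr>"

definition quotient_algebra :: "('k, 'a, 'z) module_scheme \<Rightarrow> 'a set \<Rightarrow> ('k, 'a set) module" where
  "quotient_algebra A I =
    ring.extend (A Quot I) (module.fields (\<lambda>c X. \<Union>a\<in>X. I +>\<^bsub>A\<^esub> (c \<odot>\<^bsub>A\<^esub> a)))"

definition relation_ideal :: "('a, 'z) ring_scheme \<Rightarrow> ('a \<times> 'a) set \<Rightarrow> 'a set" where
  "relation_ideal A R = genideal A {l \<ominus>\<^bsub>A\<^esub> r | l r. (l, r) \<in> R}"

definition free_monoid :: "'g set \<Rightarrow> 'g list monoid" where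
  "free_monoid G = \<lparr>carrier = lists G, mult = (@), one = []\<rparr>"

definition presented_algebra ::
  "'g set \<Rightarrow> (('g list \<Rightarrow> 'k::comm_ring_1) \<times> ('g list \<Rightarrow> 'k)) set \<Rightarrow> ('k, ('g list \<Rightarrow> 'k) set) module"
where
  "presented_algebra G R =
    quotient_algebra (monoid_algebra (free_monoid G)) (relation_ideal (monoid_algebra (free_monoid G)) R)"

definition presented_generator ::
  "'g set \<Rightarrow> (('g list \<Rightarrow> 'k::comm_ring_1) \<times> ('g list \<Rightarrow> 'k)) set \<Rightarrow> 'g \<Rightarrow> ('g list \<Rightarrow> 'k) set"
where
  "presented_generator G R g =
    relation_ideal (monoid_algebra (free_monoid G)) R
      +>\<^bsub>monoid_algebra (free_monoid G)\<^esub> monoid_basis [g]"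

text \<open>
  The tensor product of \<open>k\<close> and \<open>A\<close> over \<open>K\<close>, where \<open>k\<close> is a \<open>K\<close>-algebra via \<open>\<phi>\<close>: the free
  \<open>k\<close>-module on symbols \<open>1 \<otimes> a\<close> (\<open>a\<close> in \<open>A\<close>), with the multiplication induced by that of
  \<open>A\<close>, modulo additivity and \<open>1 \<otimes> ca = \<phi> c (1 \<otimes> a)\<close>. The \<open>k\<close>-submodule
  spanned by these relators is a two-sided ideal, so it agrees with the ideal they generate.
\<close>

definition tensor_relations ::
  "('r::comm_ring_1 \<Rightarrow> 'k::comm_ring_1) \<Rightarrow> ('r, 'a, 'z) module_scheme \<Rightarrow> (('a \<Rightarrow> 'k) \<times> ('a \<Rightarrow> 'k)) set"
where
  "tensor_relations \<phi> A =
    {(monoid_basis (a \<oplus>\<^bsub>A\<^esub> b), monoid_basis a \<oplus>\<^bsub>monoid_algebra A\<^esub> monoid_basis b)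
      | a b. a \<in> carrier A \<and> b \<in> carrier A} \<union>
    {(monoid_basis (c \<odot>\<^bsub>A\<^esub> a), \<phi> c \<odot>\<^bsub>monoid_algebra A\<^esub> monoid_basis a)
      | c a. a \<in> carrier A}"

definition extend_scalars ::
  "('r::comm_ring_1 \<Rightarrow> 'k::comm_ring_1) \<Rightarrow> ('r, 'a, 'z) module_scheme \<Rightarrow> ('k, ('a \<Rightarrow> 'k) set) module"
where
  "extend_scalars \<phi> A =
    quotient_algebra (monoid_algebra A) (relation_ideal (monoid_algebra A) (tensor_relations \<phi> A))"

definition extend_elt ::
  "('r::comm_ring_1 \<Rightarrow> 'k::comm_ring_1) \<Rightarrow> ('r, 'a, 'z) module_scheme \<Rightarrow> 'a \<Rightarrow> ('a \<Rightarrow> 'k) set"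
where
  "extend_elt \<phi> A a =
    relation_ideal (monoid_algebra A) (tensor_relations \<phi> A) +>\<^bsub>monoid_algebra A\<^esub> monoid_basis a"

definition left_genideal :: "('a, 'z) ring_scheme \<Rightarrow> 'a set \<Rightarrow> 'a set" where
  "left_genideal A S =
    \<Inter>{I. additive_subgroup I A \<and> (\<forall>a\<in>carrier A. \<forall>x\<in>I. a \<otimes>\<^bsub>A\<^esub> x \<in> I) \<and> S \<subseteq> I}"

definition sum_of_ideals :: "('a, 'z) ring_scheme \<Rightarrow> ('i \<Rightarrow> 'a set) \<Rightarrow> 'i set \<Rightarrow> 'a set" where
  "sum_of_ideals A I X = {(\<Oplus>\<^bsub>A\<^esub>i\<in>X. f i) | f. \<forall>i\<in>X. f i \<in> I i}"

definition linear_span :: "('k, 'a, 'z) module_scheme \<Rightarrow> 'a set \<Rightarrow> 'a set" where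
  "linear_span A S = {(\<Oplus>\<^bsub>A\<^esub>v\<in>T. c v \<odot>\<^bsub>A\<^esub> v) | c T. finite T \<and> T \<subseteq> S}"

definition independent_mod :: "('k::zero, 'a, 'z) module_scheme \<Rightarrow> 'a set \<Rightarrow> 'a set \<Rightarrow> bool" where
  "independent_mod A S J \<longleftrightarrow>
    (\<forall>T c. finite T \<and> T \<subseteq> S \<and> (\<Oplus>\<^bsub>A\<^esub>v\<in>T. c v \<odot>\<^bsub>A\<^esub> v) \<in> J \<longrightarrow> (\<forall>v\<in>T. c v = 0))"

definition basis_mod :: "('k::zero, 'a, 'z) module_scheme \<Rightarrow> 'a set \<Rightarrow> 'a set \<Rightarrow> 'a set \<Rightarrow> bool" where
  "basis_mod A S M J \<longleftrightarrow>
    S \<subseteq> M \<and> J \<subseteq> M \<and> independent_mod A S J \<and> linear_span A S <+>\<^bsub>A\<^esub> J = M"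

definition linear_anti_automorphism :: "('k, 'a, 'z) module_scheme \<Rightarrow> ('a \<Rightarrow> 'a) \<Rightarrow> bool" where
  "linear_anti_automorphism A f \<longleftrightarrow>
    bij_betw f (carrier A) (carrier A) \<and> f \<one>\<^bsub>A\<^esub> = \<one>\<^bsub>A\<^esub> \<and>
    (\<forall>a\<in>carrier A. \<forall>b\<in>carrier A. f (a \<oplus>\<^bsub>A\<^esub> b) = f a \<oplus>\<^bsub>A\<^esub> f b) \<and>
    (\<forall>c. \<forall>a\<in>carrier A. f (c \<odot>\<^bsub>A\<^esub> a) = c \<odot>\<^bsub>A\<^esub> f a) \<and>
    (\<forall>a\<in>carrier A. \<forall>b\<in>carrier A. f (a \<otimes>\<^bsub>A\<^esub> b) = f b \<otimes>\<^bsub>A\<^esub> f a)"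

datatype gen = Gen_e | Gen_U nat

definition gens :: "nat \<Rightarrow> gen set" where
  "gens n = insert Gen_e (Gen_U ` {1..<n})"

definition unit_inverse :: "'r::comm_ring_1 \<Rightarrow> 'r" where
  "unit_inverse a = (THE b. a * b = 1)"

definition monom_word :: "'r::comm_ring_1 \<Rightarrow> gen list \<Rightarrow> gen list \<Rightarrow> 'r" where
  "monom_word c w = (\<lambda>v. if v = w then c else 0)"

definition b_relations ::
  "'r::comm_ring_1 \<Rightarrow> 'r \<Rightarrow> 'r \<Rightarrow> nat \<Rightarrow> ((gen list \<Rightarrow> 'r) \<times> (gen list \<Rightarrow> 'r)) set"
where
  "b_relations x \<gamma> \<delta> n =
    {(monom_word 1 [Gen_U i, Gen_U i], monom_word (x^2 + unit_inverse (x^2)) [Gen_U i]) | i. i \<in> {1..<n}} \<union>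
    {(monom_word 1 [Gen_U i, Gen_U j, Gen_U i], monom_word 1 [Gen_U i])
      | i j. i \<in> {1..<n} \<and> j \<in> {1..<n} \<and> (j = i + 1 \<or> i = j + 1)} \<union>
    {(monom_word 1 [Gen_U i, Gen_U j], monom_word 1 [Gen_U j, Gen_U i])
      | i j. i \<in> {1..<n} \<and> j \<in> {1..<n} \<and> j \<noteq> i + 1 \<and> i \<noteq> j + 1} \<union>
    {(monom_word 1 [Gen_U i, Gen_e, Gen_U i], monom_word \<gamma> [Gen_U i]) | i. i \<in> {1..<n} \<and> i = 1} \<union>
    {(monom_word 1 [Gen_e, Gen_e], monom_word \<delta> [Gen_e])} \<union>
    {(monom_word 1 [Gen_U i, Gen_e], monom_word 1 [Gen_e, Gen_U i]) | i. i \<in> {1..<n} \<and> i \<noteq> 1}"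

definition b_integral ::
  "'r::comm_ring_1 \<Rightarrow> 'r \<Rightarrow> 'r \<Rightarrow> nat \<Rightarrow> ('r, (gen list \<Rightarrow> 'r) set) module"
where
  "b_integral x \<gamma> \<delta> n = presented_algebra (gens n) (b_relations x \<gamma> \<delta> n)"

type_synonym ('r, 'k) b_elt = "((gen list \<Rightarrow> 'r) set \<Rightarrow> 'k) set"

definition b_alg ::
  "('r::comm_ring_1 \<Rightarrow> 'k::field) \<Rightarrow> 'r \<Rightarrow> 'r \<Rightarrow> 'r \<Rightarrow> nat \<Rightarrow> ('k, ('r, 'k) b_elt) module"
where
  "b_alg \<phi> x \<gamma> \<delta> n = extend_scalars \<phi> (b_integral x \<gamma> \<delta> n)"

definition b_gen ::
  "('r::comm_ring_1 \<Rightarrow> 'k::field) \<Rightarrow> 'r \<Rightarrow> 'r \<Rightarrow> 'r \<Rightarrow> nat \<Rightarrow> gen \<Rightarrow> ('r, 'k) b_elt"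
where
  "b_gen \<phi> x \<gamma> \<delta> n g =
    extend_elt \<phi> (b_integral x \<gamma> \<delta> n) (presented_generator (gens n) (b_relations x \<gamma> \<delta> n) g)"

text \<open>
  From here on \<open>B\<close> is an algebra and \<open>u\<close> gives the images in \<open>B\<close> of the generators.
\<close>

definition word_val :: "('a, 'z) monoid_scheme \<Rightarrow> (gen \<Rightarrow> 'a) \<Rightarrow> gen list \<Rightarrow> 'a" where
  "word_val B u w = foldr (\<lambda>g a. u g \<otimes>\<^bsub>B\<^esub> a) w \<one>\<^bsub>B\<^esub>"

definition E_word :: "nat \<Rightarrow> nat \<Rightarrow> gen list" where
  "E_word n m = map (\<lambda>i. Gen_U (2 * i + 1)) [0..<(n - m) div 2]"

definition E_plus_word :: "nat \<Rightarrow> nat \<Rightarrow> gen list" where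
  "E_plus_word n m = E_word n m @ [Gen_e] @ map (\<lambda>i. Gen_U (2 * i)) [1..<(n - m) div 2 + 1] @ E_word n m"

definition F_word :: "nat \<Rightarrow> int \<Rightarrow> gen list" where
  "F_word n m = (if m > 0 then E_plus_word n (nat m) else E_word n (nat (- m)))"

text \<open>
  The word on the edge from \<open>(j, l)\<close> to \<open>(j + 1, l')\<close>; only the values with
  \<open>l' = l + 1\<close> or \<open>l' = l - 1\<close> are used, and \<open>j\<close> is even when \<open>l = 0\<close>.
\<close>

definition edge_word :: "nat \<Rightarrow> int \<Rightarrow> int \<Rightarrow> gen list" where
  "edge_word j l l' =
    (if l = 0 then
       if l' = 1 then
         [Gen_e] @ map (\<lambda>i. Gen_U (2 * i)) (rev [1..<j div 2 + 1])
             @ map (\<lambda>i. Gen_U (2 * i - 1)) (rev [1..<j div 2 + 1])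
       else []
     else if \<bar>l'\<bar> = \<bar>l\<bar> - 1 then map Gen_U (rev [1..<j + 1])
     else [])"

text \<open>A walk is given by the list of the weights of its vertices at levels \<open>0, \<dots>, n\<close>.\<close>

definition walks :: "nat \<Rightarrow> int \<Rightarrow> int list set" where
  "walks n m =
    {p. length p = n + 1 \<and> p ! 0 = 0 \<and> p ! n = m \<and>
        (\<forall>j<n. p ! (j + 1) = p ! j + 1 \<or> p ! (j + 1) = p ! j - 1)}"

definition walk_word :: "int list \<Rightarrow> gen list" where
  "walk_word p = concat (map (\<lambda>j. edge_word j (p ! j) (p ! (j + 1))) [0..<length p - 1])"

definition walk_set :: "('a, 'z) monoid_scheme \<Rightarrow> (gen \<Rightarrow> 'a) \<Rightarrow> nat \<Rightarrow> int \<Rightarrow> 'a set" where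
  "walk_set B u n m = {word_val B u (walk_word p) | p. p \<in> walks n m}"

definition weights :: "nat \<Rightarrow> int set" where
  "weights n = {m. \<bar>m\<bar> \<le> int n \<and> even (m - int n)}"

text \<open>
  Extensionality only fixes the value outside the carrier, so that the anti-automorphism is unique.
\<close>

definition reverse_map ::
  "('k, 'a, 'z) module_scheme \<Rightarrow> (gen \<Rightarrow> 'a) \<Rightarrow> nat \<Rightarrow> 'a \<Rightarrow> 'a"
where
  "reverse_map B u n =
    (THE f. linear_anti_automorphism B f \<and> (\<forall>g\<in>gens n. f (u g) = u g) \<and> f \<in> extensional (carrier B))"

text \<open>
  \<open>s\<close> is an admissible choice of words \<open>s(n, m)\<close>: the walk set consists of the products
  \<open>a F\<close> with \<open>a\<close> in \<open>s\<close>.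
\<close>

definition is_factor_set ::
  "('a, 'z) monoid_scheme \<Rightarrow> (gen \<Rightarrow> 'a) \<Rightarrow> nat \<Rightarrow> int \<Rightarrow> gen list set \<Rightarrow> bool"
where
  "is_factor_set B u n m s \<longleftrightarrow>
    s \<subseteq> lists (gens n) \<and>
    walk_set B u n m = {word_val B u a \<otimes>\<^bsub>B\<^esub> word_val B u (F_word n m) | a. a \<in> s}"

definition square_set ::
  "('k, 'a, 'z) module_scheme \<Rightarrow> (gen \<Rightarrow> 'a) \<Rightarrow> nat \<Rightarrow> int \<Rightarrow> gen list set \<Rightarrow> 'a set"
where
  "square_set B u n m s =
    {word_val B u a \<otimes>\<^bsub>B\<^esub> word_val B u (F_word n m) \<otimes>\<^bsub>B\<^esub> reverse_map B u n (word_val B u b)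
      | a b. a \<in> s \<and> b \<in> s}"

end

theory Submission
  imports Defs
begin

text \<open>
  Spanning is a rewriting argument: a word times \<open>F\<^sub>m\<close> is, up to a scalar, a walk word of weight \<open>m\<close>, unless
  two through lines of \<open>F\<^sub>m\<close> get joined or, for \<open>m < 0\<close>, its leftmost line receives a blob; then the product
  lies in an ideal of smaller weight. The induction is over \<open>n\<close>, along the last edge of a walk.
  Independence comes from an action of \<open>b\<^sub>n\<close> on blobbed perfect matchings of two rows of points: the
  top half of the diagram of a walk word determines the walk, and a product \<open>a F\<^sub>m b\<^sup>o\<close> acts on the
  identity diagram with coefficient \<open>1\<close> and with the top halves of \<open>a F\<^sub>m\<close> and \<open>b F\<^sub>m\<close> as its two halves.
  The coefficients of these diagrams are functionals dual to the products \<open>a F\<^sub>m b\<^sup>o\<close>. They also show that reversing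
  words is well defined, since reversal mirrors diagrams.
\<close>

subsection \<open>Straightening words\<close>

text \<open>The parameters \<gamma> and \<delta> are arbitrary, zero included, so an equation v = a
  w between words cannot be solved for w: rewriting is directed, and reversible only for the scalar
  1. For the same reason independence has to rest on coefficients that are exactly 1 rather than on
  a bilinear form. The order in which smaller ideals are divided out is forced by geometry: through
  lines disappear in pairs, which lowers |m| by 2, and a blob on the leftmost line stays as long as
  that line does, since e e = \<delta> e; so for m > 0 the unblobbed weight -m lies above the
  blobbed weight m. One abstract congruence on words, \<open>blob_rewriting\<close>, serves both
  halves of the argument: read in the algebra it yields spanning, read as operators on diagrams it
  simplifies words acting on them. Diagrams have infinitely many points in each row, so all levels n
  share one space and opening a through line changes nothing. As the algebra is a scalar extension
  of a presented one, a functional on it exists only once compatibility with the relations is known;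
  therefore the action on diagrams is checked against the relations before any coefficient is read
  off.\<close>

abbreviation (input) U :: "nat \<Rightarrow> gen" where "U \<equiv> Gen_U"

definition dn :: "nat \<Rightarrow> nat \<Rightarrow> gen list" where
  "dn a b = map Gen_U (rev [b..<Suc a])"

text \<open>The word E_m(n) with \<open>c = (n - m) div 2\<close>. Indexing by the number of cups
  makes the words of all levels with equally many cups literally equal, which
  \<open>F_word_open\<close> exploits.\<close>

definition cups :: "nat \<Rightarrow> gen list" where
  "cups c = map (\<lambda>i. Gen_U (2 * i + 1)) [0..<c]"

definition evens :: "nat \<Rightarrow> gen list" where
  "evens c = map (\<lambda>i. Gen_U (2 * i)) [1..<c + 1]"

text \<open>The blobbed word E_m+(n) with \<open>c\<close> cups. Between the two rows of cups the
  letters \<open>evens\<close> make the leftmost through line zigzag to the left edge, where it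
  meets the blob, and back.\<close>

definition blobbed_cups :: "nat \<Rightarrow> gen list" where
  "blobbed_cups c = cups c @ [Gen_e] @ evens c @ cups c"

text \<open>Pairs of letters that may be exchanged freely: those with a commutation relation, and
  also equal letters, so that \<open>rev_sim\<close> can compare a word with itself.\<close>

fun far :: "gen \<Rightarrow> gen \<Rightarrow> bool" where
  "far (Gen_U i) (Gen_U j) = (j \<noteq> i + 1 \<and> i \<noteq> j + 1)"
| "far Gen_e (Gen_U j) = (j \<noteq> 1)"
| "far (Gen_U i) Gen_e = (i \<noteq> 1)"
| "far Gen_e Gen_e = True"

lemma dn_Nil [simp]: "a < b \<Longrightarrow> dn a b = []"
  by (simp add: dn_def)

lemma dn_split: "b \<le> Suc c \<Longrightarrow> c \<le> a \<Longrightarrow> dn a b = dn a (Suc c) @ dn c b"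
  using upt_add_eq_append[of b "Suc c" "a - c"] by (simp add: dn_def flip: rev_append map_append)

lemma dn_Cons: "1 \<le> b \<Longrightarrow> b \<le> a \<Longrightarrow> dn a b = U a # dn (a - 1) b"
  by (cases a) (auto simp: dn_def)

lemma dn_snoc: "b \<le> a \<Longrightarrow> dn a b = dn a (Suc b) @ [U b]"
  by (simp add: dn_def upt_conv_Cons del: upt_Suc)

lemma dn_single [simp]: "dn a a = [U a]"
  by (simp add: dn_def)

lemma set_dn [simp]: "set (dn a b) = U ` {b..a}"
  by (auto simp: dn_def)

lemma cups_0 [simp]: "cups 0 = []" and evens_0 [simp]: "evens 0 = []"
  by (simp_all add: cups_def evens_def)

lemma cups_Suc: "cups (Suc c) = cups c @ [U (2 * c + 1)]"
  by (simp add: cups_def)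

lemma evens_Suc: "evens (Suc c) = evens c @ [U (2 * c + 2)]"
  by (simp add: evens_def)

lemma set_cups [simp]: "set (cups c) = (\<lambda>i. U (2 * i + 1)) ` {0..<c}"
  by (auto simp: cups_def)

lemma set_evens [simp]: "set (evens c) = (\<lambda>i. U (2 * i)) ` {1..<c + 1}"
  by (auto simp: evens_def)

lemma gens_U [simp]: "U i \<in> gens n \<longleftrightarrow> 1 \<le> i \<and> i < n" and gens_e [simp]: "Gen_e \<in> gens n"
  by (auto simp: gens_def)

lemma gens_mono: "m \<le> n \<Longrightarrow> gens m \<subseteq> gens n"
  by (auto simp: gens_def)

text \<open>\<open>eqv a v w\<close> reads v = a w; symmetry is assumed for the scalar 1 alone
  because a may be zero. Words are unrestricted and only the rules mention the bound
  \<open>N\<close>, so an identity between words of a small level can be used inside words of any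
  larger one.\<close>

locale blob_rewriting =
  fixes N :: nat
    and eqv :: "'k::comm_ring_1 \<Rightarrow> gen list \<Rightarrow> gen list \<Rightarrow> bool"
    and q2 \<gamma> \<delta> :: 'k
  assumes eqv_refl: "eqv 1 v v"
    and eqv_trans: "eqv a v w \<Longrightarrow> eqv b w x \<Longrightarrow> eqv (a * b) v x"
    and eqv_sym: "eqv 1 v w \<Longrightarrow> eqv 1 w v"
    and eqv_ctx: "eqv a v w \<Longrightarrow> eqv a (x @ v @ y) (x @ w @ y)"
    and eqv_UU: "1 \<le> i \<Longrightarrow> i < N \<Longrightarrow> eqv q2 [U i, U i] [U i]"
    and eqv_UUU: "\<lbrakk>1 \<le> i; i < N; 1 \<le> j; j < N; j = i + 1 \<or> i = j + 1\<rbrakk> \<Longrightarrow>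
      eqv 1 [U i, U j, U i] [U i]"
    and eqv_comm: "\<lbrakk>1 \<le> i; i < N; 1 \<le> j; j < N; j \<noteq> i + 1; i \<noteq> j + 1\<rbrakk> \<Longrightarrow>
      eqv 1 [U i, U j] [U j, U i]"
    and eqv_UeU: "1 < N \<Longrightarrow> eqv \<gamma> [U 1, Gen_e, U 1] [U 1]"
    and eqv_ee: "eqv \<delta> [Gen_e, Gen_e] [Gen_e]"
    and eqv_Ue: "\<lbrakk>1 \<le> i; i < N; i \<noteq> 1\<rbrakk> \<Longrightarrow> eqv 1 [U i, Gen_e] [Gen_e, U i]"
begin

abbreviation sim (infix "\<approx>" 50) where "v \<approx> w \<equiv> eqv 1 v w"

lemma sim_trans [trans]: "v \<approx> w \<Longrightarrow> w \<approx> x \<Longrightarrow> v \<approx> x"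
  using eqv_trans[of 1 v w 1 x] by simp

lemma sim_eqv_trans [trans]: "v \<approx> w \<Longrightarrow> eqv a w x \<Longrightarrow> eqv a v x"
  using eqv_trans[of 1 v w a x] by simp

lemma eqv_sim_trans [trans]: "eqv a v w \<Longrightarrow> w \<approx> x \<Longrightarrow> eqv a v x"
  using eqv_trans[of a v w 1 x] by simp

lemma eqv_pre: "eqv a v w \<Longrightarrow> eqv a (x @ v) (x @ w)"
  using eqv_ctx[of a v w x "[]"] by simp

lemma eqv_post: "eqv a v w \<Longrightarrow> eqv a (v @ y) (w @ y)"
  using eqv_ctx[of a v w "[]" y] by simp

lemma letter_comm:
  assumes "g \<in> gens N" "h \<in> gens N" "far g h"
  shows "[g, h] \<approx> [h, g]"
proof (cases g)
  case Gen_e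
  then show ?thesis using assms eqv_refl eqv_sym eqv_Ue by (cases h) auto
next
  case (Gen_U i)
  then show ?thesis using assms eqv_comm eqv_Ue by (cases h) auto
qed

lemma letter_word_comm:
  assumes "g \<in> gens N" "set w \<subseteq> gens N" "\<forall>h\<in>set w. far g h"
  shows "g # w \<approx> w @ [g]"
  using assms(2,3)
proof (induction w)
  case Nil
  then show ?case by (simp add: eqv_refl)
next
  case (Cons h w)
  have "g # h # w \<approx> h # g # w"
    using eqv_post[OF letter_comm[of g h], of w] Cons.prems assms(1) by simp
  also have "h # g # w \<approx> h # w @ [g]"
    using eqv_pre[OF Cons.IH, of "[h]"] Cons.prems by simp
  finally show ?case by simp
qed

lemma word_comm:
  assumes "set v \<subseteq> gens N" "set w \<subseteq> gens N" "\<forall>g\<in>set v. \<forall>h\<in>set w. far g h"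
  shows "v @ w \<approx> w @ v"
  using assms(1,3)
proof (induction v)
  case Nil
  then show ?case by (simp add: eqv_refl)
next
  case (Cons g v)
  have "g # v @ w \<approx> g # w @ v"
    using eqv_pre[OF Cons.IH, of "[g]"] Cons.prems by simp
  also have "g # w @ v \<approx> w @ g # v"
    using eqv_post[OF letter_word_comm[of g w], of v] Cons.prems assms(2) by simp
  finally show ?case by simp
qed

lemma rev_sim:
  assumes "set v \<subseteq> gens N" "\<forall>g\<in>set v. \<forall>h\<in>set v. far g h"
  shows "rev v \<approx> v"
  using assms
proof (induction v)
  case Nil
  then show ?case by (simp add: eqv_refl)
next
  case (Cons g v)
  have "rev (g # v) \<approx> v @ [g]"
    using eqv_post[OF Cons.IH, of "[g]"] Cons.prems by simp
  also have "v @ [g] \<approx> g # v"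
    using word_comm[of v "[g]"] Cons.prems by auto
  finally show ?case .
qed

text \<open>In the diagram of \<open>dn a b\<close> the strings starting at the top positions b,
  ..., a - 1 end two places further right, so a turn at i above it reappears at i + 2 below.
  Algebraically U_i is absorbed by U_i U_(i+1) U_i = U_i, and the letter i + 2 is created by the
  same relation read backwards.\<close>

lemma dn_shift:
  assumes "1 \<le> b" "b \<le> i" "i + 2 \<le> a" "a < N"
  shows "U i # dn a b \<approx> dn a b @ [U (i + 2)]"
proof -
  have s: "dn a b = dn a (i + 3) @ [U (i + 2), U (i + 1), U i] @ dn (i - 1) b"
    using dn_split[of b "i + 2" a] assms by (simp add: dn_Cons eval_nat_numeral)
  have "[U i] @ dn a b \<approx> dn a (i + 3) @ [U (i + 2)] @ [U i] @ [U (i + 1), U i] @ dn (i - 1) b"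
    using eqv_post[OF word_comm[of "[U i]" "dn a (i + 3) @ [U (i + 2)]"], of "[U (i + 1), U i] @ dn (i - 1) b"] assms
    by (force simp: s)
  also have "\<dots> \<approx> dn a (i + 3) @ [U (i + 2)] @ [U i] @ dn (i - 1) b"
    using eqv_ctx[OF eqv_UUU[of i "i + 1"], of "dn a (i + 3) @ [U (i + 2)]" "dn (i - 1) b"] assms
    by simp
  also have "\<dots> \<approx> dn a (i + 3) @ [U (i + 2), U (i + 1), U (i + 2)] @ [U i] @ dn (i - 1) b"
    using eqv_ctx[OF eqv_sym[OF eqv_UUU[of "i + 2" "i + 1"]], of "dn a (i + 3)" "[U i] @ dn (i - 1) b"] assms
    by simp
  also have "\<dots> \<approx> dn a (i + 3) @ [U (i + 2), U (i + 1)] @ ([U i] @ dn (i - 1) b) @ [U (i + 2)]"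
    using eqv_pre[OF word_comm[of "[U (i + 2)]" "[U i] @ dn (i - 1) b"], of "dn a (i + 3) @ [U (i + 2), U (i + 1)]"] assms
    by force
  finally show ?thesis by (simp add: s)
qed

lemma dn_absorb:
  assumes "1 \<le> b" "b < a" "a < N"
  shows "U (a - 1) # dn a b \<approx> dn (a - 1) b"
proof -
  have s: "dn a b = U a # U (a - 1) # dn (a - 2) b" "dn (a - 1) b = U (a - 1) # dn (a - 2) b"
    using assms dn_Cons[of b a] dn_Cons[of b "a - 1"] by (auto simp: numeral_2_eq_2)
  show ?thesis
    using eqv_post[OF eqv_UUU[of "a - 1" a], of "dn (a - 2) b"] assms unfolding s by simp
qed

lemma cups_rev: "2 * k \<le> N \<Longrightarrow> rev (cups k) \<approx> cups k"
  by (rule rev_sim) (auto, presburger+)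

lemma evens_rev: "2 * k < N \<Longrightarrow> rev (evens k) \<approx> evens k"
  by (rule rev_sim) (auto, presburger+)

lemma cups_Suc': "2 * k + 1 < N \<Longrightarrow> [U (2 * k + 1)] @ cups k \<approx> cups (Suc k)"
  unfolding cups_Suc by (rule word_comm) auto

text \<open>All strings of \<open>dn (2 * k) 1\<close> are bent back by the cups and straighten. The
  topmost cup swallows the first two letters; it then commutes to the front, leaving the shorter
  instance.\<close>

lemma cups_dn: "2 * k < N \<Longrightarrow> cups k @ dn (2 * k) 1 \<approx> cups k"
proof (induction k)
  case 0
  then show ?case by (simp add: eqv_refl)
next
  case (Suc k)
  have s: "dn (2 * Suc k) 1 = [U (2 * k + 2), U (2 * k + 1)] @ dn (2 * k) 1"
    by (simp add: dn_Cons)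
  have "cups (Suc k) @ dn (2 * Suc k) 1 \<approx> cups k @ [U (2 * k + 1)] @ dn (2 * k) 1"
    using eqv_ctx[OF eqv_UUU[of "2 * k + 1" "2 * k + 2"], of "cups k" "dn (2 * k) 1"] Suc.prems
    unfolding s cups_Suc by simp
  also have "\<dots> \<approx> [U (2 * k + 1)] @ cups k @ dn (2 * k) 1"
    using eqv_post[OF eqv_sym[OF cups_Suc'[of k]], of "dn (2 * k) 1"] Suc.prems by (simp add: cups_Suc)
  also have "\<dots> \<approx> [U (2 * k + 1)] @ cups k"
    using eqv_pre[OF Suc.IH, of "[U (2 * k + 1)]"] Suc.prems by simp
  also have "\<dots> \<approx> cups (Suc k)"
    using cups_Suc' Suc.prems by simp
  finally show ?case .
qed

text \<open>Letters up to 2k straighten out against the cups, the letter 2k + 1 becomes the next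
  cup, and the larger letters survive in front. This is the effect of a closing edge on an unblobbed
  F word.\<close>

lemma cups_dn_shift:
  assumes "2 * k + 1 \<le> a" "a < N"
  shows "cups k @ dn a 1 \<approx> dn a (2 * k + 2) @ cups (Suc k)"
proof -
  have "dn a 1 = dn a (2 * k + 1) @ dn (2 * k) 1"
    using dn_split[of 1 "2 * k" a] assms by simp
  then have "cups k @ dn a 1 = (cups k @ dn a (2 * k + 1)) @ dn (2 * k) 1"
    by simp
  also have "\<dots> \<approx> (dn a (2 * k + 1) @ cups k) @ dn (2 * k) 1"
    by (rule eqv_post, rule word_comm) (use assms in auto)
  also have "(dn a (2 * k + 1) @ cups k) @ dn (2 * k) 1 \<approx> dn a (2 * k + 1) @ cups k"
    using eqv_pre[OF cups_dn] assms by simp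
  also have "dn a (2 * k + 1) @ cups k \<approx> dn a (2 * k + 2) @ cups (Suc k)"
    using eqv_pre[OF cups_Suc', of k "dn a (2 * k + 2)"] assms by (simp add: dn_snoc)
  finally show ?thesis .
qed

lemma blobbed_cups_dn:
  assumes "2 * k + 1 \<le> a" "a < N"
  shows "blobbed_cups k @ dn a 1 \<approx> dn a (2 * k + 2) @ cups k @ [Gen_e] @ evens k @ cups (Suc k)"
proof -
  have "blobbed_cups k @ dn a 1 \<approx> (cups k @ [Gen_e] @ evens k) @ dn a (2 * k + 2) @ cups (Suc k)"
    using eqv_pre[OF cups_dn_shift[OF assms], of "cups k @ [Gen_e] @ evens k"] by (simp add: blobbed_cups_def)
  also have "\<dots> \<approx> dn a (2 * k + 2) @ (cups k @ [Gen_e] @ evens k) @ cups (Suc k)"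
    using eqv_post[OF word_comm[of "cups k @ [Gen_e] @ evens k" "dn a (2 * k + 2)"], of "cups (Suc k)"] assms
    by fastforce
  finally show ?thesis by simp
qed

text \<open>The zigzag formed by the last cup and the last letter of \<open>evens\<close> is
  straightened by the letter 2k + 2 standing in front. This letter is available only if a second
  through line exists.\<close>

lemma blobbed_cups_shift_top:
  assumes "2 * k + 2 < N"
  shows "[U (2 * k + 2)] @ blobbed_cups (Suc k) \<approx> [U (2 * k + 2)] @ cups k @ [Gen_e] @ evens k @ cups (Suc k)"
proof -
  let ?u = "[U (2 * k + 2)]" and ?v = "[U (2 * k + 1)]"
  have "?u @ blobbed_cups (Suc k) = ?u @ cups k @ ?v @ ([Gen_e] @ evens k) @ ?u @ cups (Suc k)"
    by (simp add: blobbed_cups_def cups_Suc evens_Suc)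
  also have "\<dots> \<approx> ?u @ cups k @ ?v @ (?u @ [Gen_e] @ evens k) @ cups (Suc k)"
    using eqv_ctx[OF word_comm[of "[Gen_e] @ evens k" ?u], of "?u @ cups k @ ?v" "cups (Suc k)"] assms
    by fastforce
  also have "\<dots> \<approx> (cups k @ ?u) @ ?v @ (?u @ [Gen_e] @ evens k) @ cups (Suc k)"
    using eqv_post[OF word_comm[of ?u "cups k"], of "?v @ (?u @ [Gen_e] @ evens k) @ cups (Suc k)"] assms
    by fastforce
  also have "\<dots> = cups k @ (?u @ ?v @ ?u) @ [Gen_e] @ evens k @ cups (Suc k)"
    by simp
  also have "\<dots> \<approx> cups k @ ?u @ [Gen_e] @ evens k @ cups (Suc k)"
    using eqv_ctx[OF eqv_UUU[of "2 * k + 2" "2 * k + 1"], of "cups k" "[Gen_e] @ evens k @ cups (Suc k)"] assms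
    by simp
  also have "\<dots> \<approx> ?u @ cups k @ [Gen_e] @ evens k @ cups (Suc k)"
    using eqv_post[OF word_comm[of "cups k" ?u], of "[Gen_e] @ evens k @ cups (Suc k)"] assms
    by fastforce
  finally show ?thesis .
qed

text \<open>Counterpart of \<open>cups_dn_shift\<close> for a blobbed leftmost line. For a = 2k + 1
  that line itself is closed off, and the blob ends up in the prefix instead; this is
  \<open>F_word_close_1\<close>.\<close>

lemma blobbed_cups_dn_shift:
  assumes "2 * k + 2 \<le> a" "a < N"
  shows "blobbed_cups k @ dn a 1 \<approx> dn a (2 * k + 2) @ blobbed_cups (Suc k)"
proof -
  have s: "dn a (2 * k + 2) = dn a (2 * k + 3) @ [U (2 * k + 2)]"
    using dn_snoc[of "2 * k + 2" a] assms by (simp add: eval_nat_numeral)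
  have "blobbed_cups k @ dn a 1 \<approx> dn a (2 * k + 2) @ cups k @ [Gen_e] @ evens k @ cups (Suc k)"
    using blobbed_cups_dn assms by simp
  also have "\<dots> \<approx> dn a (2 * k + 2) @ blobbed_cups (Suc k)"
    using eqv_pre[OF eqv_sym[OF blobbed_cups_shift_top], of k "dn a (2 * k + 3)"] assms unfolding s by simp
  finally show ?thesis .
qed

text \<open>All arcs between the two rows of cups form one closed loop, and it carries the blob;
  hence a single factor \<gamma>, generalising U_1 e U_1 = \<gamma> U_1. Each induction step removes
  one zigzag of the loop.\<close>

lemma cups_blob_cups:
  assumes "2 * k + 1 < N"
  shows "eqv \<gamma> (cups (Suc k) @ [Gen_e] @ evens k @ cups (Suc k)) (cups (Suc k))"
  using assms
proof (induction k)
  case 0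
  then show ?case using eqv_UeU by (simp add: cups_Suc)
next
  case (Suc k)
  let ?u = "[U (2 * k + 3)]" and ?v = "[U (2 * k + 2)]"
  have c2: "cups (Suc (Suc k)) = cups (Suc k) @ ?u"
    by (simp add: cups_Suc eval_nat_numeral)
  have c3: "cups (Suc k) @ ?u \<approx> ?u @ cups (Suc k)"
    by (rule word_comm) (use Suc.prems in auto)
  have "cups (Suc (Suc k)) @ [Gen_e] @ evens (Suc k) @ cups (Suc (Suc k))
      \<approx> cups (Suc k) @ ?u @ [Gen_e] @ evens k @ ?v @ ?u @ cups (Suc k)"
    using eqv_pre[OF c3, of "cups (Suc k) @ ?u @ [Gen_e] @ evens k @ ?v"] by (simp add: c2 evens_Suc)
  also have "\<dots> \<approx> cups (Suc k) @ [Gen_e] @ evens k @ ?u @ ?v @ ?u @ cups (Suc k)"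
    using eqv_ctx[OF word_comm[of ?u "[Gen_e] @ evens k"], of "cups (Suc k)" "?v @ ?u @ cups (Suc k)"] Suc.prems
    by fastforce
  also have "\<dots> \<approx> cups (Suc k) @ [Gen_e] @ evens k @ ?u @ cups (Suc k)"
    using eqv_ctx[OF eqv_UUU[of "2 * k + 3" "2 * k + 2"], of "cups (Suc k) @ [Gen_e] @ evens k" "cups (Suc k)"] Suc.prems
    by simp
  also have "\<dots> \<approx> cups (Suc k) @ [Gen_e] @ evens k @ cups (Suc k) @ ?u"
    using eqv_pre[OF eqv_sym[OF c3], of "cups (Suc k) @ [Gen_e] @ evens k"] by simp
  also have "eqv \<gamma> \<dots> (cups (Suc k) @ ?u)"
    using eqv_post[OF Suc.IH, of ?u] Suc.prems by simp
  finally show ?case by (simp add: c2)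
qed

lemma evens_cups_evens: "2 * k < N \<Longrightarrow> evens k @ cups k @ evens k \<approx> evens k"
proof (induction k)
  case 0
  then show ?case by (simp add: eqv_refl)
next
  case (Suc k)
  let ?u = "[U (2 * k + 2)]" and ?v = "[U (2 * k + 1)]"
  have c: "evens k @ ?u \<approx> ?u @ evens k" "?u @ cups k \<approx> cups k @ ?u"
    by (rule word_comm; use Suc.prems in force)+
  have "evens (Suc k) @ cups (Suc k) @ evens (Suc k) = evens k @ ?u @ cups k @ ?v @ evens k @ ?u"
    by (simp add: evens_Suc cups_Suc)
  also have "\<dots> \<approx> evens k @ ?u @ cups k @ ?v @ ?u @ evens k"
    using eqv_pre[OF c(1), of "evens k @ ?u @ cups k @ ?v"] by simp
  also have "\<dots> \<approx> evens k @ cups k @ ?u @ ?v @ ?u @ evens k"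
    using eqv_ctx[OF c(2), of "evens k" "?v @ ?u @ evens k"] by simp
  also have "\<dots> \<approx> evens k @ cups k @ ?u @ evens k"
    using eqv_ctx[OF eqv_UUU[of "2 * k + 2" "2 * k + 1"], of "evens k @ cups k" "evens k"] Suc.prems by simp
  also have "\<dots> \<approx> evens k @ cups k @ evens k @ ?u"
    using eqv_pre[OF eqv_sym[OF c(1)], of "evens k @ cups k"] by simp
  also have "\<dots> \<approx> evens k @ ?u"
    using eqv_post[OF Suc.IH, of ?u] Suc.prems by simp
  finally show ?case by (simp add: evens_Suc)
qed

text \<open>The second blob lies on the same through line as the first. Moving e past
  \<open>evens\<close> brings the two letters e together once the zigzag between them is
  straightened.\<close>

lemma blobbed_cups_blob:
  assumes "2 * k < N"
  shows "eqv \<delta> (blobbed_cups k @ [Gen_e] @ evens k @ cups k) (blobbed_cups k)"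
proof -
  have c: "[Gen_e] @ evens k \<approx> evens k @ [Gen_e]"
    by (rule word_comm) (use assms in auto)
  have "blobbed_cups k @ [Gen_e] @ evens k @ cups k \<approx> (cups k @ [Gen_e]) @ (evens k @ cups k @ evens k) @ [Gen_e] @ cups k"
    using eqv_ctx[OF c, of "blobbed_cups k" "cups k"] by (simp add: blobbed_cups_def)
  also have "\<dots> \<approx> (cups k @ [Gen_e]) @ evens k @ [Gen_e] @ cups k"
    using eqv_ctx[OF evens_cups_evens, of k "cups k @ [Gen_e]" "[Gen_e] @ cups k"] assms by simp
  also have "\<dots> \<approx> cups k @ [Gen_e, Gen_e] @ evens k @ cups k"
    using eqv_ctx[OF eqv_sym[OF c], of "cups k @ [Gen_e]" "cups k"] by simp
  also have "eqv \<delta> \<dots> (blobbed_cups k)"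
    using eqv_ctx[OF eqv_ee, of "cups k" "evens k @ cups k"] by (simp add: blobbed_cups_def)
  finally show ?thesis .
qed

lemma rev_blobbed_cups:
  assumes "2 * k < N"
  shows "rev (blobbed_cups k) \<approx> blobbed_cups k"
proof -
  have r: "rev (cups k) \<approx> cups k" "rev (evens k) \<approx> evens k"
    using cups_rev evens_rev assms by auto
  have "rev (blobbed_cups k) = rev (cups k) @ rev (evens k) @ [Gen_e] @ rev (cups k)"
    by (simp add: blobbed_cups_def)
  also have "\<dots> \<approx> cups k @ rev (evens k) @ [Gen_e] @ rev (cups k)"
    using eqv_post[OF r(1)] by simp
  also have "\<dots> \<approx> cups k @ evens k @ [Gen_e] @ rev (cups k)"
    using eqv_ctx[OF r(2)] by simp
  also have "\<dots> \<approx> cups k @ evens k @ [Gen_e] @ cups k"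
    using eqv_pre[OF r(1), of "cups k @ evens k @ [Gen_e]"] by simp
  also have "\<dots> \<approx> blobbed_cups k"
    using eqv_ctx[OF word_comm[of "evens k" "[Gen_e]"], of "cups k" "cups k"] assms
    by (fastforce simp: blobbed_cups_def)
  finally show ?thesis .
qed

end

section \<open>Walks, weights and the three kinds of edges\<close>

lemma weights_0 [simp]: "weights 0 = {0}"
  by (auto simp: weights_def)

lemma walks_0 [simp]: "walks 0 m = (if m = 0 then {[0]} else {})"
  by (auto simp: walks_def length_Suc_conv)

lemma walks_Suc_iff:
  "p \<in> walks (Suc n) m \<longleftrightarrow> (\<exists>q l. p = q @ [m] \<and> q \<in> walks n l \<and> (m = l + 1 \<or> m = l - 1))"
proof
  assume p: "p \<in> walks (Suc n) m"
  then have len: "length p = Suc (Suc n)" and p0: "p ! 0 = 0" and pn: "p ! Suc n = m"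
    and st: "\<And>j. j < Suc n \<Longrightarrow> p ! (j + 1) = p ! j + 1 \<or> p ! (j + 1) = p ! j - 1"
    by (auto simp: walks_def)
  have "p = take (Suc n) p @ [m]"
    using take_Suc_conv_app_nth[of "Suc n" p] len pn by simp
  moreover have "take (Suc n) p \<in> walks n (p ! n)"
    using len p0 st by (auto simp: walks_def)
  ultimately show "\<exists>q l. p = q @ [m] \<and> q \<in> walks n l \<and> (m = l + 1 \<or> m = l - 1)"
    using st[of n] pn by auto
next
  assume "\<exists>q l. p = q @ [m] \<and> q \<in> walks n l \<and> (m = l + 1 \<or> m = l - 1)"
  then show "p \<in> walks (Suc n) m"
    by (fastforce simp: walks_def nth_append less_Suc_eq)
qed

lemma walks_snoc: "q \<in> walks n l \<Longrightarrow> m = l + 1 \<or> m = l - 1 \<Longrightarrow> q @ [m] \<in> walks (Suc n) m"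
  using walks_Suc_iff by blast

lemma walk_word_snoc:
  assumes "q \<in> walks n l"
  shows "walk_word (q @ [m]) = walk_word q @ edge_word n l m"
proof -
  have len: "length q = Suc n" "q ! n = l"
    using assms by (auto simp: walks_def)
  have "map (\<lambda>j. edge_word j ((q @ [m]) ! j) ((q @ [m]) ! (j + 1))) [0..<n]
      = map (\<lambda>j. edge_word j (q ! j) (q ! (j + 1))) [0..<n]"
    using len by (auto simp: nth_append)
  moreover have "(q @ [m]) ! n = l" "(q @ [m]) ! (n + 1) = m" "length (q @ [m]) - 1 = Suc n" "length q - 1 = n"
    using len by (auto simp: nth_append)
  ultimately show ?thesis
    by (simp only: walk_word_def upt_Suc_append[of 0 n] map_append concat_append) simp
qed

lemma walk_word_0 [simp]: "walk_word [a] = []"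
  by (simp add: walk_word_def)

lemma walks_weights: "p \<in> walks n m \<Longrightarrow> m \<in> weights n"
proof (induction n arbitrary: p m)
  case (Suc n)
  then obtain q l where "q \<in> walks n l" "m = l + 1 \<or> m = l - 1"
    by (auto simp: walks_Suc_iff)
  with Suc.IH[of q l] show ?case by (auto simp: weights_def)
qed (auto split: if_splits)

lemma edge_open:
  "l > 0 \<and> m = l + 1 \<or> l \<le> 0 \<and> m = l - 1 \<Longrightarrow> edge_word n l m = []"
  by (auto simp: edge_word_def)

lemma edge_close: "l \<noteq> 0 \<Longrightarrow> \<bar>m\<bar> = \<bar>l\<bar> - 1 \<Longrightarrow> edge_word n l m = dn n 1"
  by (simp add: edge_word_def dn_def)

lemma edge_cross: "edge_word (2 * k) 0 1 = [Gen_e] @ rev (evens k) @ rev (cups k)"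
proof -
  have "map (\<lambda>i. Gen_U (2 * i - 1)) [1..<k + 1] = cups k"
    by (rule nth_equalityI) (auto simp: cups_def simp del: upt_Suc)
  from arg_cong[OF this, of rev] show ?thesis
    by (simp add: edge_word_def evens_def rev_map del: upt_Suc)
qed

text \<open>On diagrams an opening step adds a through line, a crossing step 0 to 1 adds one with a
  blob, and a closing step joins the rightmost through line to the new point. The step from 0 to -1
  counts as opening.\<close>

lemma step_cases:
  fixes l m :: int
  assumes "m = l + 1 \<or> m = l - 1"
  obtains (open_step) "l > 0 \<and> m = l + 1 \<or> l \<le> 0 \<and> m = l - 1"
  | (cross_step) "l = 0" "m = 1"
  | (close_step) "l \<noteq> 0" "\<bar>m\<bar> = \<bar>l\<bar> - 1"
  using assms by (cases "l > 0"; cases "l = 0") auto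

lemma F_word_pos: "m > 0 \<Longrightarrow> F_word n m = blobbed_cups ((n - nat m) div 2)"
  by (simp add: F_word_def E_plus_word_def E_word_def blobbed_cups_def cups_def evens_def)

lemma F_word_neg: "m \<le> 0 \<Longrightarrow> F_word n m = cups ((n - nat (- m)) div 2)"
  by (simp add: F_word_def E_word_def cups_def)

text \<open>Level and |weight| grow together, so the number of cups is unchanged, and the side of 0
  on which the weight lies is unchanged too.\<close>

lemma F_word_open:
  assumes "l > 0 \<and> m = l + 1 \<or> l \<le> 0 \<and> m = l - 1"
  shows "F_word (Suc n) m = F_word n l"
  using assms
proof
  assume l: "l > 0 \<and> m = l + 1"
  then have "Suc n - nat m = n - nat l"
    by linarith
  with l show ?thesis by (simp add: F_word_pos)
next
  assume l: "l \<le> 0 \<and> m = l - 1"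
  then have "Suc n - nat (- m) = n - nat (- l)"
    by linarith
  with l show ?thesis by (simp add: F_word_neg)
qed

lemma weights_open:
  "l \<in> weights n \<Longrightarrow> l > 0 \<and> m = l + 1 \<or> l \<le> 0 \<and> m = l - 1 \<Longrightarrow> m \<in> weights (Suc n)"
  by (auto simp: weights_def)

lemma weights_Suc_nonzero:
  assumes "m \<in> weights (Suc n)" "m \<noteq> 0"
  obtains l where "l \<in> weights n" "l > 0 \<and> m = l + 1 \<or> l \<le> 0 \<and> m = l - 1"
  | "m = 1" "even n"
proof (cases "m = 1")
  case True
  then show ?thesis using assms that(2) by (auto simp: weights_def)
next
  case False
  then show ?thesis using assms that(1)[of "m - 1"] that(1)[of "m + 1"]
    by (cases "m > 0") (auto simp: weights_def)
qed

lemma weightsE: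
  assumes "m \<in> weights n"
  obtains c where "n = nat \<bar>m\<bar> + 2 * c"
proof -
  have "even (int n - \<bar>m\<bar>)" "\<bar>m\<bar> \<le> int n"
    using assms by (auto simp: weights_def abs_if)
  then obtain k where k: "int n - \<bar>m\<bar> = 2 * k"
    by (elim evenE)
  then have "k \<ge> 0"
    using \<open>\<bar>m\<bar> \<le> int n\<close> by linarith
  then show ?thesis using that[of "nat k"] k by linarith
qed

lemma weights_minus: "m \<in> weights n \<Longrightarrow> - m \<in> weights n"
  by (auto simp: weights_def)

text \<open>\<open>gens 0\<close> still contains e, although a walk of level 0 has an empty word.
  Excluding e there is what lets U_1 commute with such words in \<open>U_walk_comm\<close>.\<close>

definition level_gens :: "nat \<Rightarrow> gen set" where
  "level_gens n = (if n = 0 then {} else gens n)"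

lemma level_gens_subset: "level_gens n \<subseteq> gens n"
  by (auto simp: level_gens_def)

lemma level_gens_mono: "m \<le> n \<Longrightarrow> level_gens m \<subseteq> level_gens n"
  using gens_mono by (auto simp: level_gens_def)

lemma set_edge_word: "set (edge_word n l m) \<subseteq> gens (Suc n)"
  by (auto simp: edge_word_def)

lemma set_walk_word: "p \<in> walks n m \<Longrightarrow> set (walk_word p) \<subseteq> level_gens n"
proof (induction n arbitrary: p m)
  case 0
  then show ?case by (auto split: if_splits)
next
  case (Suc n)
  then obtain q l where q: "q \<in> walks n l" "p = q @ [m]"
    by (auto simp: walks_Suc_iff)
  have "set (walk_word p) \<subseteq> level_gens n \<union> gens (Suc n)"
    using Suc.IH[OF q(1)] set_edge_word[of n l m] by (auto simp: walk_word_snoc[OF q(1)] q(2))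
  also have "\<dots> \<subseteq> level_gens (Suc n)"
    using level_gens_mono[of n "Suc n"] by (auto simp: level_gens_def)
  finally show ?case .
qed

lemma set_F_word:
  assumes "m \<in> weights n" "n \<ge> 1"
  shows "set (F_word n m) \<subseteq> gens n"
proof -
  obtain c where "n = nat \<bar>m\<bar> + 2 * c"
    using assms(1) by (rule weightsE)
  then show ?thesis using assms(2)
    by (cases "m > 0") (auto simp: F_word_pos F_word_neg blobbed_cups_def)
qed

section \<open>Reduction of words ending in an F word, along the last edge of a walk\<close>

context blob_rewriting
begin

text \<open>
  \<open>red n m v\<close>: up to a scalar, \<open>v\<close> is a walk word, or it factors through a diagram in which two
  neighbouring through lines of \<open>F_word n m\<close> have been joined, or, for \<open>m < 0\<close>, through the one in
  which its leftmost line has received a blob.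
\<close>

definition red :: "nat \<Rightarrow> int \<Rightarrow> gen list \<Rightarrow> bool" where
  "red n m v \<longleftrightarrow>
    (\<exists>a p. p \<in> walks n m \<and> eqv a v (walk_word p)) \<or>
    (\<exists>a x i. set x \<subseteq> gens n \<and> int n - \<bar>m\<bar> + 1 \<le> int i \<and> i < n \<and> eqv a v (x @ [U i] @ F_word n m)) \<or>
    (m < 0 \<and> (\<exists>a x. set x \<subseteq> gens n \<and> eqv a v (x @ F_word n (- m))))"

lemma redE [consumes 1, case_names walk turn blob]:
  assumes "red n m v"
  obtains a p where "p \<in> walks n m" "eqv a v (walk_word p)"
  | a x i where "set x \<subseteq> gens n" "int n - \<bar>m\<bar> + 1 \<le> int i" "i < n" "eqv a v (x @ [U i] @ F_word n m)"
  | a x where "m < 0" "set x \<subseteq> gens n" "eqv a v (x @ F_word n (- m))"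
  using assms unfolding red_def by blast

lemma red_walk: "p \<in> walks n m \<Longrightarrow> eqv a v (walk_word p) \<Longrightarrow> red n m v"
  and red_turn: "\<lbrakk>set x \<subseteq> gens n; int n - \<bar>m\<bar> + 1 \<le> int i; i < n; eqv a v (x @ [U i] @ F_word n m)\<rbrakk> \<Longrightarrow> red n m v"
  and red_blob: "\<lbrakk>m < 0; set x \<subseteq> gens n; eqv a v (x @ F_word n (- m))\<rbrakk> \<Longrightarrow> red n m v"
  unfolding red_def by blast+

lemma red_eqv: "eqv a w v \<Longrightarrow> red n m v \<Longrightarrow> red n m w"
  unfolding red_def using eqv_trans by blast

text \<open>The number of cups grows by one; the prefix \<open>dn\<close> starts right after the new
  cup, at 2k + 2 when the old word has k cups. Weight 1 is excluded because closing its only through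
  line also consumes the blob.\<close>

lemma F_word_close:
  assumes l: "l \<in> weights n" "l < 0 \<or> l > 1" and m: "\<bar>m\<bar> = \<bar>l\<bar> - 1" "m = l + 1 \<or> m = l - 1" and n: "n < N"
  shows "F_word n l @ dn n 1 \<approx> dn n (Suc n - nat \<bar>m\<bar>) @ F_word (Suc n) m"
proof -
  obtain k where k: "n = nat \<bar>l\<bar> + 2 * k"
    using l(1) by (rule weightsE)
  have b: "Suc n - nat \<bar>m\<bar> = 2 * k + 2"
    using k l m by linarith
  show ?thesis
  proof (cases "l < 0")
    case True
    then have "F_word n l = cups k" "F_word (Suc n) m = cups (Suc k)"
      using k b m l by (auto simp: F_word_neg)
    then show ?thesis using cups_dn_shift[of k n] k l True n b by simp
  next
    case False
    then have "F_word n l = blobbed_cups k" "F_word (Suc n) m = blobbed_cups (Suc k)"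
      using k b m l by (auto simp: F_word_pos)
    then show ?thesis using blobbed_cups_dn_shift[of k n] k l False n b by simp
  qed
qed

text \<open>The target weight 0 has no through line to carry the blob, so the blob is kept in the
  prefix, on the arc that has just been closed.\<close>

lemma F_word_close_1:
  assumes "n = 2 * k + 1" "n < N"
  shows "F_word n 1 @ dn n 1 \<approx> (cups k @ [Gen_e] @ evens k) @ F_word (Suc n) 0"
  using blobbed_cups_dn[of k n] assms by (simp add: F_word_pos F_word_neg)

lemma F_word_close_ex:
  assumes l: "l \<in> weights n" "l \<noteq> 0" and m: "\<bar>m\<bar> = \<bar>l\<bar> - 1" "m = l + 1 \<or> m = l - 1" and n: "n < N"
  obtains y where "set y \<subseteq> gens (Suc n)" "F_word n l @ dn n 1 \<approx> y @ F_word (Suc n) m"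
proof (cases "l = 1")
  case True
  then obtain k where "n = 2 * k + 1"
    using l by (auto simp: weights_def elim: oddE)
  then show ?thesis
    using that[of "cups k @ [Gen_e] @ evens k"] F_word_close_1[of n k] n m True by (fastforce)
next
  case False
  have "1 \<le> Suc n - nat \<bar>m\<bar>"
    using l m by (simp add: weights_def) linarith
  then have "set (dn n (Suc n - nat \<bar>m\<bar>)) \<subseteq> gens (Suc n)"
    by auto
  moreover have "l < 0 \<or> l > 1"
    using False l(2) by linarith
  ultimately show ?thesis
    using that F_word_close[OF l(1) _ m n] by metis
qed

lemma F_word_cross:
  assumes "n = 2 * k" "n < N"
  shows "F_word n 0 @ edge_word n 0 1 \<approx> F_word (Suc n) 1"
proof -
  have r: "rev (cups k) \<approx> cups k" "rev (evens k) \<approx> evens k"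
    using cups_rev evens_rev assms by auto
  have "F_word n 0 @ edge_word n 0 1 = cups k @ [Gen_e] @ rev (evens k) @ rev (cups k)"
    using assms by (simp add: F_word_neg edge_cross)
  also have "\<dots> \<approx> cups k @ [Gen_e] @ evens k @ rev (cups k)"
    using eqv_ctx[OF r(2), of "cups k @ [Gen_e]" "rev (cups k)"] by simp
  also have "\<dots> \<approx> cups k @ [Gen_e] @ evens k @ cups k"
    using eqv_pre[OF r(1), of "cups k @ [Gen_e] @ evens k"] by simp
  also have "\<dots> = F_word (Suc n) 1"
    using assms by (simp add: F_word_pos blobbed_cups_def)
  finally show ?thesis .
qed

text \<open>Existence of the factor words s(n,m). The letters of the factor stay within level n, so
  later letters of larger index commute with them.\<close>

lemma walk_word_factor:
  assumes "p \<in> walks n m" "n \<le> N"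
  shows "\<exists>a. set a \<subseteq> level_gens n \<and> walk_word p \<approx> a @ F_word n m"
  using assms
proof (induction n arbitrary: p m)
  case 0
  then show ?case by (auto simp: F_word_neg intro!: exI[of _ "[]"] eqv_refl split: if_splits)
next
  case (Suc n)
  then obtain q l where q: "q \<in> walks n l" "p = q @ [m]" "m = l + 1 \<or> m = l - 1"
    by (auto simp: walks_Suc_iff)
  obtain a where a: "set a \<subseteq> level_gens n" "walk_word q \<approx> a @ F_word n l"
    using Suc.IH[OF q(1)] Suc.prems by auto
  have w: "walk_word p \<approx> a @ F_word n l @ edge_word n l m"
    using eqv_post[OF a(2), of "edge_word n l m"] by (simp add: q(2) walk_word_snoc[OF q(1)])
  have a': "set a \<subseteq> level_gens (Suc n)"
    using a(1) level_gens_mono[of n "Suc n"] by auto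
  from q(3) show ?case
  proof (cases rule: step_cases)
    case open_step
    then have "walk_word p \<approx> a @ F_word (Suc n) m"
      using w by (simp only: edge_open F_word_open append_Nil2)
    then show ?thesis using a' by blast
  next
    case cross_step
    then obtain k where "n = 2 * k"
      using walks_weights[OF q(1)] by (auto simp: weights_def elim: evenE)
    then have "F_word n l @ edge_word n l m \<approx> F_word (Suc n) m"
      using F_word_cross[of n k] cross_step Suc.prems by simp
    from sim_trans[OF w eqv_pre[OF this]] show ?thesis using a' by blast
  next
    case close_step
    obtain y where y: "set y \<subseteq> gens (Suc n)" "F_word n l @ dn n 1 \<approx> y @ F_word (Suc n) m"
      using F_word_close_ex[of l n m] walks_weights[OF q(1)] close_step q(3) Suc.prems by auto
    have "walk_word p \<approx> (a @ y) @ F_word (Suc n) m"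
      using sim_trans[OF w, of "a @ y @ F_word (Suc n) m"] eqv_pre[OF y(2), of a] close_step
      by (simp add: edge_close)
    then show ?thesis using a' y(1) by (intro exI[of _ "a @ y"]) (auto simp: level_gens_def)
  qed
qed

lemma F_word_walk:
  assumes "m \<in> weights n" "n \<le> N"
  shows "\<exists>p \<in> walks n m. F_word n m \<approx> walk_word p"
  using assms
proof (induction n arbitrary: m)
  case 0
  then show ?case by (auto simp: F_word_neg eqv_refl)
next
  case (Suc n)
  consider "m = 0" | l where "l \<in> weights n" "l > 0 \<and> m = l + 1 \<or> l \<le> 0 \<and> m = l - 1"
    | "m = 1" "even n"
  proof (cases "m = 0")
    case False
    show ?thesis
      using that(2,3) by (rule weights_Suc_nonzero[OF Suc.prems(1) False])
  qed (rule that(1))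
  then show ?case
  proof cases
    case 1
    \<comment> \<open>The word without a blob is reached by closing from weight -1; coming from
      weight 1 would leave the blob behind.\<close>
    then have w: "- 1 \<in> weights n"
      using Suc.prems by (cases n) (auto simp: weights_def)
    then obtain q where q: "q \<in> walks n (- 1)" "F_word n (- 1) \<approx> walk_word q"
      using Suc.IH Suc.prems by auto
    have "F_word (Suc n) m \<approx> F_word n (- 1) @ dn n 1"
      using eqv_sym[OF F_word_close[OF w, of m]] 1 Suc.prems by simp
    also have "\<dots> \<approx> walk_word q @ dn n 1"
      using eqv_post[OF q(2)] .
    also have "\<dots> = walk_word (q @ [m])"
      using 1 by (simp add: walk_word_snoc[OF q(1)] edge_close)
    finally show ?thesis using walks_snoc[OF q(1), of m] 1 by auto
  next
    case (2 l)
    then obtain q where q: "q \<in> walks n l" "F_word n l \<approx> walk_word q"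
      using Suc.IH Suc.prems by auto
    then have "F_word (Suc n) m \<approx> walk_word (q @ [m])"
      using 2(2) by (simp add: walk_word_snoc[OF q(1)] edge_open F_word_open)
    then show ?thesis using walks_snoc[OF q(1), of m] 2 by auto
  next
    case 3
    then obtain k where k: "n = 2 * k" by (auto elim: evenE)
    then obtain q where q: "q \<in> walks n 0" "F_word n 0 \<approx> walk_word q"
      using Suc.IH[of 0] Suc.prems by (auto simp: weights_def)
    have "F_word (Suc n) m \<approx> F_word n 0 @ edge_word n 0 1"
      using eqv_sym[OF F_word_cross[OF k]] 3 Suc.prems by simp
    also have "\<dots> \<approx> walk_word q @ edge_word n 0 1"
      using eqv_post[OF q(2)] .
    also have "\<dots> = walk_word (q @ [m])"
      using 3 by (simp add: walk_word_snoc[OF q(1)])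
    finally show ?thesis using walks_snoc[OF q(1), of m] 3 by auto
  qed
qed

lemma red_open:
  assumes "red n l v" "l > 0 \<and> m = l + 1 \<or> l \<le> 0 \<and> m = l - 1"
  shows "red (Suc n) m v"
  using assms(1)
proof (cases rule: redE)
  case (walk a p)
  have "m = l + 1 \<or> m = l - 1"
    using assms(2) by blast
  then have "p @ [m] \<in> walks (Suc n) m"
    by (rule walks_snoc[OF walk(1)])
  moreover have "walk_word (p @ [m]) = walk_word p"
    using walk_word_snoc[OF walk(1), of m] edge_open[OF assms(2), of n] by simp
  ultimately show ?thesis
    using red_walk walk(2) by metis
next
  case (turn a x i)
  have "set x \<subseteq> gens (Suc n)"
    using turn(1) gens_mono[of n "Suc n"] by simp
  moreover have "int (Suc n) - \<bar>m\<bar> + 1 \<le> int i"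
    using turn(2) assms(2) by linarith
  ultimately show ?thesis
    using red_turn turn(3,4) F_word_open[OF assms(2), of n] by (metis less_Suc_eq)
next
  case (blob a x)
  have "set x \<subseteq> gens (Suc n)"
    using blob(2) gens_mono[of n "Suc n"] by simp
  moreover have "- l > 0 \<and> - m = - l + 1 \<or> - l \<le> 0 \<and> - m = - l - 1"
    using assms(2) blob(1) by linarith
  from F_word_open[OF this, of n] have "eqv a v (x @ F_word (Suc n) (- m))"
    using blob(3) by simp
  moreover have "m < 0"
    using assms(2) blob(1) by linarith
  ultimately show ?thesis
    using red_blob by metis
qed

text \<open>At weight 0 there is no through line to turn back or to blob, so only the walk
  alternative of the hypothesis can occur.\<close>

lemma red_cross:
  assumes "red n 0 v"
  shows "red (Suc n) 1 (v @ edge_word n 0 1)"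
  using assms
proof (cases rule: redE)
  case (walk a p)
  then show ?thesis
    using red_walk[OF walks_snoc[OF walk(1), of 1], of a "v @ edge_word n 0 1"] walk_word_snoc[OF walk(1), of 1]
      eqv_post[OF walk(2), of "edge_word n 0 1"]
    by simp
qed auto

definition reduces :: "nat \<Rightarrow> bool" where
  "reduces n \<longleftrightarrow> (\<forall>m \<in> weights n. \<forall>x. set x \<subseteq> gens n \<longrightarrow> red n m (x @ F_word n m))"

text \<open>If the prefix uses no letter of the new level, the question descends to level n, because
  the F word of weight m comes from the preceding level by an opening or crossing step. Weight 0 is
  excluded: it is reached by closing only.\<close>

lemma reduces_up:
  assumes "reduces n" "set x \<subseteq> gens n" "m \<in> weights (Suc n)" "m \<noteq> 0" "n < N"
  shows "red (Suc n) m (x @ F_word (Suc n) m)"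
  using weights_Suc_nonzero[OF assms(3,4)]
proof cases
  case (1 l)
  then show ?thesis using assms(1,2) red_open[of n l _ m] by (simp add: reduces_def F_word_open)
next
  case 2
  then obtain k where "n = 2 * k" by (auto elim: evenE)
  then have "x @ F_word (Suc n) m \<approx> (x @ F_word n 0) @ edge_word n 0 1"
    using eqv_pre[OF eqv_sym[OF F_word_cross[of n k]]] assms(5) 2 by simp
  moreover have "0 \<in> weights n"
    using 2 by (auto simp: weights_def)
  then have "red (Suc n) 1 ((x @ F_word n 0) @ edge_word n 0 1)"
    using assms(1,2) by (intro red_cross) (simp add: reduces_def)
  ultimately show ?thesis
    using red_eqv 2(1) by simp
qed

text \<open>The letters of a row of cups commute, so the last one may be moved to the front, where
  \<open>red_close\<close> needs it to cancel a neighbouring letter.\<close>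

lemma F_word_head:
  assumes "m \<in> weights n" "b = n - nat \<bar>m\<bar>" "b \<ge> 2" "n \<le> N"
  obtains R where "F_word n m \<approx> [U (b - 1)] @ R"
proof -
  obtain c' where c': "n = nat \<bar>m\<bar> + 2 * c'"
    using assms(1) by (rule weightsE)
  then obtain c where c: "b = 2 * Suc c" "n = nat \<bar>m\<bar> + 2 * Suc c"
    using assms(2,3) by (cases c') auto
  have h: "cups (Suc c) \<approx> [U (b - 1)] @ cups c"
    using eqv_sym[OF cups_Suc'[of c]] c assms by simp
  show ?thesis
  proof (cases "m > 0")
    case True
    then have "F_word n m = cups (Suc c) @ [Gen_e] @ evens (Suc c) @ cups (Suc c)"
      using c assms(2) by (simp add: F_word_pos blobbed_cups_def)
    then show ?thesis using that eqv_post[OF h] by (metis append_assoc)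
  next
    case False
    then have "F_word n m = cups (Suc c)"
      using c assms(2) by (simp add: F_word_neg)
    then show ?thesis using that h by metis
  qed
qed

text \<open>The closing word has to be carried past a defect already found at level n. A turn is
  shifted, absorbed or straightened by the closing word, and a blob stays on the leftmost line
  unless that very line is closed.\<close>

lemma red_close:
  assumes red: "red n l v" and IH: "reduces n" and n: "n < N" and l: "l \<in> weights n" "l \<noteq> 0"
    and m: "\<bar>m\<bar> = \<bar>l\<bar> - 1" "m = l + 1 \<or> m = l - 1"
  shows "red (Suc n) m (v @ dn n 1)"
proof -
  have walk_close: "red (Suc n) m (v @ dn n 1)" if "p \<in> walks n l" "eqv a v (walk_word p)" "l \<noteq> 0"
     "\<bar>m\<bar> = \<bar>l\<bar> - 1" "m = l + 1 \<or> m = l - 1" for v a p l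
    using red_walk[OF walks_snoc[OF that(1,5)], of a "v @ dn n 1"] walk_word_snoc[OF that(1), of m]
      edge_close[OF that(3,4), of n] eqv_post[OF that(2), of "dn n 1"]
    by simp
  define b where "b = Suc n - nat \<bar>m\<bar>"
  have bm: "int b = int n + 1 - \<bar>m\<bar>" and b2: "b \<ge> 2"
    using l m by (simp_all add: weights_def b_def) linarith+
  have mw: "m \<in> weights (Suc n)"
    using l m by (auto simp: weights_def)
  let ?F = "F_word (Suc n) m"
  show ?thesis
    using red
  proof (cases rule: redE)
    case (walk a p)
    then show ?thesis using walk_close l m by blast
  next
    case (turn a x i)
    have i: "b \<le> i + 1" "b \<le> n" "1 \<le> i" and m0: "m \<noteq> 0"
      using turn m bm b2 by linarith+
    have Fcl: "F_word n l @ dn n 1 \<approx> dn n b @ ?F"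
    proof -
      have "l < 0 \<or> l > 1"
        using turn(2,3) by linarith
      from F_word_close[OF l(1) this m n] show ?thesis by (simp add: b_def)
    qed
    have e: "eqv a (v @ dn n 1) (x @ [U i] @ dn n b @ ?F)"
      using eqv_sim_trans[OF eqv_post[OF turn(4), of "dn n 1"], of "x @ [U i] @ dn n b @ ?F"]
        eqv_pre[OF Fcl, of "x @ [U i]"] by simp
    have xs: "set x \<subseteq> gens (Suc n)"
      using turn(1) gens_mono[of n "Suc n"] by auto
    \<comment> \<open>The lower bound on a turn at level n reads b - 1 <= i. In the interior the
      turn moves to i + 2; at i = n - 1 it cancels the first letter of the closing word, which
      leaves a prefix of level n; at i = b - 1 it meets the newest cup.\<close>
    consider "b \<le> i" "i + 2 \<le> n" | "b \<le> i" "i = n - 1" | "i = b - 1"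
      using i turn(3) by linarith
    then show ?thesis
    proof cases
      case 1
      have "[U i] @ dn n b @ ?F \<approx> dn n b @ [U (i + 2)] @ ?F"
        using eqv_post[OF dn_shift[of b i n], of ?F] 1 b2 n by simp
      from eqv_sim_trans[OF e eqv_pre[OF this, of x]]
      have "eqv a (v @ dn n 1) ((x @ dn n b) @ [U (i + 2)] @ ?F)"
        by simp
      moreover have "set (x @ dn n b) \<subseteq> gens (Suc n)"
        using xs b2 by auto
      ultimately show ?thesis
        using red_turn[of "x @ dn n b" "Suc n" m "i + 2" a] 1 bm by auto
    next
      case 2
      have "[U i] @ dn n b @ ?F \<approx> dn (n - 1) b @ ?F"
        using eqv_post[OF dn_absorb[of b n], of ?F] 2 b2 n i turn(3) by auto
      from eqv_sim_trans[OF e eqv_pre[OF this, of x]]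
      have "eqv a (v @ dn n 1) ((x @ dn (n - 1) b) @ ?F)"
        by simp
      moreover have "set (x @ dn (n - 1) b) \<subseteq> gens n"
        using turn(1,3) b2 by auto
      ultimately show ?thesis
        using reduces_up[OF IH _ mw m0 n] red_eqv by blast
    next
      case 3
      \<comment> \<open>The cup at b - 1 together with U_b straightens the turn. What remains is
        either empty or ends in U_(b+1), again a turn next to the F word of the new level.\<close>
      obtain R where R: "?F \<approx> [U (b - 1)] @ R"
        using F_word_head[OF mw, of b] b2 n by (auto simp: b_def)
      have s: "dn n b = dn n (Suc b) @ [U b]"
        using dn_snoc i by simp
      have "[U i] @ dn n b @ ?F \<approx> dn n (Suc b) @ [U (b - 1)] @ [U b] @ ?F"
        using eqv_post[OF word_comm[of "[U i]" "dn n (Suc b)"], of "[U b] @ ?F"] 3 i b2 n turn(3)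
        by (fastforce simp: s)
      also have "\<dots> \<approx> dn n (Suc b) @ [U (b - 1), U b, U (b - 1)] @ R"
        using eqv_pre[OF R, of "dn n (Suc b) @ [U (b - 1), U b]"] by simp
      also have "\<dots> \<approx> dn n (Suc b) @ [U (b - 1)] @ R"
        using eqv_ctx[OF eqv_UUU[of "b - 1" b], of "dn n (Suc b)" R] b2 i n by simp
      also have "\<dots> \<approx> dn n (Suc b) @ ?F"
        using eqv_pre[OF eqv_sym[OF R]] .
      finally have t: "[U i] @ dn n b @ ?F \<approx> dn n (Suc b) @ ?F" .
      have e': "eqv a (v @ dn n 1) (x @ dn n (Suc b) @ ?F)"
        using eqv_sim_trans[OF e eqv_pre[OF t, of x]] .
      show ?thesis
      proof (cases "b = n")
        case True
        then show ?thesis using e' reduces_up[OF IH turn(1) mw m0 n] red_eqv by fastforce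
      next
        case False
        then have "dn n (Suc b) = dn n (b + 2) @ [U (Suc b)]"
          using dn_snoc[of "Suc b" n] i by simp
        then have "eqv a (v @ dn n 1) ((x @ dn n (b + 2)) @ [U (Suc b)] @ ?F)"
          using e' by simp
        moreover have "set (x @ dn n (b + 2)) \<subseteq> gens (Suc n)"
          using xs by auto
        ultimately show ?thesis
          using red_turn[of "x @ dn n (b + 2)" "Suc n" m "Suc b" a] False i bm by simp
      qed
    qed
  next
    case (blob a x)
    show ?thesis
    proof (cases "m = 0")
      case True
      then have l1: "l = - 1" using blob m by auto
      \<comment> \<open>Weight 1 has neither a second through line nor a further degeneration, so
        reducing once more at level n must produce a walk.\<close>
      then have "red n 1 (x @ F_word n 1)"
        using IH blob weights_minus[OF l(1)] by (auto simp: reduces_def)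
      then obtain a' p where "p \<in> walks n 1" "eqv a' (x @ F_word n 1) (walk_word p)"
        by (cases rule: redE) auto
      then have "eqv (a * a') v (walk_word p)"
        using eqv_trans blob(3) l1 by auto
      then show ?thesis using walk_close[OF \<open>p \<in> walks n 1\<close>] True by auto
    next
      case False
      then have "F_word n (- l) @ dn n 1 \<approx> dn n b @ F_word (Suc n) (- m)"
        using F_word_close[OF weights_minus[OF l(1)], of "- m"] m blob(1) n by (auto simp: b_def)
      from eqv_sim_trans[OF eqv_post[OF blob(3), of "dn n 1"], of "x @ dn n b @ F_word (Suc n) (- m)"]
        eqv_pre[OF this, of x]
      have "eqv a (v @ dn n 1) ((x @ dn n b) @ F_word (Suc n) (- m))"
        by simp
      moreover have "set (x @ dn n b) \<subseteq> gens (Suc n)"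
        using blob(2) gens_mono[of n "Suc n"] b2 by auto
      ultimately show ?thesis
        using red_blob[of m "x @ dn n b" "Suc n" a] blob(1) m False by auto
    qed
  qed
qed

lemma U_walk_comm:
  assumes "p \<in> walks n m" "Suc n < N"
  shows "[U (Suc n)] @ walk_word p \<approx> walk_word p @ [U (Suc n)]"
proof (rule word_comm)
  show "set (walk_word p) \<subseteq> gens N" "\<forall>g\<in>set [U (Suc n)]. \<forall>h\<in>set (walk_word p). far g h"
    using set_walk_word[OF assms(1)] assms(2) by (auto simp: level_gens_def gens_def split: if_splits)
qed (use assms in auto)

text \<open>The top letter U_n reaches only the last two edges, since it commutes with the rest of
  the walk word. Before a closing edge, an opening edge gives a loop, a crossing edge a loop with a
  blob, and a closing edge rearranges two arcs.\<close>

lemma red_top_close: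
  assumes IH: "reduces n" and n: "n = Suc n'" "n < N"
    and r: "r \<in> walks n' k" and kl: "l = k + 1 \<or> l = k - 1"
    and m: "m = l + 1 \<or> m = l - 1" "\<bar>m\<bar> = \<bar>l\<bar> - 1" "l \<noteq> 0"
  shows "red (Suc n) m ([U n] @ walk_word (r @ [l, m]))"
proof -
  let ?W = "walk_word r"
  have q: "r @ [l] \<in> walks n l"
    using walks_snoc[OF r kl] n by simp
  have w: "walk_word (r @ [l, m]) = ?W @ edge_word n' k l @ dn n 1"
    using walk_word_snoc[OF r, of l] walk_word_snoc[OF q, of m] edge_close[OF m(3,2)] by simp
  have comm: "[U n] @ ?W \<approx> ?W @ [U n]"
    using U_walk_comm[OF r] n by simp
  obtain a where a: "set a \<subseteq> level_gens n'" "?W \<approx> a @ F_word n' k"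
    using walk_word_factor[OF r] n by auto
  have ag: "set a \<subseteq> gens n" "set a \<subseteq> gens N"
    using a(1) level_gens_mono[of n' n] level_gens_mono[of n' N] level_gens_subset n
    by (meson le_Suc_eq less_or_eq_imp_le order_trans)+
  from kl show ?thesis
  proof (cases rule: step_cases)
    case open_step
    have "[U n] @ ?W @ dn n 1 \<approx> ?W @ [U n] @ dn n 1"
      using eqv_post[OF comm, of "dn n 1"] by simp
    also have "eqv q2 \<dots> (?W @ dn n 1)"
      using eqv_ctx[OF eqv_UU[of n], of ?W "dn (n - 1) 1"] n by (simp add: dn_Cons)
    finally have "eqv q2 ([U n] @ walk_word (r @ [l, m])) (walk_word (r @ [l, m]))"
      by (simp add: w edge_open[OF open_step])
    then show ?thesis
      using red_walk walks_snoc[OF q m(1)] by fastforce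
  next
    case cross_step
    \<comment> \<open>The new through line carried a blob and is closed at once by U_n, giving
      \<gamma>. The blob is gone afterwards, so the resulting walk returns to 0 through -1 instead
      of 1.\<close>
    then have m0: "m = 0" using m by auto
    obtain j where j: "n' = 2 * j"
      using walks_weights[OF r] cross_step by (auto simp: weights_def elim: evenE)
    have F: "F_word n' 0 = cups j" "F_word n 1 = blobbed_cups j"
      using j n by (simp_all add: F_word_neg F_word_pos)
    have "?W @ edge_word n' k l \<approx> a @ F_word n' 0 @ edge_word n' 0 1"
      using eqv_post[OF a(2), of "edge_word n' k l"] cross_step by simp
    also have "\<dots> \<approx> a @ blobbed_cups j"
      using eqv_pre[OF F_word_cross[OF j], of a] n F by simp
    finally have 1: "?W @ edge_word n' k l \<approx> a @ blobbed_cups j" .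
    have "[U n] @ walk_word (r @ [l, m]) \<approx> [U n] @ a @ blobbed_cups j @ dn n 1"
      using eqv_ctx[OF 1, of "[U n]" "dn n 1"] by (simp add: w)
    also have "\<dots> \<approx> [U n] @ a @ cups j @ [Gen_e] @ evens j @ cups (Suc j)"
      using eqv_pre[OF blobbed_cups_dn[of j n], of "[U n] @ a"] j n by simp
    also have "\<dots> \<approx> (a @ [U n]) @ cups j @ [Gen_e] @ evens j @ cups (Suc j)"
    proof -
      have "[U n] @ a \<approx> a @ [U n]"
        using a(1) ag n by (intro word_comm) (auto simp: level_gens_def gens_def split: if_splits)
      then show ?thesis using eqv_post by fastforce
    qed
    also have "\<dots> \<approx> a @ cups (Suc j) @ [Gen_e] @ evens j @ cups (Suc j)"
      using eqv_ctx[OF cups_Suc'[of j], of a "[Gen_e] @ evens j @ cups (Suc j)"] j n by simp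
    also have "eqv \<gamma> \<dots> (a @ cups (Suc j))"
      using eqv_pre[OF cups_blob_cups[of j], of a] j n by simp
    finally have 2: "eqv \<gamma> ([U n] @ walk_word (r @ [l, m])) (a @ cups (Suc j))" .
    have r1: "r @ [- 1] \<in> walks n (- 1)"
      using walks_snoc[OF r, of "- 1"] cross_step n by simp
    have r0: "(r @ [- 1]) @ [0] \<in> walks (Suc n) 0"
      using walks_snoc[OF r1, of 0] by simp
    have "walk_word ((r @ [- 1]) @ [0]) = ?W @ dn n 1"
      using walk_word_snoc[OF r, of "- 1"] walk_word_snoc[OF r1, of 0] edge_close[of "- 1" 0 n]
        edge_open[of k "- 1" n'] cross_step by simp
    also have "\<dots> \<approx> a @ cups j @ dn n 1"
      using eqv_post[OF a(2), of "dn n 1"] cross_step F by simp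
    also have "\<dots> \<approx> a @ cups (Suc j)"
      using eqv_pre[OF cups_dn_shift[of j n], of a] j n by simp
    finally show ?thesis
      using red_walk[OF r0 eqv_sim_trans[OF 2 eqv_sym]] m0 by simp
  next
    case close_step
    have k: "\<bar>k\<bar> = \<bar>m\<bar> + 2" "\<bar>k\<bar> \<le> int n'"
      using close_step m walks_weights[OF r] by (auto simp: weights_def)
    obtain n'' where n'': "n' = Suc n''" "n'' \<ge> 1"
      using k by (cases n') auto
    have kop: "l > 0 \<and> k = l + 1 \<or> l \<le> 0 \<and> k = l - 1"
      using close_step kl m k by linarith
    have Fk: "F_word n' k = F_word n'' l"
      using F_word_open[OF kop] n'' by simp
    have lw: "l \<in> weights n''"
      using walks_weights[OF r] kop n'' by (auto simp: weights_def)
    obtain y where y: "set y \<subseteq> gens n'" "F_word n'' l @ dn n'' 1 \<approx> y @ F_word n' m"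
      using F_word_close_ex[OF lw m(3,2,1)] n n'' by auto
    \<comment> \<open>Opening one line from m rewrites the same F word as one of level n, so that
      the hypothesis at level n applies to it.\<close>
    define l' where "l' = (if m > 0 then m + 1 else m - 1)"
    have l': "m > 0 \<and> l' = m + 1 \<or> m \<le> 0 \<and> l' = m - 1"
      by (simp add: l'_def)
    have mw: "m \<in> weights n'"
      using lw m n'' by (auto simp: weights_def)
    have Fm: "F_word n' m = F_word n l'" and lw': "l' \<in> weights n"
      using F_word_open[OF l'] weights_open[OF mw l'] n by simp_all
    have d: "dn n 1 = [U n] @ dn n' 1" "dn n' 1 = [U n'] @ dn n'' 1"
      using n n'' by (simp_all add: dn_Cons)
    have c: "[U n] @ dn n'' 1 \<approx> dn n'' 1 @ [U n]"
      by (rule word_comm) (use n n'' in auto)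
    \<comment> \<open>By U_n U_n' U_n = U_n the factor \<open>[U n] @ dn n' 1 @ dn n 1\<close>
      becomes \<open>dn n'' 1 @ dn n 1\<close>: the first closing word drops to an earlier level and
      the last one is untouched.\<close>
    have "[U n] @ walk_word (r @ [l, m]) \<approx> ?W @ [U n] @ dn n' 1 @ dn n 1"
      using eqv_post[OF comm, of "dn n' 1 @ dn n 1"] edge_close close_step by (simp add: w)
    also have "\<dots> = ?W @ [U n, U n'] @ (dn n'' 1 @ [U n]) @ dn n' 1"
      unfolding d(1) using d(2) by simp
    also have "\<dots> \<approx> ?W @ [U n, U n'] @ ([U n] @ dn n'' 1) @ dn n' 1"
      using eqv_ctx[OF eqv_sym[OF c], of "?W @ [U n, U n']" "dn n' 1"] by simp
    also have "\<dots> \<approx> ?W @ ([U n] @ dn n'' 1) @ dn n' 1"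
      using eqv_ctx[OF eqv_UUU[of n n'], of ?W "dn n'' 1 @ dn n' 1"] n n'' by simp
    also have "\<dots> \<approx> ?W @ (dn n'' 1 @ [U n]) @ dn n' 1"
      using eqv_ctx[OF c, of ?W "dn n' 1"] by simp
    also have "\<dots> \<approx> (a @ F_word n' k) @ dn n'' 1 @ dn n 1"
      using eqv_post[OF a(2), of "dn n'' 1 @ dn n 1"] d(1) by simp
    also have "\<dots> \<approx> ((a @ y) @ F_word n l') @ dn n 1"
      using eqv_ctx[OF y(2), of a "dn n 1"] by (simp add: Fk Fm)
    finally have 1: "[U n] @ walk_word (r @ [l, m]) \<approx> ((a @ y) @ F_word n l') @ dn n 1" .
    have "set (a @ y) \<subseteq> gens n"
      using ag y(1) gens_mono[of n' n] n by auto
    then have "red n l' ((a @ y) @ F_word n l')"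
      using IH lw' unfolding reduces_def by blast
    from red_close[OF this IH n(2) lw'] have "red (Suc n) m (((a @ y) @ F_word n l') @ dn n 1)"
      using l' by auto
    then show ?thesis using red_eqv[OF 1] by blast
  qed
qed

text \<open>If the two last edges both start through lines, U_n joins these lines, which is a turn.
  After a closing edge U_n merely completes a longer closing word, so the order of the two edges is
  exchanged: first open, then close.\<close>

lemma red_top_open:
  assumes n: "n = Suc n'" "n < N"
    and r: "r \<in> walks n' k" and kl: "l = k + 1 \<or> l = k - 1"
    and m: "l > 0 \<and> m = l + 1 \<or> l \<le> 0 \<and> m = l - 1"
  shows "red (Suc n) m ([U n] @ walk_word (r @ [l, m]))"
proof -
  let ?W = "walk_word r"
  have q: "r @ [l] \<in> walks n l"
    using walks_snoc[OF r kl] n by simp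
  have w: "walk_word (r @ [l, m]) = walk_word (r @ [l])"
    using walk_word_snoc[OF q, of m] edge_open[OF m] by simp
  have w': "walk_word (r @ [l]) = ?W @ edge_word n' k l"
    using walk_word_snoc[OF r, of l] by simp
  have comm: "[U n] @ ?W \<approx> ?W @ [U n]"
    using U_walk_comm[OF r] n by simp
  obtain a where a: "set a \<subseteq> level_gens n'" "?W \<approx> a @ F_word n' k"
    using walk_word_factor[OF r] n by auto
  have ag: "set a \<subseteq> gens n" "set a \<subseteq> gens (Suc n)" "set a \<subseteq> gens N"
    using a(1) level_gens_subset[of n'] gens_mono[of n' n] gens_mono[of n' "Suc n"] gens_mono[of n' N] n
    by fastforce+
  have Fl: "F_word (Suc n) m = F_word n l"
    using F_word_open[OF m] .
  have turn: "red (Suc n) m ([U n] @ walk_word (r @ [l, m]))"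
    if h: "walk_word (r @ [l]) \<approx> a @ F_word n l" and l: "l \<noteq> 0"
  proof -
    have c: "[U n] @ a \<approx> a @ [U n]"
      using a(1) ag n by (intro word_comm) (auto simp: level_gens_def gens_def split: if_splits)
    have "[U n] @ walk_word (r @ [l, m]) \<approx> a @ [U n] @ F_word (Suc n) m"
      using sim_trans[OF eqv_pre[OF h, of "[U n]"], of "a @ [U n] @ F_word n l"] eqv_post[OF c, of "F_word n l"]
      by (simp add: w Fl)
    then show ?thesis
      using red_turn[OF ag(2), of m n 1] m l by auto
  qed
  from kl show ?thesis
  proof (cases rule: step_cases)
    case open_step
    then show ?thesis
      using turn a(2) F_word_open[OF open_step, of n'] n by (auto simp: w' edge_open)
  next
    case cross_step
    then obtain j where j: "n' = 2 * j"
      using walks_weights[OF r] by (auto simp: weights_def elim: evenE)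
    have "walk_word (r @ [l]) \<approx> a @ F_word n' 0 @ edge_word n' 0 1"
      using eqv_post[OF a(2), of "edge_word n' k l"] unfolding w' using cross_step by simp
    also have "\<dots> \<approx> a @ F_word n l"
      using eqv_pre[OF F_word_cross[OF j], of a] n cross_step by simp
    finally show ?thesis using turn cross_step by simp
  next
    case close_step
    then have "walk_word (r @ [l]) = ?W @ dn n' 1"
      by (simp add: w' edge_close)
    then have e: "[U n] @ walk_word (r @ [l, m]) \<approx> ?W @ dn n 1"
      using eqv_post[OF comm, of "dn n' 1"] n dn_Cons[of 1 n] w by simp
    define k' where "k' = (if k > 0 then k + 1 else k - 1)"
    have k': "k > 0 \<and> k' = k + 1 \<or> k \<le> 0 \<and> k' = k - 1"
      by (simp add: k'_def)
    have r1: "r @ [k'] \<in> walks n k'"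
      using walks_snoc[OF r, of k'] k' n by auto
    have r2: "(r @ [k']) @ [k] \<in> walks (Suc n) k"
      using walks_snoc[OF r1, of k] k' by auto
    have "walk_word ((r @ [k']) @ [k]) = ?W @ dn n 1"
      using walk_word_snoc[OF r, of k'] walk_word_snoc[OF r1, of k] edge_open[OF k'] edge_close[of k' k n] k' close_step
      by auto
    then have e': "[U n] @ walk_word (r @ [l, m]) \<approx> walk_word ((r @ [k']) @ [k])"
      using e by simp
    show ?thesis
    proof (cases "k = m")
      case True
      then show ?thesis using red_walk[OF r2[unfolded True]] e' by auto
    next
      case False
      \<comment> \<open>This is the case k = 1, l = 0, m = -1: after the exchange the surviving
        through line is the blobbed one.\<close>
      then have km: "k = - m" "m < 0"
        using close_step kl m by linarith+
      obtain x where "set x \<subseteq> level_gens (Suc n)" "walk_word ((r @ [k']) @ [k]) \<approx> x @ F_word (Suc n) k"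
        using walk_word_factor[OF r2] n by auto
      then show ?thesis
        using red_blob[OF km(2), of x "Suc n" 1] level_gens_subset sim_trans[OF e'] km by blast
    qed
  qed
qed

text \<open>Coming from -1, U_n moves the blob onto an older line and the word is a closing step
  from weight 2. Coming from 1, the old and the new blob meet on one strand, which gives
  \<delta>.\<close>

lemma red_top_cross:
  assumes IH: "reduces n" and n: "n = Suc n'" "n < N"
    and r: "r \<in> walks n' k" and k: "k = 1 \<or> k = - 1"
  shows "red (Suc n) 1 ([U n] @ walk_word (r @ [0, 1]))"
proof -
  let ?W = "walk_word r"
  have q: "r @ [0] \<in> walks n 0"
    using walks_snoc[OF r, of 0] n k by auto
  obtain j where j: "n' = 2 * j + 1"
    using walks_weights[OF r] k by (auto simp: weights_def elim: oddE)
  have nj: "n = 2 * j + 2" and nj': "n = 2 * Suc j"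
    using n j by auto
  have w: "walk_word (r @ [0, 1]) = ?W @ dn n' 1 @ edge_word n 0 1"
    using walk_word_snoc[OF r, of 0] walk_word_snoc[OF q, of 1] edge_close[of k 0 n'] k by auto
  have comm: "[U n] @ ?W \<approx> ?W @ [U n]"
    using U_walk_comm[OF r] n by simp
  obtain a where a: "set a \<subseteq> level_gens n'" "?W \<approx> a @ F_word n' k"
    using walk_word_factor[OF r] n by auto
  have ag: "set a \<subseteq> gens n"
    using a(1) level_gens_subset[of n'] gens_mono[of n' n] n by fastforce
  have e: "[U n] @ walk_word (r @ [0, 1]) \<approx> ?W @ dn n 1 @ edge_word n 0 1"
    using eqv_post[OF comm, of "dn n' 1 @ edge_word n 0 1"] n dn_Cons[of 1 n] by (simp add: w)
  have F: "F_word n' 1 = blobbed_cups j" "F_word n' (- 1) = cups j" "F_word n 2 = blobbed_cups j"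
     "F_word n 0 = cups (Suc j)" "F_word (Suc n) 1 = blobbed_cups (Suc j)"
    using j nj n by (simp_all add: F_word_neg F_word_pos)
  have cr: "cups (Suc j) @ edge_word n 0 1 \<approx> blobbed_cups (Suc j)"
    using F_word_cross[OF nj'] n F by simp
  have sh: "[U n] @ blobbed_cups (Suc j) \<approx> blobbed_cups j @ dn n 1"
    using eqv_sym[OF blobbed_cups_dn_shift[of j n]] n nj by simp
  from k show ?thesis
  proof
    assume k: "k = - 1"
    note e
    also have "?W @ dn n 1 @ edge_word n 0 1 \<approx> a @ cups j @ dn n 1 @ edge_word n 0 1"
      using eqv_post[OF a(2), of "dn n 1 @ edge_word n 0 1"] k F by simp
    also have "\<dots> \<approx> a @ [U n] @ cups (Suc j) @ edge_word n 0 1"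
      using eqv_ctx[OF cups_dn_shift[of j n], of a "edge_word n 0 1"] n nj by simp
    also have "\<dots> \<approx> a @ [U n] @ blobbed_cups (Suc j)"
      using eqv_pre[OF cr, of "a @ [U n]"] by simp
    also have "\<dots> \<approx> (a @ F_word n 2) @ dn n 1"
      using eqv_pre[OF sh, of a] F by simp
    finally have 1: "[U n] @ walk_word (r @ [0, 1]) \<approx> (a @ F_word n 2) @ dn n 1" .
    have w2: "2 \<in> weights n"
      using nj by (auto simp: weights_def)
    then have "red n 2 (a @ F_word n 2)"
      using IH ag by (simp add: reduces_def)
    from red_close[OF this IH n(2) w2, of 1] show ?thesis
      using red_eqv[OF 1] by simp
  next
    assume k: "k = 1"
    let ?X = "cups j @ [Gen_e] @ evens j"
    have c: "?X @ [U n] \<approx> [U n] @ ?X"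
      by (rule word_comm) (use n nj in \<open>auto simp: gens_def\<close>)
    note e
    also have "?W @ dn n 1 @ edge_word n 0 1 \<approx> a @ blobbed_cups j @ dn n 1 @ edge_word n 0 1"
      using eqv_post[OF a(2), of "dn n 1 @ edge_word n 0 1"] k F by simp
    also have "\<dots> \<approx> a @ [U n] @ ?X @ cups (Suc j) @ edge_word n 0 1"
      using eqv_ctx[OF blobbed_cups_dn[of j n], of a "edge_word n 0 1"] n nj by simp
    also have "\<dots> \<approx> a @ [U n] @ ?X @ blobbed_cups (Suc j)"
      using eqv_pre[OF cr, of "a @ [U n] @ ?X"] by simp
    also have "\<dots> \<approx> a @ ?X @ [U n] @ blobbed_cups (Suc j)"
      using eqv_ctx[OF eqv_sym[OF c], of a "blobbed_cups (Suc j)"] by simp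
    also have "\<dots> \<approx> a @ ?X @ [U n] @ ?X @ cups (Suc j)"
      using eqv_pre[OF blobbed_cups_shift_top[of j], of "a @ ?X"] n nj by simp
    also have "\<dots> \<approx> a @ [U n] @ (blobbed_cups j @ [Gen_e] @ evens j @ cups j) @ [U (2 * j + 1)]"
      using eqv_ctx[OF c, of a "?X @ cups (Suc j)"] by (simp add: cups_Suc blobbed_cups_def)
    also have "eqv \<delta> \<dots> (a @ [U n] @ blobbed_cups j @ [U (2 * j + 1)])"
      using eqv_ctx[OF blobbed_cups_blob[of j], of "a @ [U n]" "[U (2 * j + 1)]"] n nj by simp
    also have "a @ [U n] @ blobbed_cups j @ [U (2 * j + 1)] = a @ [U n] @ ?X @ cups (Suc j)"
      by (simp add: cups_Suc blobbed_cups_def)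
    also have "\<dots> \<approx> a @ blobbed_cups j @ dn n 1"
      using eqv_pre[OF eqv_sym[OF blobbed_cups_dn[of j n]], of a] n nj by simp
    also have "\<dots> \<approx> ?W @ dn n 1"
      using eqv_post[OF eqv_sym[OF a(2)], of "dn n 1"] k F by simp
    finally have 1: "eqv \<delta> ([U n] @ walk_word (r @ [0, 1])) (?W @ dn n 1)" .
    have r1: "r @ [2] \<in> walks n 2"
      using walks_snoc[OF r, of 2] k n by simp
    have r2: "(r @ [2]) @ [1] \<in> walks (Suc n) 1"
      using walks_snoc[OF r1, of 1] by simp
    have "walk_word ((r @ [2]) @ [1]) = ?W @ dn n 1"
      using walk_word_snoc[OF r, of 2] walk_word_snoc[OF r1, of 1] edge_open[of k 2 n'] edge_close[of 2 1 n] k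
      by simp
    then show ?thesis
      using red_walk[OF r2, of \<delta>] 1 by simp
  qed
qed

text \<open>A letter of the smaller level acts on the walk without its last edge, where the
  induction hypothesis applies. The only other letter is U_n, and for it the last two edges
  decide.\<close>

lemma red_Cons:
  assumes IH: "reduces n" and n: "n \<ge> 1" "n < N" and g: "g \<in> gens (Suc n)" and red: "red (Suc n) m v"
  shows "red (Suc n) m (g # v)"
  using red
proof (cases rule: redE)
  case (turn a x i)
  then show ?thesis
    using red_turn[of "g # x" "Suc n" m i a] g eqv_pre[OF turn(4), of "[g]"] by simp
next
  case (blob a x)
  then show ?thesis
    using red_blob[of m "g # x" "Suc n" a] g eqv_pre[OF blob(3), of "[g]"] by simp
next
  case (walk a p)
  then obtain q l where q: "q \<in> walks n l" "p = q @ [m]" "m = l + 1 \<or> m = l - 1"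
    by (auto simp: walks_Suc_iff)
  have "red (Suc n) m (g # walk_word p)"
  proof (cases "g \<in> gens n")
    case True
    obtain y where y: "set y \<subseteq> level_gens n" "walk_word q \<approx> y @ F_word n l"
      using walk_word_factor[OF q(1)] n by auto
    have "red n l ((g # y) @ F_word n l)"
      using IH walks_weights[OF q(1)] True y(1) level_gens_subset[of n]
      by (simp add: reduces_def del: append_Cons)
    then have "red n l (g # walk_word q)"
      using red_eqv[of 1 "g # walk_word q"] eqv_pre[OF y(2), of "[g]"] by simp
    then have rq: "red n l ([g] @ walk_word q)"
      by simp
    have w: "g # walk_word p = ([g] @ walk_word q) @ edge_word n l m"
      using walk_word_snoc[OF q(1), of m] q(2) by simp
    from q(3) show ?thesis
    proof (cases rule: step_cases)
      case open_step
      then show ?thesis using red_open[OF rq open_step] w by (simp add: edge_open)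
    next
      case cross_step
      then show ?thesis using red_cross[of n "[g] @ walk_word q"] rq w by simp
    next
      case close_step
      then show ?thesis
        using red_close[OF rq IH n(2) walks_weights[OF q(1)] close_step q(3)] w edge_close[OF close_step]
        by simp
    qed
  next
    case False
    then have gn: "g = U n" using g by (auto simp: gens_def)
    obtain n' where n': "n = Suc n'" using n by (cases n) auto
    obtain r k where r: "r \<in> walks n' k" "q = r @ [l]" "l = k + 1 \<or> l = k - 1"
      using q(1) n' by (auto simp: walks_Suc_iff)
    have p: "p = r @ [l, m]" using q(2) r(2) by simp
    from q(3) show ?thesis
    proof (cases rule: step_cases)
      case open_step
      then show ?thesis using red_top_open[OF n' n(2) r(1,3) open_step] gn p by simp
    next
      case cross_step
      then have "k = 1 \<or> k = - 1" using r(3) by linarith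
      from red_top_cross[OF IH n' n(2) r(1) this] show ?thesis
        using gn p cross_step by simp
    next
      case close_step
      then show ?thesis using red_top_close[OF IH n' n(2) r(1,3) q(3) close_step(2,1)] gn p by simp
    qed
  qed
  moreover have "eqv a (g # v) (g # walk_word p)"
    using eqv_pre[OF walk(2), of "[g]"] by simp
  ultimately show ?thesis
    using red_eqv by blast
qed

lemma red_F_word:
  assumes "m \<in> weights n" "n \<le> N"
  shows "red n m (F_word n m)"
  using F_word_walk[OF assms] red_walk by blast

text \<open>The induction starts at level 1, where e is the only letter: it squares to \<delta> e at
  weight 1 and blobs the line at weight -1.\<close>

lemma reduces_1:
  assumes "1 \<le> N"
  shows "reduces 1"
  unfolding reduces_def
proof (intro ballI allI impI)
  fix m x assume m: "m \<in> weights 1" and x: "set x \<subseteq> gens 1"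
  have e: "g = Gen_e" if "g \<in> gens 1" for g
    using that by (auto simp: gens_def)
  have F1: "F_word 1 1 = [Gen_e]" "F_word 1 (- 1) = []"
    by (simp_all add: F_word_pos F_word_neg blobbed_cups_def)
  have m1: "m = 1 \<or> m = - 1"
    using m by (auto simp: weights_def elim!: oddE)
  show "red 1 m (x @ F_word 1 m)"
    using x
  proof (induction x)
    case Nil
    then show ?case using red_F_word[OF m assms] by simp
  next
    case (Cons g x)
    then have red: "red 1 m (x @ F_word 1 m)" and g: "g = Gen_e"
      using e by auto
    from red show ?case
    proof (cases rule: redE)
      case (turn a y i)
      then show ?thesis using m1 by auto
    next
      case (blob a y)
      then show ?thesis
        using red_blob[of m "g # y" 1 a] eqv_pre[OF blob(3), of "[g]"] Cons.prems by simp
    next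
      case (walk a p)
      have p: "p = [0, m]"
        using walk(1) walks_Suc_iff[of p 0 m] by (auto split: if_splits)
      have w: "walk_word p = F_word 1 m"
        using m1 F1 edge_cross[of 0] edge_open[of 0 "- 1" 0] walk_word_snoc[of "[0]" 0 0 m] p by auto
      have e1: "eqv a (g # x @ F_word 1 m) (Gen_e # F_word 1 m)"
        using eqv_pre[OF walk(2), of "[g]"] w g by simp
      show ?thesis
      proof (cases "m = 1")
        case True
        then show ?thesis
          using red_walk[OF walk(1)] eqv_trans[OF e1, of \<delta> "[Gen_e]"] eqv_ee w F1 by auto
      next
        case False
        then show ?thesis
          using red_blob[of m "[]" 1 a] e1 m1 F1 by auto
      qed
    qed
  qed
qed

theorem word_reduces:
  assumes "1 \<le> n" "n \<le> N" "m \<in> weights n" "set x \<subseteq> gens n"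
  shows "red n m (x @ F_word n m)"
proof -
  have "reduces n" using assms(1,2)
  proof (induction n rule: dec_induct)
    case base
    then show ?case using reduces_1 by simp
  next
    case (step n)
    then have IH: "reduces n" and n: "n < N" by auto
    show ?case unfolding reduces_def
    proof (intro ballI allI impI)
      fix m x assume "m \<in> weights (Suc n)" "set x \<subseteq> gens (Suc n)"
      then show "red (Suc n) m (x @ F_word (Suc n) m)"
        using red_F_word[of m "Suc n"] red_Cons[OF IH step.hyps(1) n] n
        by (induction x) auto
    qed
  qed
  then show ?thesis using assms by (simp add: reduces_def)
qed

end

subsection \<open>Action on link diagrams\<close>

type_synonym 'p state = "('p \<Rightarrow> 'p) \<times> ('p \<Rightarrow> bool)"

text \<open>
  A pair \<open>(f, d)\<close> encodes a diagram: the involution \<open>f\<close> exchanges the two ends of each strand, and \<open>d\<close> is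
  the set of the ends of blobbed strands. Multiplying by \<open>U_i\<close> connects the strands ending at the
  positions \<open>i - 1\<close> and \<open>i\<close> and puts a new strand there; this is \<open>join\<close>. Fixed points of \<open>f\<close> are free ends.
\<close>

definition join :: "'p \<Rightarrow> 'p \<Rightarrow> 'p state \<Rightarrow> 'p state" where
  "join x y s =
    (\<lambda>z. if z = x then y else if z = y then x
          else if z = fst s x then (if fst s y = y then z else fst s y)
          else if z = fst s y then (if fst s x = x then z else fst s x)
          else fst s z,
     \<lambda>z. if z = x \<or> z = y then False
          else if z = fst s x \<or> z = fst s y then snd s x \<or> snd s y
          else snd s z)"

definition blob :: "'p \<Rightarrow> 'p state \<Rightarrow> 'p state" where
  "blob x s = (fst s, \<lambda>z. snd s z \<or> z = x \<or> z = fst s x)"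

definition perfect :: "'p state \<Rightarrow> bool" where
  "perfect s \<longleftrightarrow> (\<forall>z. fst s (fst s z) = z \<and> fst s z \<noteq> z \<and> snd s (fst s z) = snd s z)"

lemma perfectD:
  assumes "perfect s"
  shows "fst s (fst s z) = z" "fst s z \<noteq> z" "z \<noteq> fst s z" "snd s (fst s z) = snd s z"
  using assms unfolding perfect_def by (blast, blast, metis, blast)

lemma perfect_eq_iff: "perfect s \<Longrightarrow> fst s x = y \<longleftrightarrow> fst s y = x"
  by (metis perfectD(1))

lemma perfect_inj: "perfect s \<Longrightarrow> fst s x = fst s y \<longleftrightarrow> x = y"
  by (metis perfectD(1))

lemma perfect_blob:
  assumes "perfect s"
  shows "perfect (blob x s)"
proof -
  have "fst s z = x \<longleftrightarrow> z = fst s x" for z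
    using perfect_eq_iff[OF assms, of z x] by auto
  then show ?thesis
    using assms perfect_inj[OF assms] unfolding perfect_def blob_def by auto
qed

lemma perfect_join:
  assumes s: "perfect s" and xy: "x \<noteq> y"
  shows "perfect (join x y s)"
  unfolding perfect_def
proof
  fix z
  note p = perfectD[OF s] perfect_inj[OF s]
  show "fst (join x y s) (fst (join x y s) z) = z \<and> fst (join x y s) z \<noteq> z \<and>
    snd (join x y s) (fst (join x y s) z) = snd (join x y s) z"
  proof (cases "fst s x = y")
    case True
    then have "fst s y = x" using p(1) by metis
    then show ?thesis using True xy p by (auto simp: join_def)
  next
    case False
    then have "fst s y \<noteq> x" using p(1) by metis
    then show ?thesis using False xy p by (auto simp: join_def)
  qed
qed

lemma join_join_perfect:
  assumes "perfect s" "x \<noteq> y"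
  shows "join x y (join x y s) = join x y s"
proof -
  obtain f D where fD: "s = (f, D)" by fastforce
  note p = perfectD[OF assms(1), unfolded fD fst_conv snd_conv] perfect_inj[OF assms(1), unfolded fD fst_conv snd_conv]
  have e: "f y = x \<longleftrightarrow> f x = y" "x = f y \<longleftrightarrow> f x = y" using p(1) by metis+
  show ?thesis using assms(2) p e unfolding fD by (auto simp: join_def fun_eq_iff)
qed

text \<open>The arc x-y is the one left by an earlier \<open>join x y\<close>; the two further joins
  only pull it tight. This is the relation U_i U_j U_i = U_i for neighbouring i and j.\<close>

lemma join_absorb:
  assumes s: "perfect s" and d: "distinct [x, y, z]" and xy: "fst s x = y" "\<not> snd s x"
  shows "join x y (join y z s) = s"
proof -
  note p = perfectD[OF s] perfect_inj[OF s]
  obtain f D where fD: "s = (f, D)" by fastforce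
  note p = p[unfolded fD fst_conv snd_conv]
  have yx: "f x = y" "f y = x" "\<not> D x" "\<not> D y" using p(1,4) xy fD by auto
  have "z \<noteq> x" "z \<noteq> y" using d by auto
  then have z: "f z \<noteq> x" "f z \<noteq> y" using yx p(1) by metis+
  show ?thesis
    unfolding fD join_def using d yx z p(1-4) by (auto simp: fun_eq_iff)
qed

lemma join_blob_join:
  assumes s: "perfect s" and d: "x \<noteq> y"
  shows "join x y (blob x (join x y s)) = join x y s"
proof -
  obtain f D where fD: "s = (f, D)" by fastforce
  note p = perfectD[OF s, unfolded fD fst_conv snd_conv] perfect_inj[OF s, unfolded fD fst_conv snd_conv]
  have e: "f y = x \<longleftrightarrow> f x = y" "x = f y \<longleftrightarrow> f x = y" using p(1) by metis+
  show ?thesis using d p e unfolding fD by (auto simp: join_def blob_def fun_eq_iff)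
qed

lemma blob_comm:
  "blob x (blob y s) = blob y (blob x s)"
  by (auto simp: blob_def fun_eq_iff)

lemma join_blob_comm:
  assumes s: "perfect s" and d: "distinct [x, y, z]"
  shows "join x y (blob z s) = blob z (join x y s)"
proof -
  obtain f D where fD: "s = (f, D)" by fastforce
  note p = perfectD[OF s, unfolded fD fst_conv snd_conv] perfect_inj[OF s, unfolded fD fst_conv snd_conv]
  have e: "f y = x \<longleftrightarrow> f x = y" "x = f y \<longleftrightarrow> f x = y" "f z = x \<longleftrightarrow> f x = z" "x = f z \<longleftrightarrow> f x = z"
    "f z = y \<longleftrightarrow> f y = z" "y = f z \<longleftrightarrow> f y = z"
    using p(1) by metis+
  show ?thesis using d p e unfolding fD by (auto simp: join_def blob_def fun_eq_iff)
qed

lemma join_comm: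
  assumes s: "perfect s" and d: "distinct [x, y, z, w]"
  shows "join x y (join z w s) = join z w (join x y s)"
proof -
  obtain f D where fD: "s = (f, D)" by fastforce
  note p = perfectD[OF s, unfolded fD fst_conv snd_conv] perfect_inj[OF s, unfolded fD fst_conv snd_conv]
  have e: "f y = x \<longleftrightarrow> f x = y" "x = f y \<longleftrightarrow> f x = y" "f z = x \<longleftrightarrow> f x = z" "x = f z \<longleftrightarrow> f x = z"
    "f z = y \<longleftrightarrow> f y = z" "y = f z \<longleftrightarrow> f y = z" "f w = x \<longleftrightarrow> f x = w" "x = f w \<longleftrightarrow> f x = w"
    "f w = y \<longleftrightarrow> f y = w" "y = f w \<longleftrightarrow> f y = w" "f w = z \<longleftrightarrow> f z = w" "z = f w \<longleftrightarrow> f z = w"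
    using p(1) by metis+
  have neq: "x \<noteq> y" "x \<noteq> z" "x \<noteq> w" "y \<noteq> z" "y \<noteq> w" "z \<noteq> w" using d by auto
  consider (1) "f x = y" | (2) "f x \<noteq> y" "f z = w" | (3) "f x = z" | (4) "f x = w"
    | (5) "f x \<noteq> y" "f x \<noteq> z" "f x \<noteq> w" "f z \<noteq> w" "f y = z"
    | (6) "f x \<noteq> y" "f x \<noteq> z" "f x \<noteq> w" "f z \<noteq> w" "f y = w"
    | (7) "f x \<noteq> y" "f x \<noteq> z" "f x \<noteq> w" "f z \<noteq> w" "f y \<noteq> z" "f y \<noteq> w"
    by blast
  then show ?thesis
  proof cases
    case 1 then show ?thesis using neq p e unfolding fD by (auto simp: join_def fun_eq_iff)
  next
    case 2 then show ?thesis using neq p e unfolding fD by (auto simp: join_def fun_eq_iff)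
  next
    case 3 then show ?thesis using neq p e unfolding fD by (auto simp: join_def fun_eq_iff)
  next
    case 4 then show ?thesis using neq p e unfolding fD by (auto simp: join_def fun_eq_iff)
  next
    case 5 then show ?thesis using neq p e unfolding fD by (auto simp: join_def fun_eq_iff)
  next
    case 6 then show ?thesis using neq p e unfolding fD by (auto simp: join_def fun_eq_iff)
  next
    case 7 then show ?thesis using neq p e unfolding fD by (auto simp: join_def fun_eq_iff)
  qed
qed

text \<open>Without free ends the default branches of \<open>join\<close> disappear, and the new
  partner of a point is a function of its old partner. In this form two joins can be
  compared.\<close>

lemma join_other:
  assumes s: "perfect s" and z: "z \<noteq> x" "z \<noteq> y"
  shows "fst (join x y s) z =
      (if fst s z = x then fst s y else if fst s z = y then fst s x else fst s z)"
    and "snd (join x y s) z = (if fst s z = x \<or> fst s z = y then snd s x \<or> snd s y else snd s z)"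
proof -
  have "z = fst s x \<longleftrightarrow> fst s z = x" "z = fst s y \<longleftrightarrow> fst s z = y"
    using perfectD(1)[OF s] by metis+
  then show "fst (join x y s) z =
      (if fst s z = x then fst s y else if fst s z = y then fst s x else fst s z)"
    "snd (join x y s) z = (if fst s z = x \<or> fst s z = y then snd s x \<or> snd s y else snd s z)"
    using z perfectD(2)[OF s] by (auto simp: join_def)
qed

section \<open>Scalars of the action, and the defining relations on diagrams\<close>

locale blob_params =
  fixes q2 \<gamma> \<delta> :: "'k::comm_ring_1"
begin

text \<open>If x and y already bound one strand, joining closes a loop, worth \<gamma> or q + 1/q
  according to its blob. Otherwise two strands merge, and a factor \<delta> appears when both carry
  blobs.\<close>

definition join_coef :: "'p \<Rightarrow> 'p \<Rightarrow> 'p state \<Rightarrow> 'k" where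
  "join_coef x y s =
    (if fst s x = y then if snd s x then \<gamma> else q2 else if snd s x \<and> snd s y then \<delta> else 1)"

definition blob_coef :: "'p \<Rightarrow> 'p state \<Rightarrow> 'k" where
  "blob_coef x s = (if snd s x then \<delta> else 1)"

text \<open>Either order produces the same loops and merges the same blobs. The cases list how the
  four points are linked, which determines every coefficient.\<close>

lemma join_coef_comm:
  assumes s: "perfect s" and d: "distinct [x, y, z, w]"
  shows "join_coef x y (join z w s) * join_coef z w s = join_coef z w (join x y s) * join_coef x y s"
proof -
  have neq: "x \<noteq> y" "x \<noteq> z" "x \<noteq> w" "y \<noteq> z" "y \<noteq> w" "z \<noteq> w" using d by auto
  note p = perfectD[OF s] and e = perfect_eq_iff[OF s]
  have c: "join_coef x y (join z w s) =
      (if (if fst s x = z then fst s w else if fst s x = w then fst s z else fst s x) = y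
       then if (if fst s x = z \<or> fst s x = w then snd s z \<or> snd s w else snd s x) then \<gamma> else q2
       else if (if fst s x = z \<or> fst s x = w then snd s z \<or> snd s w else snd s x) \<and>
         (if fst s y = z \<or> fst s y = w then snd s z \<or> snd s w else snd s y) then \<delta> else 1)"
    "join_coef z w (join x y s) =
      (if (if fst s z = x then fst s y else if fst s z = y then fst s x else fst s z) = w
       then if (if fst s z = x \<or> fst s z = y then snd s x \<or> snd s y else snd s z) then \<gamma> else q2
       else if (if fst s z = x \<or> fst s z = y then snd s x \<or> snd s y else snd s z) \<and>
         (if fst s w = x \<or> fst s w = y then snd s x \<or> snd s y else snd s w) then \<delta> else 1)"
    unfolding join_coef_def using neq by (simp_all add: join_other[OF s])
  consider (1) "fst s x = y" | (2) "fst s x \<noteq> y" "fst s z = w" | (3) "fst s x = z" | (4) "fst s x = w"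
    | (5) "fst s x \<noteq> y" "fst s x \<noteq> z" "fst s x \<noteq> w" "fst s z \<noteq> w" by blast
  then show ?thesis
  proof cases
    case 1
    then have *: "fst s y = x" "fst s z \<noteq> x" "fst s z \<noteq> y" "fst s w \<noteq> x" "fst s w \<noteq> y"
      using neq p(1) by metis+
    show ?thesis unfolding c unfolding join_coef_def using neq 1 * by simp
  next
    case 2
    then have *: "fst s w = z" "fst s x \<noteq> z" "fst s x \<noteq> w" "fst s y \<noteq> z" "fst s y \<noteq> w"
      using neq p(1) by metis+
    show ?thesis unfolding c unfolding join_coef_def using neq 2 * by simp
  next
    case 3
    then have *: "fst s z = x" "snd s z = snd s x" "fst s y \<noteq> z" "fst s y \<noteq> x" "fst s w \<noteq> x"
      "fst s w = y \<longleftrightarrow> fst s y = w" "fst s y = w \<Longrightarrow> snd s w = snd s y"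
      using neq p(1,4) by metis+
    show ?thesis unfolding c unfolding join_coef_def using neq 3 *
      by (cases "fst s y = w"; cases "snd s x"; cases "snd s y"; cases "snd s w") simp_all
  next
    case 4
    then have *: "fst s w = x" "snd s w = snd s x" "fst s y \<noteq> w" "fst s y \<noteq> x" "fst s z \<noteq> x" "fst s z \<noteq> w"
      "fst s z = y \<longleftrightarrow> fst s y = z" "fst s y = z \<Longrightarrow> snd s z = snd s y"
      using neq p(1,4) by metis+
    show ?thesis unfolding c unfolding join_coef_def using neq 4 *
      by (cases "fst s y = z"; cases "snd s x"; cases "snd s y"; cases "snd s z") simp_all
  next
    case 5
    then have *: "fst s z \<noteq> x" "fst s w \<noteq> x" "fst s w \<noteq> z" "fst s y \<noteq> x"
      using e[of x z] e[of x w] e[of z w] e[of x y] by auto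
    consider (y) "fst s y = z" | (w) "fst s y = w" | (no) "fst s y \<noteq> z" "fst s y \<noteq> w" by blast
    then show ?thesis
    proof cases
      case y
      then have "fst s z = y" "snd s z = snd s y" "fst s w \<noteq> y" using neq p(1,4) by metis+
      with y show ?thesis unfolding c unfolding join_coef_def using neq 5 *
        by (cases "snd s x"; cases "snd s y"; cases "snd s w") simp_all
    next
      case w
      then have "fst s w = y" "snd s w = snd s y" "fst s z \<noteq> y" using neq p(1,4) by metis+
      with w show ?thesis unfolding c unfolding join_coef_def using neq 5 *
        by (cases "snd s x"; cases "snd s y"; cases "snd s z") simp_all
    next
      case no
      then have "fst s z \<noteq> y" "fst s w \<noteq> y" using e[of y z] e[of y w] by auto
      with no show ?thesis unfolding c unfolding join_coef_def using neq 5 * by simp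
    qed
  qed
qed

lemma join_sym:
  assumes s: "perfect s"
  shows "join x y s = join y x s"
proof -
  obtain f D where fD: "s = (f, D)" by fastforce
  note p = perfectD[OF s, unfolded fD fst_conv snd_conv] perfect_inj[OF s, unfolded fD fst_conv snd_conv]
  have e: "f y = x \<longleftrightarrow> f x = y" "x = f y \<longleftrightarrow> f x = y" using p(1) by metis+
  show ?thesis using p e unfolding fD by (auto simp: join_def fun_eq_iff)
qed

lemma join_coef_sym:
  assumes s: "perfect s"
  shows "join_coef x y s = join_coef y x s"
proof -
  have "fst s x = y \<longleftrightarrow> fst s y = x" by (rule perfect_eq_iff[OF s])
  moreover have "fst s x = y \<Longrightarrow> snd s y = snd s x" using perfectD(4)[OF s, of x] by simp
  ultimately show ?thesis unfolding join_coef_def by (simp add: conj_commute)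
qed

lemma join_absorb_coef:
  assumes s: "perfect s" and d: "distinct [x, y, z]" and xy: "fst s x = y" "\<not> snd s x"
  shows "join_coef x y (join y z s) * join_coef y z s = 1"
proof -
  obtain f D where fD: "s = (f, D)" by fastforce
  note p = perfectD[OF s, unfolded fD fst_conv snd_conv]
  have yx: "f x = y" "f y = x" "\<not> D x" "\<not> D y" using p(1,4) xy fD by auto
  have "z \<noteq> x" "z \<noteq> y" using d by auto
  then have "f z \<noteq> x" "f z \<noteq> y" using yx p(1) by metis+
  then show ?thesis
    unfolding fD using d yx p(1-4) by (auto simp: join_def join_coef_def)
qed

lemma join_blob_coef_comm:
  assumes s: "perfect s" and d: "distinct [x, y, z]"
  shows "join_coef x y (blob z s) * blob_coef z s = blob_coef z (join x y s) * join_coef x y s"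
proof -
  have neq: "x \<noteq> y" "x \<noteq> z" "y \<noteq> z" using d by auto
  note p = perfectD[OF s]
  have c: "blob_coef z (join x y s) =
      (if (if fst s z = x \<or> fst s z = y then snd s x \<or> snd s y else snd s z) then \<delta> else 1)"
    unfolding blob_coef_def using neq by (simp add: join_other[OF s])
  have c': "join_coef x y (blob z s) =
      (if fst s x = y then if snd s x \<or> x = fst s z then \<gamma> else q2
       else if (snd s x \<or> x = fst s z) \<and> (snd s y \<or> y = fst s z) then \<delta> else 1)"
    unfolding join_coef_def blob_def using neq by simp
  have *: "fst s z = x \<Longrightarrow> snd s x = snd s z" "fst s z = y \<Longrightarrow> snd s y = snd s z"
    "fst s x = y \<Longrightarrow> fst s z \<noteq> x" "fst s x = y \<Longrightarrow> fst s z \<noteq> y"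
    using neq p(1,4) by metis+
  show ?thesis unfolding c c' unfolding join_coef_def blob_coef_def using neq *
    by (cases "fst s x = y"; cases "fst s z = x"; cases "fst s z = y"; cases "snd s x"; cases "snd s y"; cases "snd s z") auto
qed

lemma blob_coef_comm:
  assumes s: "perfect s"
  shows "blob_coef x (blob y s) * blob_coef y s = blob_coef y (blob x s) * blob_coef x s"
proof -
  have "fst s x = y \<longleftrightarrow> fst s y = x" "x = fst s y \<longleftrightarrow> fst s y = x" "y = fst s x \<longleftrightarrow> fst s y = x"
    using perfect_eq_iff[OF s] by metis+
  moreover have "snd s (fst s y) = snd s y" using perfectD(4)[OF s] .
  ultimately show ?thesis by (auto simp: blob_coef_def blob_def)
qed

text \<open>The flag selects the row: \<open>True\<close> is left multiplication,
  \<open>False\<close> is multiplication from the other side. A letter sends a diagram to a multiple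
  of a diagram, so a scalar with one diagram suffices as a vector. Positions count from 0;
  \<open>Suc (i - 1)\<close> keeps the two points distinct even for i = 0, so every letter preserves
  perfect diagrams.\<close>

fun gen_act :: "bool \<Rightarrow> gen \<Rightarrow> 'k \<times> (bool \<times> nat) state \<Rightarrow> 'k \<times> (bool \<times> nat) state" where
  "gen_act b Gen_e (c, s) = (blob_coef (b, 0) s * c, blob (b, 0) s)"
| "gen_act b (Gen_U i) (c, s) = (join_coef (b, i - 1) (b, Suc (i - 1)) s * c, join (b, i - 1) (b, Suc (i - 1)) s)"

definition word_act :: "bool \<Rightarrow> gen list \<Rightarrow> 'k \<times> (bool \<times> nat) state \<Rightarrow> 'k \<times> (bool \<times> nat) state" where
  "word_act b w = foldr (gen_act b) w"

definition scale :: "'k \<Rightarrow> 'k \<times> (bool \<times> nat) state \<Rightarrow> 'k \<times> (bool \<times> nat) state" where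
  "scale a cs = (a * fst cs, snd cs)"

lemma word_act_Nil [simp]: "word_act b [] cs = cs"
  and word_act_Cons [simp]: "word_act b (g # w) cs = gen_act b g (word_act b w cs)"
  and word_act_append [simp]: "word_act b (v @ w) cs = word_act b v (word_act b w cs)"
  by (simp_all add: word_act_def)

lemma gen_act_scale: "gen_act b g (scale a cs) = scale a (gen_act b g cs)"
  by (cases g; cases cs) (auto simp: scale_def)

lemma word_act_scale: "word_act b w (scale a cs) = scale a (word_act b w cs)"
  by (induction w) (auto simp: gen_act_scale)

lemma scale_1 [simp]: "scale 1 cs = cs"
  and scale_scale: "scale a (scale b cs) = scale (a * b) cs"
  by (auto simp: scale_def mult.assoc)

lemma gen_act_perfect: "perfect (snd cs) \<Longrightarrow> perfect (snd (gen_act b g cs))"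
  by (cases g; cases cs) (auto intro: perfect_blob perfect_join)

lemma word_act_perfect: "perfect (snd cs) \<Longrightarrow> perfect (snd (word_act b w cs))"
  by (induction w) (auto intro: gen_act_perfect)

text \<open>The two rows form a bimodule. This commutation later allows letters appended at the
  right end of a word to be applied last, on an already known diagram.\<close>

lemma gen_act_comm:
  assumes "perfect (snd cs)" "b \<noteq> b'"
  shows "gen_act b g (gen_act b' h cs) = gen_act b' h (gen_act b g cs)"
proof -
  obtain c s where cs: "cs = (c, s)" by (cases cs)
  then have s: "perfect s" using assms(1) by simp
  have m: "u * (v * c) = u' * (v' * c)" if "u * v = u' * v'" for u v u' v' :: 'k
    using that by (metis mult.assoc)
  show ?thesis
  proof (cases g)
    case Gen_e
    then show ?thesis
    proof (cases h)
      case Gen_e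
      then show ?thesis using \<open>g = Gen_e\<close> cs
        by (auto intro!: m blob_comm blob_coef_comm s)
    next
      case (Gen_U i)
      have "distinct [(b', i - 1), (b', Suc (i - 1)), (b, 0)]" using assms(2) by auto
      from join_blob_comm[OF s this] join_blob_coef_comm[OF s this] show ?thesis
        using Gen_U \<open>g = Gen_e\<close> cs by (auto intro!: m)
    qed
  next
    case (Gen_U i)
    show ?thesis
    proof (cases h)
      case Gen_e
      have "distinct [(b, i - 1), (b, Suc (i - 1)), (b', 0)]" using assms(2) by auto
      from join_blob_comm[OF s this] join_blob_coef_comm[OF s this] show ?thesis
        using Gen_U Gen_e cs by (auto intro!: m)
    next
      case (Gen_U j)
      have "distinct [(b, i - 1), (b, Suc (i - 1)), (b', j - 1), (b', Suc (j - 1))]" using assms(2) by auto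
      from join_comm[OF s this] join_coef_comm[OF s this] show ?thesis
        using Gen_U \<open>g = Gen_U i\<close> cs by (auto intro!: m)
    qed
  qed
qed

lemma word_act_gen_comm:
  assumes "perfect (snd cs)" "b \<noteq> b'"
  shows "word_act b w (gen_act b' h cs) = gen_act b' h (word_act b w cs)"
proof (induction w)
  case (Cons g w)
  then show ?case
    using gen_act_comm[OF word_act_perfect[OF assms(1)] assms(2)] by simp
qed simp

lemma word_act_comm:
  assumes "perfect (snd cs)" "b \<noteq> b'"
  shows "word_act b v (word_act b' w cs) = word_act b' w (word_act b v cs)"
proof (induction w)
  case (Cons g w)
  then show ?case
    using word_act_gen_comm[OF word_act_perfect[OF assms(1)] assms(2)] by simp
qed simp

definition diagram_eqv :: "bool \<Rightarrow> 'k \<Rightarrow> gen list \<Rightarrow> gen list \<Rightarrow> bool" where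
  "diagram_eqv b a v w \<longleftrightarrow> (\<forall>cs. perfect (snd cs) \<longrightarrow> word_act b v cs = scale a (word_act b w cs))"

text \<open>Besides making coefficients well defined on the algebra, this gives the diagrams access
  to every straightening identity of words.\<close>

lemma blob_rewriting_diagram: "blob_rewriting N (diagram_eqv b) q2 \<gamma> \<delta>"
proof
  fix v w x y a c
  show "diagram_eqv b 1 v v" by (simp add: diagram_eqv_def)
  show "diagram_eqv b a v w \<Longrightarrow> diagram_eqv b c w x \<Longrightarrow> diagram_eqv b (a * c) v x"
    by (simp add: diagram_eqv_def scale_scale)
  show "diagram_eqv b 1 v w \<Longrightarrow> diagram_eqv b 1 w v" by (simp add: diagram_eqv_def)
  show "diagram_eqv b a v w \<Longrightarrow> diagram_eqv b a (x @ v @ y) (x @ w @ y)"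
    unfolding diagram_eqv_def by (metis word_act_append word_act_perfect word_act_scale)
next
  fix i :: nat assume "1 \<le> i" "i < N"
  show "diagram_eqv b q2 [U i, U i] [U i]"
    unfolding diagram_eqv_def
  proof (intro allI impI)
    fix cs :: "'k \<times> (bool \<times> nat) state" assume p: "perfect (snd cs)"
    obtain c s where cs: "cs = (c, s)" by (cases cs)
    let ?s = "join (b, i - 1) (b, Suc (i - 1)) s"
    have "join_coef (b, i - 1) (b, Suc (i - 1)) ?s = q2"
      by (simp add: join_coef_def) (simp add: join_def)
    then show "word_act b [U i, U i] cs = scale q2 (word_act b [U i] cs)"
      using join_join_perfect[of s] p cs by (simp add: scale_def)
  qed
next
  fix i j :: nat assume ij: "1 \<le> i" "i < N" "1 \<le> j" "j < N" "j = i + 1 \<or> i = j + 1"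
  have m: "u * (v * t) = t" if "u * v = 1" for u v t :: 'k
    using that by (simp flip: mult.assoc)
  show "diagram_eqv b 1 [U i, U j, U i] [U i]"
    unfolding diagram_eqv_def
  proof (intro allI impI)
    fix cs :: "'k \<times> (bool \<times> nat) state" assume p: "perfect (snd cs)"
    obtain c s where cs: "cs = (c, s)" by (cases cs)
    let ?s = "join (b, i - 1) (b, Suc (i - 1)) s"
    have ps: "perfect ?s" using p cs by (auto intro: perfect_join)
    from ij(5) show "word_act b [U i, U j, U i] cs = scale 1 (word_act b [U i] cs)"
    proof
      assume j: "j = i + 1"
      have d: "distinct [(b, i - 1), (b, Suc (i - 1)), (b, Suc (j - 1))]" using ij(1) j by auto
      have j': "j - 1 = Suc (i - 1)" using ij(1) j by simp
      have f: "fst ?s (b, i - 1) = (b, Suc (i - 1))" "\<not> snd ?s (b, i - 1)"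
        by (simp_all add: join_def)
      show ?thesis
        using m[OF join_absorb_coef[OF ps d f]] join_absorb[OF ps d f] by (simp only: word_act_Cons word_act_Nil cs gen_act.simps scale_1 j')
    next
      assume i: "i = j + 1"
      let ?x = "(b, Suc (i - 1))" and ?y = "(b, i - 1)" and ?z = "(b, j - 1)"
      have i': "Suc (j - 1) = i - 1" using ij(3) i by simp
      have d: "distinct [?x, ?y, ?z]" using ij(3) i by auto
      have f: "fst ?s ?x = ?y" "\<not> snd ?s ?x"
        by (simp_all add: join_def)
      have ps': "perfect (join ?y ?z ?s)"
        by (rule perfect_join[OF ps]) (use d in auto)
      have a: "join ?y ?x (join ?z ?y ?s) = ?s"
        using join_absorb[OF ps d f] join_sym[OF ps, of ?y ?z] join_sym[OF ps', of ?x ?y] by simp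
      have "join_coef ?y ?x (join ?z ?y ?s) * join_coef ?z ?y ?s = 1"
        using join_absorb_coef[OF ps d f] join_sym[OF ps, of ?y ?z] join_coef_sym[OF ps', of ?x ?y]
          join_coef_sym[OF ps, of ?y ?z] by simp
      from m[OF this] show ?thesis
        using a by (simp only: word_act_Cons word_act_Nil cs gen_act.simps scale_1 i')
    qed
  qed
next
  have m: "u * (v * t) = u' * (v' * t)" if "u * v = u' * v'" for u v u' v' t :: 'k
    using that by (simp flip: mult.assoc)
  {
    fix i j :: nat assume ij: "1 \<le> i" "i < N" "1 \<le> j" "j < N" "j \<noteq> i + 1" "i \<noteq> j + 1"
    show "diagram_eqv b 1 [U i, U j] [U j, U i]"
    proof (cases "i = j")
      case False
      have d: "distinct [(b, i - 1), (b, Suc (i - 1)), (b, j - 1), (b, Suc (j - 1))]"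
        using False ij by auto
      show ?thesis
        unfolding diagram_eqv_def
      proof (intro allI impI)
        fix cs :: "'k \<times> (bool \<times> nat) state" assume p: "perfect (snd cs)"
        obtain c s where cs: "cs = (c, s)" by (cases cs)
        have s: "perfect s" using p cs by simp
        show "word_act b [U i, U j] cs = scale 1 (word_act b [U j, U i] cs)"
          using join_comm[OF s d] m[OF join_coef_comm[OF s d]]
          by (simp only: word_act_Cons word_act_Nil cs gen_act.simps scale_1)
      qed
    qed (simp add: diagram_eqv_def)
  }
  fix i :: nat assume i: "1 \<le> i" "i < N" "i \<noteq> 1"
  have d: "distinct [(b, i - 1), (b, Suc (i - 1)), (b, 0)]"
    using i by auto
  show "diagram_eqv b 1 [U i, Gen_e] [Gen_e, U i]"
    unfolding diagram_eqv_def
  proof (intro allI impI)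
    fix cs :: "'k \<times> (bool \<times> nat) state" assume p: "perfect (snd cs)"
    obtain c s where cs: "cs = (c, s)" by (cases cs)
    have s: "perfect s" using p cs by simp
    show "word_act b [U i, Gen_e] cs = scale 1 (word_act b [Gen_e, U i] cs)"
      using join_blob_comm[OF s d] m[OF join_blob_coef_comm[OF s d]]
      by (simp only: word_act_Cons word_act_Nil cs gen_act.simps scale_1)
  qed
next
  show "diagram_eqv b \<gamma> [U 1, Gen_e, U 1] [U 1]"
    unfolding diagram_eqv_def
  proof (intro allI impI)
    fix cs :: "'k \<times> (bool \<times> nat) state" assume p: "perfect (snd cs)"
    obtain c s where cs: "cs = (c, s)" by (cases cs)
    let ?s = "join (b, 0) (b, Suc 0) s"
    have "join_coef (b, 0) (b, Suc 0) (blob (b, 0) ?s) = \<gamma>" "blob_coef (b, 0) ?s = 1"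
      by (simp_all add: join_coef_def blob_coef_def) (simp_all add: blob_def join_def)
    then show "word_act b [U 1, Gen_e, U 1] cs = scale \<gamma> (word_act b [U 1] cs)"
      using join_blob_join[of s "(b, 0)" "(b, Suc 0)"] p cs by (simp add: scale_def)
  qed
next
  show "diagram_eqv b \<delta> [Gen_e, Gen_e] [Gen_e]"
    unfolding diagram_eqv_def
  proof (intro allI impI)
    fix cs :: "'k \<times> (bool \<times> nat) state" assume p: "perfect (snd cs)"
    obtain c s where cs: "cs = (c, s)" by (cases cs)
    have "blob_coef (b, 0) (blob (b, 0) s) = \<delta>" "blob (b, 0) (blob (b, 0) s) = blob (b, 0) s"
      by (simp_all add: blob_coef_def blob_def)
    then show "word_act b [Gen_e, Gen_e] cs = scale \<delta> (word_act b [Gen_e] cs)"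
      using cs by (simp add: scale_def)
  qed
qed

end

subsection \<open>Diagrams of walks\<close>

definition swap :: "(bool \<times> nat) state \<Rightarrow> (bool \<times> nat) state" where
  "swap s = (\<lambda>z. apfst Not (fst s (apfst Not z)), \<lambda>z. snd s (apfst Not z))"

text \<open>One half of a diagram: strands leaving the row are cut and become free ends, but keep
  their blobs.\<close>

definition view :: "bool \<Rightarrow> (bool \<times> nat) state \<Rightarrow> (bool \<times> nat) state" where
  "view b s = (\<lambda>z. if fst z = b \<and> fst (fst s z) = b then fst s z else z, \<lambda>z. fst z = b \<and> snd s z)"

lemma apfst_Not [simp]: "apfst Not (apfst Not z) = z"
  by (cases z) simp

lemma swap_swap [simp]: "swap (swap s) = s"
  by (simp add: swap_def)

lemma apfst_Not_inj: "apfst Not z = apfst Not w \<longleftrightarrow> z = w"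
  by (cases z; cases w) auto

lemma swap_join: "swap (join (b, i) (b, j) s) = join (\<not> b, i) (\<not> b, j) (swap s)"
proof -
  have 1: "fst (join (apfst Not x) (apfst Not y) (swap s)) (apfst Not w) = apfst Not (fst (join x y s) w)" for x y w
    by (simp add: join_def swap_def apfst_Not_inj)
  have 2: "snd (join (apfst Not x) (apfst Not y) (swap s)) (apfst Not w) = snd (join x y s) w" for x y w
    by (simp add: join_def swap_def apfst_Not_inj)
  show ?thesis
  proof (rule prod_eqI; rule ext)
    fix z :: "bool \<times> nat"
    show "fst (swap (join (b, i) (b, j) s)) z = fst (join (\<not> b, i) (\<not> b, j) (swap s)) z"
      using 1[of "(b, i)" "(b, j)" "apfst Not z"] by (simp add: swap_def)
    show "snd (swap (join (b, i) (b, j) s)) z = snd (join (\<not> b, i) (\<not> b, j) (swap s)) z"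
      using 2[of "(b, i)" "(b, j)" "apfst Not z"] by (simp add: swap_def)
  qed
qed

lemma swap_blob: "swap (blob (b, i) s) = blob (\<not> b, i) (swap s)"
proof -
  have "z = (\<not> b, i) \<longleftrightarrow> apfst Not z = (b, i)" for z
    by (cases z) auto
  moreover have "z = apfst Not a \<longleftrightarrow> apfst Not z = a" for z a :: "bool \<times> nat"
    by (cases a; cases z) auto
  ultimately show ?thesis
    by (simp add: swap_def blob_def fun_eq_iff)
qed

text \<open>The branches of \<open>join\<close> for free ends are made for this: a strand continued
  by one that leaves the row becomes free itself.\<close>

lemma view_join:
  assumes "i \<noteq> j"
  shows "view b (join (b, i) (b, j) s) = join (b, i) (b, j) (view b s)"
proof (rule prod_eqI)
  show "fst (view b (join (b, i) (b, j) s)) = fst (join (b, i) (b, j) (view b s))"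
  proof
    fix z :: "bool \<times> nat"
    show "fst (view b (join (b, i) (b, j) s)) z = fst (join (b, i) (b, j) (view b s)) z"
      using assms
      by (cases "fst z = b"; cases "fst (fst s (b, i)) = b"; cases "fst (fst s (b, j)) = b"; cases "fst (fst s z) = b")
        (auto simp: view_def join_def)
  qed
  show "snd (view b (join (b, i) (b, j) s)) = snd (join (b, i) (b, j) (view b s))"
  proof
    fix z :: "bool \<times> nat"
    show "snd (view b (join (b, i) (b, j) s)) z = snd (join (b, i) (b, j) (view b s)) z"
      using assms
      by (cases "fst z = b"; cases "fst (fst s (b, i)) = b"; cases "fst (fst s (b, j)) = b"; cases "fst (fst s z) = b")
        (auto simp: view_def join_def)
  qed
qed

lemma view_blob: "view b (blob (b, i) s) = blob (b, i) (view b s)"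
  by (cases "fst s (b, i)") (auto simp: view_def blob_def fun_eq_iff)

lemma view_swap: "view b (swap s) = swap (view (\<not> b) s)"
  by (auto simp: view_def swap_def fun_eq_iff)

text \<open>Joining x to one end of a plain arc y-z pulls the strand at x over to z and leaves a
  plain arc x-y. The diagram is thus relabelled by a 3-cycle, with its structure unchanged.\<close>

lemma join_cycle:
  assumes s: "perfect s" and yz: "fst s y = z" "\<not> snd s y" and d: "distinct [x, y, z]"
  defines "\<kappa> \<equiv> \<lambda>t. if t = x then z else if t = z then y else if t = y then x else t"
  shows "fst (join x y s) (\<kappa> t) = \<kappa> (fst s t)" "snd (join x y s) (\<kappa> t) = snd s t"
proof -
  note p = perfectD[OF s]
  have n: "x \<noteq> y" "x \<noteq> z" "y \<noteq> z" using d by auto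
  have zy: "fst s z = y" "\<not> snd s z" using p yz by metis+
  have fx: "fst s x \<noteq> x" "fst s x \<noteq> y" "fst s x \<noteq> z" using p zy yz n by metis+
  consider "t = x" | "t = y" | "t = z" | "t = fst s x" "t \<noteq> x" "t \<noteq> y" "t \<noteq> z"
    | "t \<noteq> x" "t \<noteq> y" "t \<noteq> z" "t \<noteq> fst s x" by blast
  then have "fst (join x y s) (\<kappa> t) = \<kappa> (fst s t) \<and> snd (join x y s) (\<kappa> t) = snd s t"
  proof cases
    case 1 then show ?thesis using n fx yz zy by (auto simp: join_def \<kappa>_def)
  next
    case 2 then show ?thesis using n fx yz zy by (auto simp: join_def \<kappa>_def)
  next
    case 3 then show ?thesis using n fx yz zy by (auto simp: join_def \<kappa>_def)
  next
    case 4
    then show ?thesis using n fx yz zy p by (auto simp: join_def \<kappa>_def)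
  next
    case 5
    then have "fst s t \<noteq> x" "fst s t \<noteq> y" "fst s t \<noteq> z" using p(1) yz zy by metis+
    then show ?thesis using 5 n yz by (auto simp: join_def \<kappa>_def)
  qed
  then show "fst (join x y s) (\<kappa> t) = \<kappa> (fst s t)" "snd (join x y s) (\<kappa> t) = snd s t"
    by auto
qed

text \<open>The product of the 3-cycles met when an arc at i, i + 1 slides to positions 0, 1: the
  points it passes move two places to the right.\<close>

definition rot :: "bool \<Rightarrow> nat \<Rightarrow> bool \<times> nat \<Rightarrow> bool \<times> nat" where
  "rot b i z = (if fst z \<noteq> b then z else if snd z < i then (b, snd z + 2) else if snd z = i then (b, 0)
    else if snd z = Suc i then (b, 1) else z)"

lemma rot_surj: "\<exists>w. rot b i w = z"
proof (cases "fst z = b")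
  case False
  then show ?thesis by (intro exI[of _ z]) (simp add: rot_def)
next
  case True
  then obtain k where z: "z = (b, k)" by (cases z) auto
  consider "k = 0" | "k = 1" | "2 \<le> k" "k < i + 2" | "k \<ge> i + 2" by linarith
  then show ?thesis
  proof cases
    case 1 then show ?thesis by (intro exI[of _ "(b, i)"]) (simp add: rot_def z)
  next
    case 2 then show ?thesis by (intro exI[of _ "(b, Suc i)"]) (simp add: rot_def z)
  next
    case 3 then show ?thesis by (intro exI[of _ "(b, k - 2)"]) (auto simp: rot_def z)
  next
    case 4 then show ?thesis by (intro exI[of _ "(b, k)"]) (auto simp: rot_def z)
  qed
qed

definition cup_partner :: "nat \<Rightarrow> nat" where
  "cup_partner z = (if even z then Suc z else z - 1)"

type_synonym half = "(nat \<Rightarrow> nat) \<times> (nat \<Rightarrow> bool) \<times> (nat \<Rightarrow> nat)"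

text \<open>
  A half diagram is a triple \<open>(f, d, ln)\<close>: a partial matching \<open>f\<close> of the points \<open>0, 1, \<dots>\<close>, the set \<open>d\<close>
  of points on blobbed arcs, and the increasing enumeration \<open>ln\<close> of the unmatched points.
  \<open>full c bl\<close> completes it at the bottom by \<open>c div 2\<close> cups followed by the through lines.
\<close>

definition full :: "nat \<Rightarrow> bool \<Rightarrow> half \<Rightarrow> (bool \<times> nat) state" where
  "full c bl h =
    (\<lambda>(b, z). if b then if fst h z = z then (False, c + (THE r. snd (snd h) r = z)) else (True, fst h z)
       else if z < c then (False, cup_partner z) else (True, snd (snd h) (z - c)),
     \<lambda>(b, z). if b then fst (snd h) z else z = c \<and> bl)"

text \<open>The enumeration of free points is total: every point beyond those reached by a walk is
  free, so there are always infinitely many through lines and no length has to be recorded.\<close>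

definition half_ok :: "bool \<Rightarrow> half \<Rightarrow> bool" where
  "half_ok bl h \<longleftrightarrow> (case h of (f, d, ln) \<Rightarrow>
    strict_mono ln \<and> (\<forall>z. f (f z) = z) \<and> (\<forall>z. f z = z \<longleftrightarrow> z \<in> range ln) \<and>
    (\<forall>z. d (f z) = d z) \<and> (\<forall>r. d (ln r) \<longleftrightarrow> r = 0 \<and> bl))"

lemma full_simps:
  assumes "half_ok bl (f, d, ln)"
  shows "fst (full c bl (f, d, ln)) (True, ln r) = (False, c + r)"
    "f z \<noteq> z \<Longrightarrow> fst (full c bl (f, d, ln)) (True, z) = (True, f z)"
    "z < c \<Longrightarrow> fst (full c bl (f, d, ln)) (False, z) = (False, cup_partner z)"
    "fst (full c bl (f, d, ln)) (False, c + r) = (True, ln r)"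
    "snd (full c bl (f, d, ln)) (True, z) = d z"
    "snd (full c bl (f, d, ln)) (False, z) = (z = c \<and> bl)"
proof -
  have inj: "inj ln" using assms by (auto simp: half_ok_def strict_mono_imp_increasing intro: strict_mono_imp_inj_on)
  have "f (ln r) = ln r" using assms by (auto simp: half_ok_def)
  moreover have "(THE r'. ln r' = ln r) = r" using inj by (auto simp: inj_eq)
  ultimately show "fst (full c bl (f, d, ln)) (True, ln r) = (False, c + r)"
    by (simp add: full_def)
qed (auto simp: full_def)

lemma full_snd [simp]:
  "snd (full c bl h) (False, z) \<longleftrightarrow> z = c \<and> bl" "snd (full c bl (f, d, ln)) (True, z) = d z"
  by (simp_all add: full_def)

lemma point_cases:
  assumes "half_ok bl (f, d, ln)"
  obtains r where "z = (True, ln r)" | t where "z = (True, t)" "f t \<noteq> t"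
  | t where "z = (False, t)" "t < c" | r where "z = (False, c + r)"
proof (cases z)
  case (Pair b t)
  show ?thesis
  proof (cases b)
    case True
    then show ?thesis using that(1,2) assms Pair by (cases "f t = t") (auto simp: half_ok_def)
  next
    case False
    then show ?thesis using that(3)[of t] that(4)[of "t - c"] Pair by (cases "t < c") auto
  qed
qed

lemma cup_partner: "even c \<Longrightarrow> z < c \<Longrightarrow> cup_partner z < c" "cup_partner (cup_partner z) = z" "cup_partner z \<noteq> z"
  by (auto simp: cup_partner_def) (presburger+)?

lemma perfect_full:
  assumes "half_ok bl (f, d, ln)" "even c"
  shows "perfect (full c bl (f, d, ln))"
  unfolding perfect_def
proof
  fix z
  note h = assms(1)[unfolded half_ok_def prod.case]
  show "fst (full c bl (f, d, ln)) (fst (full c bl (f, d, ln)) z) = z \<and>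
    fst (full c bl (f, d, ln)) z \<noteq> z \<and>
    snd (full c bl (f, d, ln)) (fst (full c bl (f, d, ln)) z) = snd (full c bl (f, d, ln)) z"
  proof (rule point_cases[OF assms(1), where z = z and c = c])
    fix t assume t: "z = (True, t)" "f t \<noteq> t"
    then have "f (f t) \<noteq> f t" "f (f t) = t" using h by metis+
    then have "fst (full c bl (f, d, ln)) (True, f t) = (True, t)"
      using full_simps(2)[OF assms(1), of "f t"] by simp
    then show ?thesis using t h full_simps(2)[OF assms(1) t(2)] by (simp add: full_simps(5)[OF assms(1)])
  qed (use h cup_partner(1)[OF assms(2)] cup_partner(2,3) in \<open>auto simp: full_simps[OF assms(1)]\<close>)
qed

context blob_params
begin

lemma gen_act_swap: "gen_act (\<not> b) g (c, swap s) = apsnd swap (gen_act b g (c, s))"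
proof -
  have e: "apfst Not a = (\<not> b', k) \<longleftrightarrow> a = (b', k)" for a :: "bool \<times> nat" and b' k
    by (cases a) auto
  have "blob_coef (\<not> b, k) (swap s) = blob_coef (b, k) s" for k
    by (simp add: blob_coef_def swap_def)
  moreover have "join_coef (\<not> b, k) (\<not> b, l) (swap s) = join_coef (b, k) (b, l) s" for k l
    by (simp add: join_coef_def swap_def e)
  ultimately show ?thesis by (cases g) (auto simp: swap_join swap_blob)
qed

lemma word_act_swap: "word_act (\<not> b) w (c, swap s) = apsnd swap (word_act b w (c, s))"
proof (induction w)
  case (Cons g w)
  then show ?case
    using gen_act_swap[of b g "fst (word_act b w (c, s))" "snd (word_act b w (c, s))"]
    by (cases "word_act b w (c, s)") auto
qed simp

text \<open>Loops and merging blobs are decided by partners and blobs at points of the row acted on.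
  Hence even the scalar is the same for the diagram and for its half.\<close>

lemma gen_act_view: "gen_act b g (c, view b s) = apsnd (view b) (gen_act b g (c, s))"
proof -
  have "join_coef (b, k) (b, l) (view b s) = join_coef (b, k) (b, l) s" if "k \<noteq> l" for k l
    using that by (auto simp: join_coef_def view_def)
  moreover have "blob_coef (b, k) (view b s) = blob_coef (b, k) s" for k
    by (simp add: blob_coef_def view_def)
  ultimately show ?thesis
    by (cases g) (simp_all add: view_join view_blob)
qed

lemma word_act_view: "word_act b w (c, view b s) = apsnd (view b) (word_act b w (c, s))"
proof (induction w)
  case (Cons g w)
  then show ?case
    using gen_act_view[of b g "fst (word_act b w (c, s))" "snd (word_act b w (c, s))"]
    by (cases "word_act b w (c, s)") auto
qed simp

text \<open>Multiplying by \<open>U_i \<dots> U_1\<close> slides a cup at \<open>i, i + 1\<close> to the far left.\<close>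

lemma rotate:
  assumes "perfect s" "fst s (b, i) = (b, Suc i)" "\<not> snd s (b, i)"
  shows "\<exists>s'. word_act b (rev (dn i 1)) (c, s) = (c, s') \<and>
    (\<forall>z. fst s' (rot b i z) = rot b i (fst s z) \<and> snd s' (rot b i z) = snd s z)"
  using assms
proof (induction i arbitrary: s)
  case 0
  have "rot b 0 z = z" for z by (cases z) (auto simp: rot_def)
  then show ?case by simp
next
  case (Suc i)
  let ?x = "(b, i)" and ?y = "(b, Suc i)" and ?z = "(b, Suc (Suc i))"
  let ?k = "\<lambda>t. if t = ?x then ?z else if t = ?z then ?y else if t = ?y then ?x else t"
  let ?s = "join ?x ?y s"
  have d: "distinct [?x, ?y, ?z]" by auto
  note cyc = join_cycle[OF Suc.prems d]
  have "fst s ?x \<noteq> ?y"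
    using perfectD(1)[OF Suc.prems(1), of ?x] Suc.prems(2) by auto
  then have coef: "join_coef ?x ?y s = 1"
    using Suc.prems by (simp add: join_coef_def)
  have "perfect ?s" "fst ?s ?x = ?y" "\<not> snd ?s ?x"
    using perfect_join[OF Suc.prems(1)] by (auto simp: join_def)
  from Suc.IH[OF this] obtain s' where s': "word_act b (rev (dn i 1)) (c, ?s) = (c, s')"
    "\<And>z. fst s' (rot b i z) = rot b i (fst ?s z) \<and> snd s' (rot b i z) = snd ?s z"
    by blast
  have r: "rot b (Suc i) z = rot b i (?k z)" for z
    by (cases z) (auto simp: rot_def)
  have "word_act b (rev (dn (Suc i) 1)) (c, s) = (c, s')"
    using s'(1) coef by (simp add: dn_Cons)
  moreover have "fst s' (rot b (Suc i) z) = rot b (Suc i) (fst s z)" "snd s' (rot b (Suc i) z) = snd s z" for z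
    using s'(2)[of "?k z"] cyc[of z] unfolding r by simp_all
  ultimately show ?case by blast
qed

text \<open>The first letter to act, U_(c+l), joins the lower ends of the through lines l - 1 and l,
  so their upper ends become partners and an arc appears below. The remaining letters slide this arc
  to the left, which restores the normal form with c + 2 cup points. For l = 1 the line that could
  carry a blob is closed.\<close>

lemma full_close:
  assumes h: "half_ok bl (f, d, ln)" "even c" and l: "l \<ge> 1"
  defines "h' \<equiv> (f(ln (l - 1) := ln l, ln l := ln (l - 1)), d(ln l := d (ln (l - 1))),
      \<lambda>r. if r < l - 1 then ln r else ln (r + 2))"
  shows "half_ok (bl \<and> l \<ge> 2) h'"
    "word_act False (rev (dn (c + l) 1)) (a, full c bl (f, d, ln)) = (a, full (c + 2) (bl \<and> l \<ge> 2) h')"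
proof -
  let ?s = "full c bl (f, d, ln)"
  obtain i where li: "l = Suc i" using l by (cases l) auto
  note ok = h(1)[unfolded half_ok_def prod.case]
  have mono: "strict_mono ln" using ok by simp
  have inj: "ln r = ln r' \<longleftrightarrow> r = r'" for r r'
    using mono by (simp add: strict_mono_eq)
  define f' d' ln' where "f' = f(ln i := ln (Suc i), ln (Suc i) := ln i)"
    "d' = d(ln (Suc i) := d (ln i))" "ln' = (\<lambda>r. if r < i then ln r else ln (r + 2))"
  have h': "h' = (f', d', ln')"
    by (simp add: h'_def f'_d'_ln'_def li)
  have fln: "f (ln r) = ln r" for r using ok by blast
  have fne: "f z = ln r \<longleftrightarrow> z = ln r" for z r using ok fln by metis
  have rng: "z \<in> range ln' \<longleftrightarrow> z \<in> range ln \<and> z \<noteq> ln i \<and> z \<noteq> ln (Suc i)" for z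
  proof
    assume "z \<in> range ln'"
    then show "z \<in> range ln \<and> z \<noteq> ln i \<and> z \<noteq> ln (Suc i)"
      by (auto simp: f'_d'_ln'_def inj)
  next
    assume z: "z \<in> range ln \<and> z \<noteq> ln i \<and> z \<noteq> ln (Suc i)"
    then obtain r where r: "z = ln r" by blast
    with z have "r \<noteq> i" "r \<noteq> Suc i" by auto
    then have "r < i \<or> i \<le> r - 2 \<and> r - 2 + 2 = r" by linarith
    then have "z = ln' (if r < i then r else r - 2)"
      using r by (auto simp: f'_d'_ln'_def)
    then show "z \<in> range ln'" by blast
  qed
  have "strict_mono ln'"
    unfolding strict_mono_def f'_d'_ln'_def using strict_monoD[OF mono] by auto
  moreover have "f' (f' z) = z" for z
    using ok fne by (simp add: f'_d'_ln'_def inj)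
  moreover have "f' z = z \<longleftrightarrow> z \<in> range ln'" for z
    unfolding rng using ok by (auto simp: f'_d'_ln'_def inj)
  moreover have "d' (f' z) = d' z" for z
    using ok fne by (simp add: f'_d'_ln'_def inj)
  moreover have "d' (ln' r) \<longleftrightarrow> r = 0 \<and> bl \<and> i \<ge> 1" for r
    using ok by (auto simp: f'_d'_ln'_def inj)
  ultimately show ok': "half_ok (bl \<and> l \<ge> 2) h'"
    by (simp add: half_ok_def h' li)
  note S = full_simps[OF h(1)] and S' = full_simps[OF ok'[unfolded h']]
  have ps: "perfect ?s" using perfect_full[OF h] .
  let ?x = "(False, c + i)" and ?y = "(False, c + Suc i)"
  let ?t = "join ?x ?y ?s"
  have Sy: "fst ?s ?y = (True, ln (Suc i))" using S(4)[of c "Suc i"] by simp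
  have coef: "join_coef ?x ?y ?s = 1"
    using S(4)[of c i] by (simp add: join_coef_def S(6))
  have t: "perfect ?t" "fst ?t ?x = (False, Suc (c + i))" "\<not> snd ?t ?x"
    using perfect_join[OF ps] by (auto simp: join_def)
  from rotate[OF t, of a] obtain s' where s': "word_act False (rev (dn (c + i) 1)) (a, ?t) = (a, s')"
    "\<And>z. fst s' (rot False (c + i) z) = rot False (c + i) (fst ?t z)"
    "\<And>z. snd s' (rot False (c + i) z) = snd ?t z"
    by blast
  let ?F = "full (c + 2) (bl \<and> l \<ge> 2) (f', d', ln')"
  note J = join_other[OF ps, of _ ?x ?y]
  have ln'_lo: "r < i \<Longrightarrow> ln' r = ln r" and ln'_hi: "i \<le> r \<Longrightarrow> ln' r = ln (r + 2)" for r
    by (auto simp: f'_d'_ln'_def)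
  \<comment> \<open>The result of sliding is known only at points of the form \<open>rot z\<close>;
    since \<open>rot\<close> is onto, comparing there is enough.\<close>
  have key: "fst ?F (rot False (c + i) z) = rot False (c + i) (fst ?t z) \<and>
      snd ?F (rot False (c + i) z) = snd ?t z" for z
  proof (cases "z = ?x \<or> z = ?y")
    case True
    have "fst ?t ?x = ?y" "fst ?t ?y = ?x" "\<not> snd ?t ?x" "\<not> snd ?t ?y"
      by (simp_all add: join_def)
    moreover have "rot False (c + i) ?x = (False, 0)" "rot False (c + i) ?y = (False, 1)"
      by (simp_all add: rot_def)
    moreover have "fst ?F (False, 0) = (False, 1)" "fst ?F (False, 1) = (False, 0)"
      "\<not> snd ?F (False, 0)" "\<not> snd ?F (False, 1)"
      by (simp_all add: full_def cup_partner_def)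
    ultimately show ?thesis using True by metis
  next
    case z: False
    then have zx: "z \<noteq> ?x" "z \<noteq> ?y" by auto
    show ?thesis
    proof (rule point_cases[OF h(1), where z = z and c = c])
      fix r assume zr: "z = (True, ln r)"
      consider "r = i" | "r = Suc i" | "r < i" | "r \<ge> i + 2" by linarith
      then show ?thesis
      proof cases
        case 1
        then have "f' (ln r) \<noteq> ln r" "f' (ln r) = ln (Suc i)" by (auto simp: f'_d'_ln'_def inj)
        then show ?thesis
          using 1 zr J[OF zx] Sy by (simp add: S S' rot_def) (simp add: f'_d'_ln'_def inj ok)
      next
        case 2
        then have "f' (ln r) \<noteq> ln r" "f' (ln r) = ln i" by (auto simp: f'_d'_ln'_def inj)
        then show ?thesis
          using 2 zr J[OF zx] Sy S(1)[of c "Suc i"] by (simp add: S S' rot_def) (simp add: f'_d'_ln'_def inj ok)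
      next
        case 3
        then have "d' (ln r) = d (ln r)" by (simp add: f'_d'_ln'_def inj)
        then show ?thesis
          using 3 zr J[OF zx] S'(1)[of "c + 2" r] by (simp add: S S' rot_def ln'_lo)
      next
        case 4
        then have "d' (ln r) = d (ln r)" by (simp add: f'_d'_ln'_def inj)
        moreover have "r - 2 + 2 = r" using 4 by simp
        then have "ln' (r - 2) = ln r" using 4 ln'_hi[of "r - 2"] by simp
        ultimately show ?thesis
          using 4 zr J[OF zx] S'(1)[of "c + 2" "r - 2"] by (simp add: S S' rot_def)
      qed
    next
      fix t assume zt: "z = (True, t)" "f t \<noteq> t"
      then have n: "t \<noteq> ln i" "t \<noteq> ln (Suc i)" using fln by auto
      then have "f' t = f t" "d' t = d t" by (simp_all add: f'_d'_ln'_def)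
      then show ?thesis
        using zt J[OF zx] n by (simp add: S S' rot_def)
    next
      fix t assume zt: "z = (False, t)" "t < c"
      have cp: "cup_partner t < c" "cup_partner (t + 2) = cup_partner t + 2"
        using cup_partner(1)[OF h(2) zt(2)] by (auto simp: cup_partner_def elim!: oddE)
      then show ?thesis
        using zt J[OF zx] by (simp add: S S' rot_def)
    next
      fix r assume zr: "z = (False, c + r)"
      with z have "r \<noteq> i" "r \<noteq> Suc i" by auto
      then consider "r < i" | "r \<ge> i + 2" by linarith
      then show ?thesis
      proof cases
        case 1
        then show ?thesis
          using zr J[OF zx] S'(4)[of "c + 2" r] by (auto simp: S S' rot_def ln'_lo inj li)
      next
        case 2
        then have "r = (r - 2) + 2" "i \<le> r - 2" by simp_all
        then obtain r' where r': "r = r' + 2" "i \<le> r'" by blast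
        have "fst ?F (False, c + r) = (True, ln r)"
          using S'(4)[of "c + 2" r'] ln'_hi[OF r'(2)] r'(1) by simp
        moreover have "rot False (c + i) (True, ln r) = (True, ln r)" "rot False (c + i) z = z"
          using r' by (simp_all add: rot_def zr)
        moreover have "fst ?s z = (True, ln r)" "\<not> snd ?s z"
          using S(4)[of c r] r' by (simp_all add: zr)
        then have "fst ?t z = (True, ln r)" "\<not> snd ?t z"
          using J[OF zx] by simp_all
        moreover have "\<not> snd ?F (False, c + r)"
          using r' by (auto simp: li)
        ultimately show ?thesis
          using zr by simp
      qed
    qed
  qed
  have "s' = ?F"
  proof (rule prod_eqI; rule ext)
    fix z
    obtain w where w: "z = rot False (c + i) w" using rot_surj by metis
    show "fst s' z = fst ?F z" unfolding w s'(2) using key by simp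
    show "snd s' z = snd ?F z" unfolding w s'(3) using key by simp
  qed
  then show "word_act False (rev (dn (c + l) 1)) (a, full c bl (f, d, ln)) = (a, full (c + 2) (bl \<and> l \<ge> 2) h')"
    using s'(1) coef by (simp add: dn_Cons li h')
qed

text \<open>The blobbed arc x-y is first merged into the strand at z, and then a fresh plain arc is
  cut off at x, y. No loop is closed and no two blobs meet, so both coefficients are 1.\<close>

lemma join_slide_blob:
  assumes s: "perfect s" and d: "distinct [x, y, z]" and xy: "fst s x = y" "\<not> snd s x" and z: "\<not> snd s z"
  shows "join x y (join y z (blob x s)) = blob z s"
    "join_coef x y (join y z (blob x s)) = 1" "join_coef y z (blob x s) = 1"
proof -
  note p = perfectD[OF s]
  have n: "x \<noteq> y" "x \<noteq> z" "y \<noteq> z" using d by auto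
  have yx: "fst s y = x" "\<not> snd s y" using p(1,4) xy by metis+
  have fz: "fst s z \<noteq> x" "fst s z \<noteq> y" "fst s z \<noteq> z" "\<not> snd s (fst s z)"
    using p n xy yx z by metis+
  let ?b = "blob x s"
  have b: "fst ?b = fst s" "snd ?b x" "snd ?b y" "\<not> snd ?b z"
    using xy z n by (auto simp: blob_def)
  have pb: "perfect ?b" using perfect_blob[OF s] .
  show c1: "join_coef y z ?b = 1"
    using b yx n by (simp add: join_coef_def)
  note J = join_other[OF pb, of _ y z]
  let ?j = "join y z ?b"
  have jx: "fst ?j x = fst s z" "snd ?j x"
    using J[of x] n b xy by auto
  have jy: "fst ?j y = z" "\<not> snd ?j y" by (simp_all add: join_def)
  have pj: "perfect ?j" using perfect_join[OF pb n(3)] .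
  show "join_coef x y ?j = 1"
    using jx jy fz by (simp add: join_coef_def)
  note J2 = join_other[OF pj, of _ x y]
  show "join x y ?j = blob z s"
  proof (rule prod_eqI; rule ext)
    fix t
    have jz: "fst ?j z = y" using perfectD(1)[OF pj] jy by metis
    consider "t = x" | "t = y" | "t = z" | "t = fst s z" "t \<noteq> x" "t \<noteq> y" "t \<noteq> z"
      | "t \<noteq> x" "t \<noteq> y" "t \<noteq> z" "t \<noteq> fst s z" by blast
    then have "fst (join x y ?j) t = fst (blob z s) t \<and> snd (join x y ?j) t = snd (blob z s) t"
    proof cases
      case 1 then show ?thesis using xy n fz by (auto simp: join_def blob_def)
    next
      case 2 then show ?thesis using yx n fz by (auto simp: join_def blob_def)
    next
      case 3 then show ?thesis using J2[of z] n jz jx jy by (simp add: blob_def)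
    next
      case 4
      then have "fst s t = z" using p(1) by metis
      then have "fst ?j t = x" using J[of t] 4 n b yx by (simp add: xy)
      then show ?thesis using J2[of t] 4 n jx jy \<open>fst s t = z\<close> by (simp add: blob_def)
    next
      case 5
      then have t: "fst s t \<noteq> x" "fst s t \<noteq> y" "fst s t \<noteq> z" using p(1) xy yx by metis+
      then have "fst ?j t = fst s t" "snd ?j t = snd s t"
        using J[of t] 5 b xy by (auto simp: blob_def)
      then show ?thesis using J2[of t] 5 t by (simp add: blob_def)
    qed
    then show "fst (join x y ?j) t = fst (blob z s) t" "snd (join x y ?j) t = snd (blob z s) t"
      by auto
  qed
qed

text \<open>The crossing word read backwards, as it acts from below: e puts a blob at position 0,
  and the other letters carry it across k cups to the first through line.\<close>

definition slide_word :: "nat \<Rightarrow> gen list" where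
  "slide_word k = cups k @ evens k @ [Gen_e]"

lemma diagram_eqv_slide:
  "diagram_eqv b 1 (cups (Suc k) @ evens (Suc k)) ([U (2 * k + 1), U (2 * k + 2)] @ cups k @ evens k)"
proof -
  interpret blob_rewriting "2 * k + 3" "diagram_eqv b" q2 \<gamma> \<delta> by (rule blob_rewriting_diagram)
  have "cups (Suc k) @ evens (Suc k) = cups k @ [U (2 * k + 1)] @ evens k @ [U (2 * k + 2)]"
    by (simp add: cups_Suc evens_Suc)
  also have "diagram_eqv b 1 \<dots> ([U (2 * k + 1)] @ cups k @ evens k @ [U (2 * k + 2)])"
    using eqv_post[OF word_comm[of "cups k" "[U (2 * k + 1)]"], of "evens k @ [U (2 * k + 2)]"] by fastforce
  also have "diagram_eqv b 1 \<dots> ([U (2 * k + 1)] @ [U (2 * k + 2)] @ cups k @ evens k)"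
    using eqv_pre[OF word_comm[of "cups k @ evens k" "[U (2 * k + 2)]"], of "[U (2 * k + 1)]"] by fastforce
  finally show ?thesis by simp
qed

lemma slide:
  assumes s: "perfect s" and cup: "\<And>j. j < k \<Longrightarrow> fst s (b, 2 * j) = (b, 2 * j + 1)" and nd: "\<And>j. j \<le> 2 * k \<Longrightarrow> \<not> snd s (b, j)"
  shows "word_act b (slide_word k) (a, s) = (a, blob (b, 2 * k) s)"
proof -
  have "word_act b (cups k @ evens k) (a, blob (b, 0) s) = (a, blob (b, 2 * k) s)"
    using cup nd
  proof (induction k)
    case (Suc k)
    let ?x = "(b, 2 * k)" and ?y = "(b, 2 * k + 1)" and ?z = "(b, 2 * k + 2)"
    have d: "distinct [?x, ?y, ?z]" by auto
    have "word_act b (cups (Suc k) @ evens (Suc k)) (a, blob (b, 0) s) =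
        word_act b [U (2 * k + 1), U (2 * k + 2)] (word_act b (cups k @ evens k) (a, blob (b, 0) s))"
      using diagram_eqv_slide[of b k, unfolded diagram_eqv_def, rule_format, of "(a, blob (b, 0) s)"] perfect_blob[OF s]
      by simp
    also have "word_act b (cups k @ evens k) (a, blob (b, 0) s) = (a, blob ?x s)"
      using Suc by auto
    also have "word_act b [U (2 * k + 1), U (2 * k + 2)] \<dots> = (a, blob ?z s)"
      using join_slide_blob[OF s d, OF Suc.prems(1)[of k] Suc.prems(2) Suc.prems(2)] by simp
    finally show ?case by simp
  qed simp
  moreover have "blob_coef (b, 0) s = 1" using nd[of 0] by (simp add: blob_coef_def)
  ultimately show ?thesis by (simp add: slide_word_def)
qed

lemma full_cross:
  assumes h: "half_ok False (f, d, ln)"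
  shows "half_ok True (f, d(ln 0 := True), ln)"
    "word_act False (rev (edge_word (2 * k) 0 1)) (a, full (2 * k) False (f, d, ln))
      = (a, full (2 * k) True (f, d(ln 0 := True), ln))"
proof -
  note ok = h[unfolded half_ok_def prod.case]
  have inj: "ln r = ln r' \<longleftrightarrow> r = r'" for r r'
    using ok by (simp add: strict_mono_eq)
  have f0: "f (ln 0) = ln 0" "f z = ln 0 \<longleftrightarrow> z = ln 0" for z using ok by (metis rangeI)+
  show ok': "half_ok True (f, d(ln 0 := True), ln)"
    using ok by (auto simp: half_ok_def inj f0)
  note S = full_simps[OF h, where c = "2 * k"]
  let ?s = "full (2 * k) False (f, d, ln)"
  have ps: "perfect ?s" using perfect_full[OF h] by simp
  have "word_act False (slide_word k) (a, ?s) = (a, blob (False, 2 * k) ?s)"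
    by (rule slide[OF ps]) (simp_all add: S cup_partner_def)
  moreover have "rev (edge_word (2 * k) 0 1) = slide_word k"
    by (simp add: edge_cross slide_word_def)
  moreover have "blob (False, 2 * k) ?s = full (2 * k) True (f, d(ln 0 := True), ln)"
  proof (rule prod_eqI; rule ext)
    fix z
    have "fst ?s (False, 2 * k) = (True, ln 0)" using S(4)[of 0] by simp
    then show "snd (blob (False, 2 * k) ?s) z = snd (full (2 * k) True (f, d(ln 0 := True), ln)) z"
      by (cases z) (auto simp: blob_def full_def)
    show "fst (blob (False, 2 * k) ?s) z = fst (full (2 * k) True (f, d(ln 0 := True), ln)) z"
      by (cases z) (simp add: blob_def full_def)
  qed
  ultimately show "word_act False (rev (edge_word (2 * k) 0 1)) (a, ?s)
      = (a, full (2 * k) True (f, d(ln 0 := True), ln))" by simp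
qed

end

text \<open>With c lines open, \<open>ln c\<close> is the first point not yet reached, hence the new
  point k itself. An opening step therefore leaves the triple unchanged, and a closing step pairs
  \<open>ln (c - 1)\<close> with this new point.\<close>

primrec half :: "int list \<Rightarrow> nat \<Rightarrow> half" where
  "half p 0 = (id, \<lambda>_. False, id)"
| "half p (Suc k) = (case half p k of (f, d, ln) \<Rightarrow>
    let l = p ! k; l' = p ! Suc k; c = nat \<bar>l\<bar> in
      if \<bar>l'\<bar> < \<bar>l\<bar> then
        (f(ln (c - 1) := ln c, ln c := ln (c - 1)), d(ln c := d (ln (c - 1))),
          \<lambda>r. if r < c - 1 then ln r else ln (r + 2))
      else if l = 0 \<and> l' = 1 then (f, d(ln 0 := True), ln)
      else (f, d, ln))"

lemma half_append: "k < length q \<Longrightarrow> half (q @ r) k = half q k"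
  by (induction k) (auto simp: nth_append Let_def split: prod.splits)

definition vac :: "(bool \<times> nat) state" where
  "vac = (\<lambda>(b, z). (\<not> b, z), \<lambda>_. False)"

lemma perfect_vac: "perfect vac"
  by (auto simp: perfect_def vac_def)

lemma swap_vac [simp]: "swap vac = vac"
  by (auto simp: swap_def vac_def fun_eq_iff)

lemma half_ok_0: "half_ok False (half p 0)"
  by (auto simp: half_ok_def strict_mono_def)

lemma vac_full: "vac = full 0 False (half p 0)"
  by (auto simp: vac_def full_def fun_eq_iff)

context blob_params
begin

lemma gen_act_vac: "gen_act b g (a, vac) = gen_act (\<not> b) g (a, vac)"
proof (cases g)
  case Gen_e
  then show ?thesis by (auto simp: blob_coef_def blob_def vac_def fun_eq_iff)
next
  case (Gen_U i)
  then show ?thesis by (auto simp: join_coef_def join_def vac_def fun_eq_iff)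
qed

text \<open>On the identity diagram a letter may be applied in either row with the same result.
  Since the rows commute, changing the row of a whole word reverses it.\<close>

lemma word_act_vac: "word_act b w (a, vac) = word_act (\<not> b) (rev w) (a, vac)"
proof (induction w)
  case (Cons g w)
  have "word_act b (g # w) (a, vac) = gen_act b g (word_act (\<not> b) (rev w) (a, vac))"
    using Cons by simp
  also have "\<dots> = word_act (\<not> b) (rev w) (gen_act b g (a, vac))"
    using word_act_gen_comm[of "(a, vac)" "\<not> b" b "rev w" g] perfect_vac by simp
  also have "\<dots> = word_act (\<not> b) (rev (g # w)) (a, vac)"
    using gen_act_vac[of b] by simp
  finally show ?case .
qed simp

theorem walk_word_state:
  assumes "p \<in> walks n m"
  shows "half_ok (m > 0) (half p n) \<and>
    word_act True (walk_word p) (1, vac) = (1, full (n - nat \<bar>m\<bar>) (m > 0) (half p n))"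
  using assms
proof (induction n arbitrary: p m)
  case 0
  then have "p = [0]" "m = 0" by (auto split: if_splits)
  then show ?case using half_ok_0 vac_full[of p] by simp
next
  case (Suc n)
  then obtain q l where q: "q \<in> walks n l" "p = q @ [m]" "m = l + 1 \<or> m = l - 1"
    by (auto simp: walks_Suc_iff)
  have len: "length q = Suc n" "q ! n = l" using q(1) by (auto simp: walks_def)
  obtain f d ln where fd: "half q n = (f, d, ln)" by (cases "half q n") auto
  have ok: "half_ok (l > 0) (f, d, ln)"
    and st: "word_act True (walk_word q) (1, vac) = (1, full (n - nat \<bar>l\<bar>) (l > 0) (f, d, ln))"
    using Suc.IH[OF q(1)] fd by auto
  have hp: "half p n = (f, d, ln)" "p ! n = l" "p ! Suc n = m"
    using half_append[of n q "[m]"] fd len q(2) by (auto simp: nth_append)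
  obtain c where c: "n = nat \<bar>l\<bar> + 2 * c"
    using walks_weights[OF q(1)] by (rule weightsE)
  \<comment> \<open>The last edge word acts first in the top row. Moved to the bottom row of the
    identity it can be commuted past the shorter walk and then acts on a known diagram.\<close>
  have "word_act True (walk_word p) (1, vac) = word_act True (walk_word q) (word_act False (rev (edge_word n l m)) (1, vac))"
    using word_act_vac[of True "edge_word n l m" 1] by (simp add: q(2) walk_word_snoc[OF q(1)])
  also have "\<dots> = word_act False (rev (edge_word n l m)) (1, full (2 * c) (l > 0) (f, d, ln))"
    using word_act_comm[of "(1, vac)" True False] perfect_vac st c by simp
  finally have w: "word_act True (walk_word p) (1, vac) = \<dots>" .
  from q(3) show ?case
  proof (cases rule: step_cases)
    case open_step
    then have "half p (Suc n) = (f, d, ln)" "(m > 0) = (l > 0)"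
      "Suc n - nat \<bar>m\<bar> = 2 * c"
      using hp c by auto
    then show ?thesis using w ok open_step by (simp add: edge_open)
  next
    case cross_step
    then have "half p (Suc n) = (f, d(ln 0 := True), ln)" using hp by simp
    then show ?thesis using w full_cross[of f d ln] ok cross_step c by simp
  next
    case close_step
    then have l: "nat \<bar>l\<bar> \<ge> 1" by auto
    have b: "(l > 0 \<and> nat \<bar>l\<bar> \<ge> 2) = (m > 0)" "Suc n - nat \<bar>m\<bar> = 2 * c + 2" "2 * c + nat \<bar>l\<bar> = n"
      using close_step q(3) c by auto
    have "half p (Suc n) = (f(ln (nat \<bar>l\<bar> - 1) := ln (nat \<bar>l\<bar>), ln (nat \<bar>l\<bar>) := ln (nat \<bar>l\<bar> - 1)),
        d(ln (nat \<bar>l\<bar>) := d (ln (nat \<bar>l\<bar> - 1))), \<lambda>r. if r < nat \<bar>l\<bar> - 1 then ln r else ln (r + 2))"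
      using hp close_step by (simp add: Let_def)
    then show ?thesis
      using full_close[OF ok _ l, where c = "2 * c", unfolded b(1,3)] w edge_close[OF close_step, of n] b(2)
      by (simp del: half.simps)
  qed
qed

end

text \<open>A walk is read off from its arcs and blobs: step k closes a line exactly if k is the
  right end of an arc, and at weight 0 the blob at k tells a step to 1 from a step to -1. The
  invariant on \<open>ln\<close> identifies the next new point.\<close>

lemma half_decode:
  assumes "p \<in> walks n m" "half p n = (f, d, ln)"
  shows "strict_mono ln \<and> (\<forall>r. ln (nat \<bar>m\<bar> + r) = n + r) \<and> (\<forall>z\<ge>n. f z = z) \<and> (\<forall>z\<ge>n. \<not> d z) \<and> (\<forall>r. f (ln r) = ln r) \<and>
    (\<forall>k<n. (\<bar>p ! Suc k\<bar> < \<bar>p ! k\<bar> \<longleftrightarrow> f k < k) \<and> (p ! k = 0 \<longrightarrow> (d k \<longleftrightarrow> p ! Suc k = 1)))"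
  using assms
proof (induction n arbitrary: p m f d ln)
  case 0
  then show ?case by (auto simp: strict_mono_def walks_def)
next
  case (Suc n)
  then obtain q l where q: "q \<in> walks n l" "p = q @ [m]" "m = l + 1 \<or> m = l - 1"
    by (auto simp: walks_Suc_iff)
  have len: "length q = Suc n" "q ! n = l" using q(1) by (auto simp: walks_def)
  obtain f0 d0 ln0 where fd: "half q n = (f0, d0, ln0)" by (cases "half q n") auto
  have nth: "p ! Suc k = q ! Suc k" "p ! k = q ! k" if "k < n" for k
    using that len q(2) by (auto simp: nth_append)
  note IH = Suc.IH[OF q(1) fd]
  then have mono: "strict_mono ln0" and lnn: "\<And>r. ln0 (nat \<bar>l\<bar> + r) = n + r" and fixd: "\<And>z. z \<ge> n \<Longrightarrow> f0 z = z"
    and nod: "\<And>z. z \<ge> n \<Longrightarrow> \<not> d0 z" and fln: "\<And>r. f0 (ln0 r) = ln0 r"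
    and dec: "\<And>k. k < n \<Longrightarrow> (\<bar>q ! Suc k\<bar> < \<bar>q ! k\<bar> \<longleftrightarrow> f0 k < k) \<and> (q ! k = 0 \<longrightarrow> (d0 k \<longleftrightarrow> q ! Suc k = 1))"
    by blast+
  have ln_n: "ln0 (nat \<bar>l\<bar>) = n" using lnn[of 0] by simp
  have hp: "half p n = (f0, d0, ln0)" "p ! n = l" "p ! Suc n = m"
    using half_append[of n q "[m]"] fd len q(2) by (auto simp: nth_append)
  from q(3) show ?case
  proof (cases rule: step_cases)
    case open_step
    then have e: "f = f0" "d = d0" "ln = ln0" using Suc.prems(2) hp by auto
    have "nat \<bar>m\<bar> = Suc (nat \<bar>l\<bar>)" using open_step by auto
    then have "ln (nat \<bar>m\<bar> + r) = Suc n + r" for r using lnn[of "Suc r"] e by simp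
    then show ?thesis
      using mono fixd nod fln dec nth hp e open_step by (auto simp: less_Suc_eq)
  next
    case cross_step
    then have e: "f = f0" "d = d0(n := True)" "ln = ln0" using Suc.prems(2) hp ln_n by auto
    have "ln (nat \<bar>m\<bar> + r) = Suc n + r" for r using lnn[of "Suc r"] e cross_step by simp
    then show ?thesis
      using mono fixd nod fln dec nth hp e cross_step by (auto simp: less_Suc_eq)
  next
    case close_step
    then obtain i where i: "nat \<bar>l\<bar> = Suc i" by (cases "nat \<bar>l\<bar>") auto
    have e: "f = f0(ln0 i := n, n := ln0 i)" "d = d0(n := d0 (ln0 i))"
      "ln = (\<lambda>r. if r < i then ln0 r else ln0 (r + 2))"
      using Suc.prems(2) hp close_step i ln_n by (auto simp: Let_def)
    have lt: "ln0 i < n" using strict_monoD[OF mono, of i "Suc i"] ln_n i by simp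
    have m: "nat \<bar>m\<bar> = i" using close_step i by linarith
    have "strict_mono ln"
      unfolding strict_mono_def e using strict_monoD[OF mono] by auto
    moreover have "ln (nat \<bar>m\<bar> + r) = Suc n + r" for r
      using lnn[of "Suc r"] i by (simp add: m e)
    moreover have "f z = z" "\<not> d z" if "z \<ge> Suc n" for z
      using that fixd nod lt by (auto simp: e)
    moreover have "f (ln r) = ln r" for r
    proof -
      have "ln0 (if r < i then r else r + 2) \<noteq> ln0 i" "ln0 (if r < i then r else r + 2) \<noteq> ln0 (Suc i)"
        using strict_mono_eq[OF mono] by auto
      then show ?thesis using fln ln_n i by (simp add: e split: if_splits)
    qed
    moreover have "(\<bar>p ! Suc k\<bar> < \<bar>p ! k\<bar> \<longleftrightarrow> f k < k) \<and> (p ! k = 0 \<longrightarrow> (d k \<longleftrightarrow> p ! Suc k = 1))"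
      if "k < Suc n" for k
    proof (cases "k = n")
      case True
      then show ?thesis using hp lt close_step by (auto simp: e)
    next
      case False
      then have "k < n" using that by simp
      then show ?thesis
        using dec[of k] nth[of k] fln[of i] by (auto simp: e)
    qed
    ultimately show ?thesis by blast
  qed
qed

text \<open>Starting at 0, arcs and blobs determine each next vertex. The end weights may differ in
  the hypotheses, so products of different weights are separated as well.\<close>

lemma half_inj:
  assumes "p \<in> walks n m" "q \<in> walks n m'" "fst (half p n) = fst (half q n)" "fst (snd (half p n)) = fst (snd (half q n))"
  shows "p = q"
proof -
  obtain f d ln ln' where h: "half p n = (f, d, ln)" "half q n = (f, d, ln')"
    using assms(3,4) by (cases "half p n"; cases "half q n") auto
  have dp: "\<bar>p ! Suc k\<bar> < \<bar>p ! k\<bar> \<longleftrightarrow> f k < k" "p ! k = 0 \<Longrightarrow> d k \<longleftrightarrow> p ! Suc k = 1" if "k < n" for k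
    using half_decode[OF assms(1) h(1)] that by blast+
  have dq: "\<bar>q ! Suc k\<bar> < \<bar>q ! k\<bar> \<longleftrightarrow> f k < k" "q ! k = 0 \<Longrightarrow> d k \<longleftrightarrow> q ! Suc k = 1" if "k < n" for k
    using half_decode[OF assms(2) h(2)] that by blast+
  have lp: "length p = Suc n" "p ! 0 = 0" "\<And>k. k < n \<Longrightarrow> p ! Suc k = p ! k + 1 \<or> p ! Suc k = p ! k - 1"
    and lq: "length q = Suc n" "q ! 0 = 0" "\<And>k. k < n \<Longrightarrow> q ! Suc k = q ! k + 1 \<or> q ! Suc k = q ! k - 1"
    using assms(1,2) by (auto simp: walks_def)
  have "p ! k = q ! k" if "k \<le> n" for k
    using that
  proof (induction k)
    case (Suc k)
    then have e: "p ! k = q ! k" "k < n" by auto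
    show ?case
    proof (cases "p ! k = 0")
      case True
      then show ?thesis using dp(2)[OF e(2)] dq(2)[OF e(2)] lp(3)[OF e(2)] lq(3)[OF e(2)] e(1) by auto
    next
      case False
      have "\<bar>p ! Suc k\<bar> < \<bar>p ! k\<bar> \<longleftrightarrow> \<bar>q ! Suc k\<bar> < \<bar>p ! k\<bar>"
        using dp(1)[OF e(2)] dq(1)[OF e(2)] e(1) by simp
      then show ?thesis
        using False lp(3)[OF e(2)] lq(3)[OF e(2)] e(1) by auto
    qed
  qed (simp add: lp lq)
  then show ?thesis using lp(1) lq(1) by (intro nth_equalityI) auto
qed

lemma view_full:
  assumes "half_ok bl (f, d, ln)"
  shows "view True (full c bl (f, d, ln)) = (\<lambda>(b, z). if b then (True, f z) else (False, z), \<lambda>(b, z). b \<and> d z)"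
    "view False (full c bl (f, d, ln)) = (\<lambda>(b, z). if b then (True, z) else if z < c then (False, cup_partner z) else (False, z),
      \<lambda>(b, z). \<not> b \<and> z = c \<and> bl)"
  by (auto simp: view_def full_def fun_eq_iff)

definition walk_state :: "nat \<Rightarrow> int \<Rightarrow> int list \<Rightarrow> (bool \<times> nat) state" where
  "walk_state n m p = full (n - nat \<bar>m\<bar>) (m > 0) (half p n)"

lemma (in blob_params) walk_word_act:
  "p \<in> walks n m \<Longrightarrow> word_act True (walk_word p) (1, vac) = (1, walk_state n m p)"
  using walk_word_state[of p n m] by (simp add: walk_state_def)

lemma half_ok_walk: "p \<in> walks n m \<Longrightarrow> half_ok (m > 0) (half p n)"
  using blob_params.walk_word_state[of p n m] by blast

lemma view_bottom_walk_state:
  assumes "p \<in> walks n m" "q \<in> walks n m"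
  shows "view False (walk_state n m p) = view False (walk_state n m q)"
  using half_ok_walk[OF assms(1)] half_ok_walk[OF assms(2)] view_full(2)
  by (cases "half p n"; cases "half q n") (simp add: walk_state_def)

lemma view_top_walk_state_inj:
  assumes "p \<in> walks n m" "q \<in> walks n m'" "view True (walk_state n m p) = view True (walk_state n m' q)"
  shows "p = q"
proof (rule half_inj[OF assms(1,2)])
  obtain f d ln f' d' ln' where h: "half p n = (f, d, ln)" "half q n = (f', d', ln')"
    by (cases "half p n"; cases "half q n") auto
  have e: "(\<lambda>(b, z). if b then (True, f z) else (False, z), \<lambda>(b, z). b \<and> d z)
      = (\<lambda>(b, z). if b then (True, f' z) else (False, z), \<lambda>(b, z). b \<and> d' z)"
    using assms(3) half_ok_walk[OF assms(1)] half_ok_walk[OF assms(2)]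
    unfolding walk_state_def h by (simp only: view_full)
  have "f z = f' z \<and> d z = d' z" for z
    using fun_cong[OF arg_cong[OF e, of fst], of "(True, z)"] fun_cong[OF arg_cong[OF e, of snd], of "(True, z)"]
    by simp
  then show "fst (half p n) = fst (half q n)" "fst (snd (half p n)) = fst (snd (half q n))"
    unfolding h by auto
qed

lemma weights_of_walk: "p \<in> walks n m \<Longrightarrow> m = p ! n"
  by (simp add: walks_def)

context blob_params
begin

text \<open>
  The top half of \<open>a F b\<^sup>o\<close> is that of \<open>a F\<close> and its bottom half is the mirror image of the top half of
  \<open>b F\<close>, because the action of \<open>b\<close> on the bottom points only sees the bottom half of \<open>a F\<close>.
\<close>

lemma square_state:
  assumes F: "word_act True F (1, vac) = (1, \<Phi>)" "word_act True (rev F) (1, vac) = (1, \<Phi>)"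
    and a: "word_act True (a @ F) (1, vac) = (1, A)" "view False A = view False \<Phi>"
    and b: "word_act True (b @ F) (1, vac) = (1, B)" "view False B = view False \<Phi>"
  obtains s where "word_act True (a @ F @ rev b) (1, vac) = (1, s)"
    "view True s = view True A" "view False s = swap (view True B)"
proof -
  \<comment> \<open>F and its reversal give the same diagram, and reversal mirrors diagrams, so the
    diagram of F is symmetric.\<close>
  have sw: "swap \<Phi> = \<Phi>"
    using word_act_swap[of True F 1 vac] word_act_vac[of True "rev F" 1] F by simp
  have p: "perfect \<Phi>" "perfect B" "perfect A"
    using word_act_perfect[of "(1, vac)" True F] word_act_perfect[of "(1, vac)" True "b @ F"]
      word_act_perfect[of "(1, vac)" True "a @ F"] perfect_vac F(1) a b by auto
  have aA: "word_act True a (1, \<Phi>) = (1, A)" and bB: "word_act True b (1, \<Phi>) = (1, B)"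
    using F a b by auto
  have bB': "word_act False b (1, \<Phi>) = (1, swap B)"
    using word_act_swap[of True b 1 \<Phi>] bB sw by simp
  have e: "word_act True (a @ F @ rev b) (1, vac) = word_act False b (1, A)"
    using word_act_vac[of True "rev b" 1] word_act_comm[of "(1, vac)" True False "a @ F" b] perfect_vac a by simp
  have e': "word_act False b (1, A) = word_act True a (1, swap B)"
    using word_act_comm[of "(1, \<Phi>)" True False a b] p aA bB' by simp
  obtain c s where cs: "word_act False b (1, A) = (c, s)" by (cases "word_act False b (1, A)")
  have "(c, view False s) = word_act False b (1, view False \<Phi>)"
    using word_act_view[of False b 1 A] cs a(2) by simp
  also have "\<dots> = (1, view False (swap B))"
    using word_act_view[of False b 1 \<Phi>] bB' by simp
  finally have 1: "c = 1" "view False s = swap (view True B)"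
    by (auto simp: view_swap)
  have "view True (swap B) = view True \<Phi>"
    using b(2) view_swap[of True B] view_swap[of True \<Phi>] sw by simp
  then have "(c, view True s) = word_act True a (1, view True \<Phi>)"
    using word_act_view[of True a 1 "swap B"] cs e' by simp
  also have "\<dots> = (1, view True A)"
    using word_act_view[of True a 1 \<Phi>] aA by simp
  finally have "view True s = view True A" by simp
  then show ?thesis using that e cs 1 by simp
qed

end

section \<open>Associative algebras whose scalars form a type\<close>

locale scalar_ring = ring A for A :: "('k::comm_ring_1, 'a) module" (structure) +
  assumes smult_closed [simp, intro]: "a \<in> carrier A \<Longrightarrow> c \<odot> a \<in> carrier A"
    and smult_add: "\<lbrakk>a \<in> carrier A; b \<in> carrier A\<rbrakk> \<Longrightarrow> c \<odot> (a \<oplus> b) = c \<odot> a \<oplus> c \<odot> b"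
    and add_smult: "a \<in> carrier A \<Longrightarrow> (c + d) \<odot> a = c \<odot> a \<oplus> d \<odot> a"
    and smult_smult: "a \<in> carrier A \<Longrightarrow> (c * d) \<odot> a = c \<odot> (d \<odot> a)"
    and one_smult [simp]: "a \<in> carrier A \<Longrightarrow> 1 \<odot> a = a"
    and smult_mult: "\<lbrakk>a \<in> carrier A; b \<in> carrier A\<rbrakk> \<Longrightarrow> (c \<odot> a) \<otimes> b = c \<odot> (a \<otimes> b)"
    and mult_smult: "\<lbrakk>a \<in> carrier A; b \<in> carrier A\<rbrakk> \<Longrightarrow> a \<otimes> (c \<odot> b) = c \<odot> (a \<otimes> b)"
begin

lemma zero_smult [simp]: "a \<in> carrier A \<Longrightarrow> 0 \<odot> a = \<zero>"
  using add_smult[of a 0 0] by simp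

lemma smult_zero [simp]: "c \<odot> \<zero> = \<zero>"
  using smult_add[of \<zero> \<zero> c] by simp

lemma smult_finsum:
  assumes "f \<in> S \<rightarrow> carrier A"
  shows "c \<odot> (\<Oplus>i\<in>S. f i) = (\<Oplus>i\<in>S. c \<odot> f i)"
proof (cases "finite S")
  case True
  then show ?thesis using assms
    by (induction S) (auto simp: smult_add finsum_insert Pi_def)
next
  case False
  then show ?thesis by (simp add: finsum_infinite)
qed

lemma smult_eq_mult: "a \<in> carrier A \<Longrightarrow> c \<odot> a = (c \<odot> \<one>) \<otimes> a"
  by (simp add: smult_mult)

end

text \<open>A factor ring and the corresponding quotient algebra are records of different types that
  share their ring operations; this carries the ring axioms across.\<close>

lemma ring_cong_fields:
  assumes "ring R" "carrier S = carrier R" "mult S = mult R" "one S = one R" "zero S = zero R" "add S = add R"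
  shows "ring S"
proof -
  interpret R: ring R by fact
  show ?thesis
  proof (rule ringI)
    show "abelian_group S"
    proof (rule abelian_groupI)
      fix x assume "x \<in> carrier S"
      then show "\<exists>y\<in>carrier S. y \<oplus>\<^bsub>S\<^esub> x = \<zero>\<^bsub>S\<^esub>"
        using R.l_neg assms by (metis R.a_inv_closed)
    qed (simp_all add: assms R.add.m_assoc R.add.m_comm R.add.m_lcomm)
    show "monoid S"
      by (rule monoidI) (simp_all add: assms R.m_assoc)
  qed (simp_all add: assms R.l_distr R.r_distr)
qed

subsection \<open>Monoid algebras\<close>

definition support :: "('m \<Rightarrow> 'k::zero) \<Rightarrow> 'm set" where
  "support f = {a. f a \<noteq> 0}"

text \<open>The linear extension of t, with coefficients moved along \<phi>. For the identity map it
  detects equality (\<open>pairing_ext\<close>), so identities in a monoid algebra are tested by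
  pairing; for a general \<phi> it produces functionals on the scalar extension.\<close>

definition pairing :: "('r::comm_ring_1 \<Rightarrow> 'k::comm_ring_1) \<Rightarrow> ('m \<Rightarrow> 'r) \<Rightarrow> ('m \<Rightarrow> 'k) \<Rightarrow> 'k" where
  "pairing \<phi> f t = (\<Sum>a\<in>support f. \<phi> (f a) * t a)"

lemma monoid_algebra_simps:
  "carrier (monoid_algebra M) = {f. finite (support f) \<and> support f \<subseteq> carrier M}"
  "one (monoid_algebra M) = monoid_basis \<one>\<^bsub>M\<^esub>"
  "zero (monoid_algebra M) = (\<lambda>_. 0)"
  "add (monoid_algebra M) f g = (\<lambda>a. f a + g a)"
  "smult (monoid_algebra M) c f = (\<lambda>a. c * f a)"
  by (simp_all add: monoid_algebra_def support_def)

locale comm_ring_map =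
  fixes \<phi> :: "'r::comm_ring_1 \<Rightarrow> 'k::comm_ring_1"
  assumes map_1: "\<phi> 1 = 1" and map_add: "\<phi> (a + b) = \<phi> a + \<phi> b" and map_mult: "\<phi> (a * b) = \<phi> a * \<phi> b"
begin

lemma map_0: "\<phi> 0 = 0"
  using map_add[of 0 0] by simp

lemma map_sum: "\<phi> (sum f S) = (\<Sum>i\<in>S. \<phi> (f i))"
  by (induction S rule: infinite_finite_induct) (simp_all add: map_0 map_add)

lemma pairing_superset:
  assumes "finite S" "support f \<subseteq> S"
  shows "pairing \<phi> f t = (\<Sum>a\<in>S. \<phi> (f a) * t a)"
  unfolding pairing_def using assms by (intro sum.mono_neutral_left) (auto simp: support_def map_0)

lemma pairing_add:
  assumes "finite (support f)" "finite (support g)"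
  shows "pairing \<phi> (\<lambda>a. f a + g a) t = pairing \<phi> f t + pairing \<phi> g t"
proof -
  let ?S = "support f \<union> support g"
  have "support (\<lambda>a. f a + g a) \<subseteq> ?S" by (auto simp: support_def)
  then show ?thesis
    using assms pairing_superset[of ?S _ t] by (simp add: map_add distrib_right sum.distrib)
qed

lemma pairing_smult:
  assumes "finite (support f)"
  shows "pairing \<phi> (\<lambda>a. c * f a) t = \<phi> c * pairing \<phi> f t"
proof -
  have "support (\<lambda>a. c * f a) \<subseteq> support f" by (auto simp: support_def)
  then show ?thesis
    using assms pairing_superset[of "support f" _ t] by (simp add: map_mult sum_distrib_left mult.assoc)
qed

lemma pairing_basis: "pairing \<phi> (monoid_basis a) t = t a"
  using pairing_superset[of "{a}" "monoid_basis a" t] by (simp add: monoid_basis_def support_def map_0 map_1)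

lemma pairing_cong: "(\<And>a. a \<in> support f \<Longrightarrow> t a = t' a) \<Longrightarrow> pairing \<phi> f t = pairing \<phi> f t'"
  unfolding pairing_def by (rule sum.cong) auto

lemma pairing_fun_add: "pairing \<phi> f (\<lambda>a. t a + t' a) = pairing \<phi> f t + pairing \<phi> f t'"
  by (simp add: pairing_def distrib_left sum.distrib)

lemma pairing_fun_mult: "pairing \<phi> f (\<lambda>a. c * t a) = c * pairing \<phi> f t"
  by (simp add: pairing_def sum_distrib_left mult.left_commute)

text \<open>Grouping pairs by their product turns a convolution into an iterated pairing.
  Associativity and distributivity then follow without handling convolution sums again.\<close>

lemma pairing_mult:
  assumes f: "finite (support f)" and g: "finite (support g)"
  shows "finite (support (mult (monoid_algebra M) f g))"
    "support (mult (monoid_algebra M) f g) \<subseteq> (\<lambda>(a, b). a \<otimes>\<^bsub>M\<^esub> b) ` (support f \<times> support g)"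
    "pairing \<phi> (mult (monoid_algebra M) f g) t = pairing \<phi> f (\<lambda>a. pairing \<phi> g (\<lambda>b. t (a \<otimes>\<^bsub>M\<^esub> b)))"
proof -
  let ?P = "support f \<times> support g" and ?m = "\<lambda>(a, b). a \<otimes>\<^bsub>M\<^esub> b"
  let ?h = "mult (monoid_algebra M) f g"
  have h: "?h c = (\<Sum>p\<in>{p \<in> ?P. ?m p = c}. case p of (a, b) \<Rightarrow> f a * g b)" for c
    unfolding monoid_algebra_def by (simp, rule sum.cong) (auto simp: support_def)
  show sub: "support ?h \<subseteq> ?m ` ?P"
  proof
    fix c assume "c \<in> support ?h"
    then have "?h c \<noteq> 0" by (simp add: support_def)
    then have "{p \<in> ?P. ?m p = c} \<noteq> {}" using h[of c] sum.empty by metis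
    then show "c \<in> ?m ` ?P" by blast
  qed
  have fin: "finite ?P" using f g by simp
  then show "finite (support ?h)" using sub finite_subset by blast
  have "pairing \<phi> ?h t = (\<Sum>c\<in>?m ` ?P. \<phi> (?h c) * t c)"
    using pairing_superset[OF _ sub] fin by simp
  also have "\<dots> = (\<Sum>c\<in>?m ` ?P. \<Sum>p\<in>{p \<in> ?P. ?m p = c}. case p of (a, b) \<Rightarrow> \<phi> (f a) * \<phi> (g b) * t (?m p))"
  proof (rule sum.cong[OF refl])
    fix c
    show "\<phi> (?h c) * t c = (\<Sum>p\<in>{p \<in> ?P. ?m p = c}. case p of (a, b) \<Rightarrow> \<phi> (f a) * \<phi> (g b) * t (?m p))"
      unfolding h map_sum sum_distrib_right by (rule sum.cong) (auto simp: map_mult)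
  qed
  also have "\<dots> = (\<Sum>p\<in>?P. case p of (a, b) \<Rightarrow> \<phi> (f a) * \<phi> (g b) * t (?m p))"
    using sum.image_gen[OF fin, of "\<lambda>p. case p of (a, b) \<Rightarrow> \<phi> (f a) * \<phi> (g b) * t (?m p)" ?m] by simp
  also have "\<dots> = (\<Sum>a\<in>support f. \<Sum>b\<in>support g. \<phi> (f a) * (\<phi> (g b) * t (a \<otimes>\<^bsub>M\<^esub> b)))"
    by (simp add: sum.cartesian_product case_prod_beta' mult.assoc)
  finally show "pairing \<phi> ?h t = pairing \<phi> f (\<lambda>a. pairing \<phi> g (\<lambda>b. t (a \<otimes>\<^bsub>M\<^esub> b)))"
    by (simp add: pairing_def sum_distrib_left)
qed

end

lemma comm_ring_map_id: "comm_ring_map (\<lambda>c. c)"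
  by unfold_locales auto

lemma pairing_ext:
  fixes f g :: "'m \<Rightarrow> 'k::comm_ring_1"
  assumes "finite (support f)" "finite (support g)" "\<And>t. pairing (\<lambda>c. c) f t = pairing (\<lambda>c. c) g t"
  shows "f = g"
proof
  fix a
  interpret comm_ring_map "\<lambda>c::'k. c" by (rule comm_ring_map_id)
  have *: "pairing (\<lambda>c. c) h (\<lambda>b. if b = a then 1 else 0) = h a" if "finite (support h)" for h :: "'m \<Rightarrow> 'k"
    using pairing_superset[of "insert a (support h)" h "\<lambda>b. if b = a then 1 else 0"] that
    by (auto simp: sum.delta if_distrib cong: if_cong)
  show "f a = g a"
    by (rule trans[OF trans[OF *[OF assms(1), symmetric] assms(3)] *[OF assms(2)]])
qed

lemma support_basis: "support (monoid_basis a :: 'm \<Rightarrow> 'k::comm_ring_1) = {a}"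
  by (auto simp: support_def monoid_basis_def)

lemma monoid_basis_closed: "a \<in> carrier M \<Longrightarrow> monoid_basis a \<in> carrier (monoid_algebra M)"
  by (simp add: monoid_algebra_simps support_basis)

theorem scalar_ring_monoid_algebra:
  fixes M :: "('m, 'z) monoid_scheme"
  assumes "monoid M"
  shows "scalar_ring (monoid_algebra M :: ('k::comm_ring_1, 'm \<Rightarrow> 'k) module)"
proof -
  interpret M: monoid M by fact
  interpret comm_ring_map "\<lambda>c::'k. c" by (rule comm_ring_map_id)
  let ?A = "monoid_algebra M :: ('k, 'm \<Rightarrow> 'k) module"
  note simps = monoid_algebra_simps[of M]
  have cl: "finite (support f)" "support f \<subseteq> carrier M" if "f \<in> carrier ?A" for f
    using that by (auto simp: simps)
  have add_cl: "f \<oplus>\<^bsub>?A\<^esub> g \<in> carrier ?A" if "f \<in> carrier ?A" "g \<in> carrier ?A" for f g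
  proof -
    have sub: "support (\<lambda>a. f a + g a) \<subseteq> support f \<union> support g" by (auto simp: support_def)
    have "finite (support (\<lambda>a. f a + g a))"
      by (rule finite_subset[OF sub]) (simp add: cl that)
    moreover have "support (\<lambda>a. f a + g a) \<subseteq> carrier M"
      using sub cl(2)[OF that(1)] cl(2)[OF that(2)] by blast
    ultimately show ?thesis by (simp add: simps(1,4))
  qed
  have smult_cl: "c \<odot>\<^bsub>?A\<^esub> f \<in> carrier ?A" if "f \<in> carrier ?A" for c f
  proof -
    have sub: "support (\<lambda>a. c * f a) \<subseteq> support f" by (auto simp: support_def)
    have "finite (support (\<lambda>a. c * f a))"
      by (rule finite_subset[OF sub]) (simp add: cl that)
    moreover have "support (\<lambda>a. c * f a) \<subseteq> carrier M"
      using sub cl(2)[OF that] by blast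
    ultimately show ?thesis by (simp add: simps(1,5))
  qed
  have mult_cl: "f \<otimes>\<^bsub>?A\<^esub> g \<in> carrier ?A" if f: "f \<in> carrier ?A" and g: "g \<in> carrier ?A" for f g
  proof -
    have "(\<lambda>(a, b). a \<otimes>\<^bsub>M\<^esub> b) ` (support f \<times> support g) \<subseteq> carrier M"
      using cl(2)[OF f] cl(2)[OF g] by (auto dest!: subsetD)
    then show ?thesis
      using pairing_mult(1,2)[OF cl(1)[OF f] cl(1)[OF g], of M] by (simp add: simps(1) subset_trans)
  qed
  have ext: "f = g" if "f \<in> carrier ?A" "g \<in> carrier ?A" "\<And>t. pairing (\<lambda>c. c) f t = pairing (\<lambda>c. c) g t" for f g
    by (rule pairing_ext) (use that cl in auto)
  have pm: "pairing (\<lambda>c. c) (f \<otimes>\<^bsub>?A\<^esub> g) t = pairing (\<lambda>c. c) f (\<lambda>a. pairing (\<lambda>c. c) g (\<lambda>b. t (a \<otimes>\<^bsub>M\<^esub> b)))"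
    if "f \<in> carrier ?A" "g \<in> carrier ?A" for f g t
    using pairing_mult(3) cl(1) that by blast
  have pa: "pairing (\<lambda>c. c) (f \<oplus>\<^bsub>?A\<^esub> g) t = pairing (\<lambda>c. c) f t + pairing (\<lambda>c. c) g t"
    if "f \<in> carrier ?A" "g \<in> carrier ?A" for f g t
    using pairing_add[OF cl(1)[OF that(1)] cl(1)[OF that(2)]] by (simp add: simps(4))
  have ps: "pairing (\<lambda>c. c) (c \<odot>\<^bsub>?A\<^esub> f) t = c * pairing (\<lambda>c. c) f t" if "f \<in> carrier ?A" for c f t
    using pairing_smult[OF cl(1)[OF that]] by (simp add: simps(5))
  have one_cl: "\<one>\<^bsub>?A\<^esub> \<in> carrier ?A" by (simp add: simps support_basis)
  have p1: "pairing (\<lambda>c. c) \<one>\<^bsub>?A\<^esub> t = t \<one>\<^bsub>M\<^esub>" for t by (simp add: simps pairing_basis)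
  have pc: "pairing (\<lambda>c. c) f t = pairing (\<lambda>c. c) f t'"
    if "f \<in> carrier ?A" "\<And>a. a \<in> carrier M \<Longrightarrow> t a = t' a" for f t t'
    using cl(2) that by (intro pairing_cong) blast
  have "ring ?A"
  proof (rule ringI)
    show "abelian_group ?A"
    proof (rule abelian_groupI)
      fix f assume f: "f \<in> carrier ?A"
      have "(\<lambda>a. - f a) \<in> carrier ?A" using f by (simp add: simps support_def)
      then show "\<exists>g\<in>carrier ?A. g \<oplus>\<^bsub>?A\<^esub> f = \<zero>\<^bsub>?A\<^esub>"
        by (intro bexI[of _ "\<lambda>a. - f a"]) (auto simp: simps)
    next
      show "\<zero>\<^bsub>?A\<^esub> \<in> carrier ?A" by (simp add: simps support_def)
    qed (use add_cl in \<open>simp_all add: simps(3,4) ac_simps\<close>)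
    show "monoid ?A"
    proof (rule monoidI)
      fix f g h assume fgh: "f \<in> carrier ?A" "g \<in> carrier ?A" "h \<in> carrier ?A"
      show "f \<otimes>\<^bsub>?A\<^esub> g \<otimes>\<^bsub>?A\<^esub> h = f \<otimes>\<^bsub>?A\<^esub> (g \<otimes>\<^bsub>?A\<^esub> h)"
      proof (rule ext)
        fix t
        show "pairing (\<lambda>c. c) (f \<otimes>\<^bsub>?A\<^esub> g \<otimes>\<^bsub>?A\<^esub> h) t = pairing (\<lambda>c. c) (f \<otimes>\<^bsub>?A\<^esub> (g \<otimes>\<^bsub>?A\<^esub> h)) t"
          using fgh by (simp add: pm mult_cl) (intro pc, auto simp: M.m_assoc)
      qed (use fgh mult_cl in auto)
    next
      fix f assume f: "f \<in> carrier ?A"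
      show "\<one>\<^bsub>?A\<^esub> \<otimes>\<^bsub>?A\<^esub> f = f"
      proof (rule ext)
        fix t show "pairing (\<lambda>c. c) (\<one>\<^bsub>?A\<^esub> \<otimes>\<^bsub>?A\<^esub> f) t = pairing (\<lambda>c. c) f t"
          unfolding pm[OF one_cl f] p1 by (rule pc[OF f]) simp
      qed (use f one_cl mult_cl in auto)
      show "f \<otimes>\<^bsub>?A\<^esub> \<one>\<^bsub>?A\<^esub> = f"
      proof (rule ext)
        fix t show "pairing (\<lambda>c. c) (f \<otimes>\<^bsub>?A\<^esub> \<one>\<^bsub>?A\<^esub>) t = pairing (\<lambda>c. c) f t"
          unfolding pm[OF f one_cl] p1 by (rule pc[OF f]) simp
      qed (use f one_cl mult_cl in auto)
    qed (use one_cl mult_cl in auto)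
  next
    fix f g h assume fgh: "f \<in> carrier ?A" "g \<in> carrier ?A" "h \<in> carrier ?A"
    show "(f \<oplus>\<^bsub>?A\<^esub> g) \<otimes>\<^bsub>?A\<^esub> h = f \<otimes>\<^bsub>?A\<^esub> h \<oplus>\<^bsub>?A\<^esub> g \<otimes>\<^bsub>?A\<^esub> h"
      by (rule ext) (use fgh add_cl mult_cl in \<open>simp_all add: pm pa\<close>)
    show "h \<otimes>\<^bsub>?A\<^esub> (f \<oplus>\<^bsub>?A\<^esub> g) = h \<otimes>\<^bsub>?A\<^esub> f \<oplus>\<^bsub>?A\<^esub> h \<otimes>\<^bsub>?A\<^esub> g"
      by (rule ext) (use fgh add_cl mult_cl in \<open>simp_all add: pm pa pairing_fun_add\<close>)
  qed
  then interpret A: ring ?A .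
  show ?thesis
  proof
    fix f g c assume f: "f \<in> carrier ?A" and g: "g \<in> carrier ?A"
    show "(c \<odot>\<^bsub>?A\<^esub> f) \<otimes>\<^bsub>?A\<^esub> g = c \<odot>\<^bsub>?A\<^esub> (f \<otimes>\<^bsub>?A\<^esub> g)"
      by (rule ext) (use f g smult_cl mult_cl in \<open>simp_all add: pm ps\<close>)
    show "f \<otimes>\<^bsub>?A\<^esub> (c \<odot>\<^bsub>?A\<^esub> g) = c \<odot>\<^bsub>?A\<^esub> (f \<otimes>\<^bsub>?A\<^esub> g)"
      by (rule ext) (use f g smult_cl mult_cl in \<open>simp_all add: pm ps pairing_fun_mult\<close>)
    show "c \<odot>\<^bsub>?A\<^esub> f \<in> carrier ?A" by (rule smult_cl[OF f])
  qed (simp_all add: simps(4,5) distrib_left distrib_right mult.assoc)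
qed

lemma basis_mult:
  assumes "monoid M" "a \<in> carrier M" "b \<in> carrier M"
  shows "monoid_basis a \<otimes>\<^bsub>monoid_algebra M\<^esub> monoid_basis b = (monoid_basis (a \<otimes>\<^bsub>M\<^esub> b) :: 'm \<Rightarrow> 'k::comm_ring_1)"
proof -
  interpret comm_ring_map "\<lambda>c::'k. c" by (rule comm_ring_map_id)
  have fin: "finite (support (monoid_basis x :: 'm \<Rightarrow> 'k))" for x by (simp add: support_basis)
  show ?thesis
    by (rule pairing_ext) (simp_all add: pairing_mult[OF fin fin] fin pairing_basis)
qed

lemma monoid_algebra_span:
  assumes f: "f \<in> carrier (monoid_algebra M)"
    and zero: "\<zero>\<^bsub>monoid_algebra M\<^esub> \<in> W"
    and basis: "\<And>a. a \<in> carrier M \<Longrightarrow> monoid_basis a \<in> W"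
    and add: "\<And>g h. g \<in> W \<Longrightarrow> h \<in> W \<Longrightarrow> g \<oplus>\<^bsub>monoid_algebra M\<^esub> h \<in> W"
    and smult: "\<And>c g. g \<in> W \<Longrightarrow> c \<odot>\<^bsub>monoid_algebra M\<^esub> g \<in> W"
  shows "f \<in> W"
proof -
  have "\<forall>f. support f = S \<longrightarrow> f \<in> W" if "finite S" "S \<subseteq> carrier M" for S
    using that
  proof (induction S)
    case empty
    then show ?case using zero by (auto simp: support_def monoid_algebra_simps fun_eq_iff)
  next
    case (insert a S)
    show ?case
    proof (intro allI impI)
      fix f :: "'a \<Rightarrow> 'b" assume f: "support f = insert a S"
      have "support (f(a := 0)) = S" using f insert.hyps by (auto simp: support_def split: if_splits)
      then have "f(a := 0) \<in> W" using insert by auto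
      moreover have "f = f a \<odot>\<^bsub>monoid_algebra M\<^esub> monoid_basis a \<oplus>\<^bsub>monoid_algebra M\<^esub> f(a := 0)"
        by (auto simp: monoid_algebra_simps monoid_basis_def)
      ultimately show "f \<in> W" using add smult basis insert.prems by (metis insert_subset)
    qed
  qed
  then show ?thesis using f by (auto simp: monoid_algebra_simps(1))
qed

subsection \<open>Quotients and universal property\<close>

lemma quotient_algebra_simps:
  "carrier (quotient_algebra A I) = carrier (A Quot I)"
  "mult (quotient_algebra A I) = mult (A Quot I)"
  "one (quotient_algebra A I) = one (A Quot I)"
  "zero (quotient_algebra A I) = zero (A Quot I)"
  "add (quotient_algebra A I) = add (A Quot I)"
  "c \<odot>\<^bsub>quotient_algebra A I\<^esub> X = (\<Union>a\<in>X. I +>\<^bsub>A\<^esub> (c \<odot>\<^bsub>A\<^esub> a))"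
  by (simp_all add: quotient_algebra_def ring.extend_def module.fields_def)

locale scalar_ring_ideal = scalar_ring A + ideal I A for A :: "('k::comm_ring_1, 'a) module" (structure) and I
begin

abbreviation Q where "Q \<equiv> quotient_algebra A I"

lemma smult_ideal: "i \<in> I \<Longrightarrow> c \<odot> i \<in> I"
  using smult_eq_mult[of i c] I_l_closed[of i "c \<odot> \<one>"] Icarr[of i] by simp

lemma quotient_carrier: "carrier Q = (\<lambda>a. I +> a) ` carrier A"
  by (auto simp: quotient_algebra_simps FactRing_def A_RCOSETS_def')

lemma proj_closed [simp]: "a \<in> carrier A \<Longrightarrow> I +> a \<in> carrier Q"
  by (simp add: quotient_carrier)

lemma proj_add: "a \<in> carrier A \<Longrightarrow> b \<in> carrier A \<Longrightarrow> I +> (a \<oplus> b) = (I +> a) \<oplus>\<^bsub>Q\<^esub> (I +> b)"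
  using ring_hom_add[OF rcos_ring_hom] by (simp add: quotient_algebra_simps)

lemma proj_mult: "a \<in> carrier A \<Longrightarrow> b \<in> carrier A \<Longrightarrow> I +> (a \<otimes> b) = (I +> a) \<otimes>\<^bsub>Q\<^esub> (I +> b)"
  using ring_hom_mult[OF rcos_ring_hom] by (simp add: quotient_algebra_simps)

lemma proj_one: "I +> \<one> = \<one>\<^bsub>Q\<^esub>"
  using ring_hom_one[OF rcos_ring_hom] by (simp add: quotient_algebra_simps)

lemma proj_eq_iff: "a \<in> carrier A \<Longrightarrow> b \<in> carrier A \<Longrightarrow> I +> a = I +> b \<longleftrightarrow> a \<ominus> b \<in> I"
  using quotient_eq_iff_same_a_r_cos[OF is_ideal] by simp

lemma proj_smult: "a \<in> carrier A \<Longrightarrow> I +> (c \<odot> a) = c \<odot>\<^bsub>Q\<^esub> (I +> a)"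
proof -
  assume a: "a \<in> carrier A"
  \<comment> \<open>The quotient defines the scalar action as a union over representatives; all of
    them contribute the same coset.\<close>
  have "I +> (c \<odot> b) = I +> (c \<odot> a)" if "b \<in> I +> a" for b
  proof -
    have b: "b \<in> carrier A" using that a a_r_coset_subset_G[OF a_subset a] by blast
    have "I +> b = I +> a"
      using a_repr_independence[OF that a] additive_subgroup_axioms additive_subgroup.a_subgroup by metis
    then have i: "b \<ominus> a \<in> I" using proj_eq_iff a b by simp
    have "c \<odot> b = c \<odot> ((b \<ominus> a) \<oplus> a)" using a b by (simp add: minus_eq a_assoc l_neg)
    also have "\<dots> = c \<odot> (b \<ominus> a) \<oplus> c \<odot> a" using a b by (simp add: smult_add)
    finally have "c \<odot> b \<ominus> c \<odot> a = c \<odot> (b \<ominus> a)"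
      using a b by (simp add: minus_eq a_assoc r_neg)
    then show ?thesis using proj_eq_iff a b smult_ideal[OF i] by simp
  qed
  moreover have "a \<in> I +> a" using a_rcos_self[OF a] additive_subgroup_axioms by (simp add: additive_subgroup.a_subgroup)
  ultimately have "(\<Union>b\<in>I +> a. I +> (c \<odot> b)) = I +> (c \<odot> a)"
    by blast
  then show ?thesis by (simp only: quotient_algebra_simps(6))
qed

lemma quotientE:
  assumes "X \<in> carrier Q"
  obtains a where "a \<in> carrier A" "X = I +> a"
  using assms by (auto simp: quotient_carrier)

sublocale quotient: scalar_ring Q
proof -
  have "ring Q"
    by (rule ring_cong_fields[OF quotient_is_ring]) (simp_all add: quotient_algebra_simps)
  then interpret R: ring Q .
  show "scalar_ring Q"
  proof
    fix X c assume "X \<in> carrier Q"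
    then obtain a where a: "a \<in> carrier A" "X = I +> a" by (rule quotientE)
    show "c \<odot>\<^bsub>Q\<^esub> X \<in> carrier Q" using a by (simp flip: proj_smult)
    show "1 \<odot>\<^bsub>Q\<^esub> X = X" using a by (simp flip: proj_smult)
    fix d
    show "(c + d) \<odot>\<^bsub>Q\<^esub> X = c \<odot>\<^bsub>Q\<^esub> X \<oplus>\<^bsub>Q\<^esub> d \<odot>\<^bsub>Q\<^esub> X"
      using a by (simp add: add_smult flip: proj_smult proj_add)
    show "(c * d) \<odot>\<^bsub>Q\<^esub> X = c \<odot>\<^bsub>Q\<^esub> (d \<odot>\<^bsub>Q\<^esub> X)"
      using a by (simp add: smult_smult flip: proj_smult)
  next
    fix X Y c assume "X \<in> carrier Q" "Y \<in> carrier Q"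
    then obtain a b where a: "a \<in> carrier A" "X = I +> a" and b: "b \<in> carrier A" "Y = I +> b"
      by (metis quotientE)
    show "c \<odot>\<^bsub>Q\<^esub> (X \<oplus>\<^bsub>Q\<^esub> Y) = c \<odot>\<^bsub>Q\<^esub> X \<oplus>\<^bsub>Q\<^esub> c \<odot>\<^bsub>Q\<^esub> Y"
      using a b by (simp add: smult_add flip: proj_smult proj_add)
    show "c \<odot>\<^bsub>Q\<^esub> X \<otimes>\<^bsub>Q\<^esub> Y = c \<odot>\<^bsub>Q\<^esub> (X \<otimes>\<^bsub>Q\<^esub> Y)"
      using a b by (simp add: smult_mult flip: proj_smult proj_mult)
    show "X \<otimes>\<^bsub>Q\<^esub> (c \<odot>\<^bsub>Q\<^esub> Y) = c \<odot>\<^bsub>Q\<^esub> (X \<otimes>\<^bsub>Q\<^esub> Y)"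
      using a b by (simp add: mult_smult flip: proj_smult proj_mult)
  qed
qed

end

locale additive_map = ring A for A :: "('a, 'z) ring_scheme" (structure) +
  fixes t :: "'a \<Rightarrow> 'v::ab_group_add"
  assumes additive: "\<lbrakk>a \<in> carrier A; b \<in> carrier A\<rbrakk> \<Longrightarrow> t (a \<oplus> b) = t a + t b"
begin

lemma additive_zero [simp]: "t \<zero> = 0"
  using additive[of \<zero> \<zero>] by simp

lemma additive_minus: "a \<in> carrier A \<Longrightarrow> b \<in> carrier A \<Longrightarrow> t (a \<ominus> b) = t a - t b"
proof -
  assume ab: "a \<in> carrier A" "b \<in> carrier A"
  then have "(a \<ominus> b) \<oplus> b = a" by (simp add: minus_eq a_assoc l_neg)
  then have "t a = t (a \<ominus> b) + t b" using additive[of "a \<ominus> b" b] ab by simp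
  then show "t (a \<ominus> b) = t a - t b" by (simp add: eq_diff_eq)
qed

lemma relation_ideal_vanish:
  assumes R: "R \<subseteq> carrier A \<times> carrier A"
    and t: "\<And>l r x y. \<lbrakk>(l, r) \<in> R; x \<in> carrier A; y \<in> carrier A\<rbrakk> \<Longrightarrow> t (x \<otimes> l \<otimes> y) = t (x \<otimes> r \<otimes> y)"
    and a: "a \<in> relation_ideal A R"
  shows "t a = 0"
proof -
  let ?S = "{l \<ominus> r | l r. (l, r) \<in> R}"
  let ?K = "{i \<in> carrier A. \<forall>x\<in>carrier A. \<forall>y\<in>carrier A. t (x \<otimes> i \<otimes> y) = 0}"
  have sub: "?S \<subseteq> ?K"
  proof
    fix s assume "s \<in> ?S"
    then obtain l r where lr: "(l, r) \<in> R" "s = l \<ominus> r" by blast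
    then have c: "l \<in> carrier A" "r \<in> carrier A" using R by auto
    have "t (x \<otimes> s \<otimes> y) = 0" if "x \<in> carrier A" "y \<in> carrier A" for x y
    proof -
      have "x \<otimes> s \<otimes> y = x \<otimes> l \<otimes> y \<ominus> x \<otimes> r \<otimes> y"
        using c that lr(2) by (simp add: minus_eq l_distr r_distr l_minus r_minus)
      then show ?thesis using t[OF lr(1) that] c that by (simp add: additive_minus)
    qed
    then show "s \<in> ?K" using c lr(2) by simp
  qed
  have "ideal ?K A"
  proof (rule idealI[OF ring_axioms])
    show "subgroup ?K (add_monoid A)"
    proof (rule add.subgroupI)
      show "?K \<noteq> {}" by (rule ccontr) (use zero_closed in force)
      fix i assume i: "i \<in> ?K"
      have "t (x \<otimes> (\<ominus> i) \<otimes> y) = 0" if "x \<in> carrier A" "y \<in> carrier A" for x y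
        using i that additive_minus[of \<zero> "x \<otimes> i \<otimes> y"] by (simp add: minus_eq l_minus r_minus)
      then show "\<ominus> i \<in> ?K" using i by simp
      fix j assume j: "j \<in> ?K"
      then show "i \<oplus> j \<in> ?K" using i by (simp add: l_distr r_distr additive)
    qed auto
  next
    fix i x assume i: "i \<in> ?K" and x: "x \<in> carrier A"
    have "t (a \<otimes> (x \<otimes> i) \<otimes> b) = t ((a \<otimes> x) \<otimes> i \<otimes> b)" if "a \<in> carrier A" "b \<in> carrier A" for a b
      using i x that by (simp add: m_assoc)
    then show "x \<otimes> i \<in> ?K" using i x by auto
    have "t (a \<otimes> (i \<otimes> x) \<otimes> b) = t (a \<otimes> i \<otimes> (x \<otimes> b))" if "a \<in> carrier A" "b \<in> carrier A" for a b
      using i x that by (simp add: m_assoc)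
    then show "i \<otimes> x \<in> ?K" using i x by auto
  qed
  then have "relation_ideal A R \<subseteq> ?K"
    unfolding relation_ideal_def using genideal_minimal sub by blast
  then have "a \<in> carrier A" "t (\<one> \<otimes> a \<otimes> \<one>) = 0" using a by auto
  then show ?thesis by simp
qed

end

lemma (in ring) relation_ideal_ideal:
  assumes "Rel \<subseteq> carrier R \<times> carrier R"
  shows "ideal (relation_ideal R Rel) R"
  unfolding relation_ideal_def by (rule genideal_ideal) (use assms in auto)

lemma (in ring) relation_in_ideal:
  assumes "Rel \<subseteq> carrier R \<times> carrier R" "(l, r) \<in> Rel"
  shows "l \<ominus> r \<in> relation_ideal R Rel"
proof -
  have "{l \<ominus> r | l r. (l, r) \<in> Rel} \<subseteq> carrier R" using assms(1) by auto
  from genideal_self[OF this] show ?thesis unfolding relation_ideal_def using assms(2) by blast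
qed

locale quotient_by_relations = scalar_ring A for A :: "('k::comm_ring_1, 'a) module" (structure) +
  fixes Rel assumes Rel: "Rel \<subseteq> carrier A \<times> carrier A"
begin

abbreviation "RI \<equiv> relation_ideal A Rel"

sublocale scalar_ring_ideal A RI
  by (intro scalar_ring_ideal.intro scalar_ring_axioms relation_ideal_ideal[OF Rel])

lemma proj_relation: "(l, r) \<in> Rel \<Longrightarrow> RI +> l = RI +> r"
  using proj_eq_iff[of l r] relation_in_ideal[OF Rel] Rel by auto

text \<open>The universal property is stated for additive maps, since coefficient functionals are
  not multiplicative. The price is that compatibility must hold in all two-sided contexts.\<close>

lemma lift_additive:
  assumes "additive_map A t"
    and "\<And>l r x y. \<lbrakk>(l, r) \<in> Rel; x \<in> carrier A; y \<in> carrier A\<rbrakk> \<Longrightarrow> t (x \<otimes> l \<otimes> y) = t (x \<otimes> r \<otimes> y)"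
  obtains T where "additive_map Q T" "\<And>a. a \<in> carrier A \<Longrightarrow> T (RI +> a) = t a"
proof -
  interpret t: additive_map A t by fact
  define T where "T X = t (SOME a. a \<in> carrier A \<and> X = RI +> a)" for X
  have T: "T (RI +> a) = t a" if a: "a \<in> carrier A" for a
  proof -
    define b where "b = (SOME b. b \<in> carrier A \<and> RI +> a = RI +> b)"
    have b: "b \<in> carrier A \<and> RI +> a = RI +> b"
      unfolding b_def by (rule someI[of _ a]) (simp add: a)
    then have "a \<ominus> b \<in> RI" using a proj_eq_iff by blast
    then have "t (a \<ominus> b) = 0" using t.relation_ideal_vanish[OF Rel assms(2)] by blast
    then have "t a = t b" using a b t.additive_minus by simp
    then show ?thesis by (simp add: T_def b_def)
  qed
  have "additive_map Q T"
  proof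
    fix X Y assume "X \<in> carrier Q" "Y \<in> carrier Q"
    then obtain a b where "a \<in> carrier A" "X = RI +> a" "b \<in> carrier A" "Y = RI +> b"
      by (metis quotientE)
    then show "T (X \<oplus>\<^bsub>Q\<^esub> Y) = T X + T Y"
      using t.additive T by (simp flip: proj_add)
  qed
  then show ?thesis using that T by blast
qed

end

section \<open>Words and linear functionals on the presented algebra\<close>

definition blob_rules :: "'r::comm_ring_1 \<Rightarrow> 'r \<Rightarrow> 'r \<Rightarrow> nat \<Rightarrow> (gen list \<times> 'r \<times> gen list) set" where
  "blob_rules q2 \<gamma> \<delta> n =
    {([Gen_U i, Gen_U i], q2, [Gen_U i]) | i. i \<in> {1..<n}} \<union>
    {([Gen_U i, Gen_U j, Gen_U i], 1, [Gen_U i])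
      | i j. i \<in> {1..<n} \<and> j \<in> {1..<n} \<and> (j = i + 1 \<or> i = j + 1)} \<union>
    {([Gen_U i, Gen_U j], 1, [Gen_U j, Gen_U i])
      | i j. i \<in> {1..<n} \<and> j \<in> {1..<n} \<and> j \<noteq> i + 1 \<and> i \<noteq> j + 1} \<union>
    {([Gen_U i, Gen_e, Gen_U i], \<gamma>, [Gen_U i]) | i. i \<in> {1..<n} \<and> i = 1} \<union>
    {([Gen_e, Gen_e], \<delta>, [Gen_e])} \<union>
    {([Gen_U i, Gen_e], 1, [Gen_e, Gen_U i]) | i. i \<in> {1..<n} \<and> i \<noteq> 1}"

lemma b_relations_eq:
  "b_relations x \<gamma> \<delta> n =
    {(monom_word 1 l, monom_word c r) | l c r. (l, c, r) \<in> blob_rules (x^2 + unit_inverse (x^2)) \<gamma> \<delta> n}"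
  unfolding b_relations_def blob_rules_def by (rule Set.set_eqI) (simp only: Un_iff mem_Collect_eq, blast)

lemma blob_rules_lists: "(l, c, r) \<in> blob_rules q2 \<gamma> \<delta> n \<Longrightarrow> l \<in> lists (gens n) \<and> r \<in> lists (gens n)"
  by (auto simp: blob_rules_def gens_def)

lemma monom_word_eq: "monom_word c w = (\<lambda>v. c * monoid_basis w v)"
  by (auto simp: monom_word_def monoid_basis_def fun_eq_iff)

lemma monoid_free_monoid: "monoid (free_monoid G)"
  by (rule monoidI) (auto simp: free_monoid_def)

text \<open>Two quotients are stacked: the free algebra over the ring modulo the relations, giving
  \<open>A\<close>, and the k-algebra on the elements of \<open>A\<close> modulo the tensor
  relators, giving \<open>B\<close>.\<close>

locale blob_scalars = comm_ring_map \<phi> for \<phi> :: "'r::comm_ring_1 \<Rightarrow> 'k::field" +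
  fixes x \<gamma> \<delta> :: 'r and n :: nat
begin

abbreviation F1 :: "('r, gen list \<Rightarrow> 'r) module" where "F1 \<equiv> monoid_algebra (free_monoid (gens n))"
abbreviation R1 where "R1 \<equiv> b_relations x \<gamma> \<delta> n"
abbreviation q2 where "q2 \<equiv> x^2 + unit_inverse (x^2)"

lemma basis_F1: "w \<in> lists (gens n) \<Longrightarrow> monoid_basis w \<in> carrier F1"
  by (rule monoid_basis_closed) (simp add: free_monoid_def)

lemma monom_word_F1: "monom_word c w = c \<odot>\<^bsub>F1\<^esub> monoid_basis w"
  by (simp add: monom_word_eq monoid_algebra_simps)

sublocale F1: scalar_ring F1
  by (rule scalar_ring_monoid_algebra[OF monoid_free_monoid])

sublocale q1: quotient_by_relations F1 R1
proof
  show "R1 \<subseteq> carrier F1 \<times> carrier F1"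
    unfolding b_relations_eq
    by (auto simp: monom_word_F1 dest!: blob_rules_lists intro!: basis_F1 F1.smult_closed)
qed

abbreviation A where "A \<equiv> b_integral x \<gamma> \<delta> n"

lemma A_eq: "A = quotient_algebra F1 (relation_ideal F1 R1)"
  by (simp add: b_integral_def presented_algebra_def)

sublocale A: scalar_ring A
  unfolding A_eq by (rule q1.quotient.scalar_ring_axioms)

abbreviation F2 :: "('k, (gen list \<Rightarrow> 'r) set \<Rightarrow> 'k) module" where "F2 \<equiv> monoid_algebra A"
abbreviation R2 :: "(((gen list \<Rightarrow> 'r) set \<Rightarrow> 'k) \<times> ((gen list \<Rightarrow> 'r) set \<Rightarrow> 'k)) set" where
  "R2 \<equiv> tensor_relations \<phi> A"

sublocale F2: scalar_ring F2
  by (rule scalar_ring_monoid_algebra[OF A.monoid_axioms])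

sublocale q2: quotient_by_relations F2 R2
proof
  show "R2 \<subseteq> carrier F2 \<times> carrier F2"
    unfolding tensor_relations_def using monoid_basis_closed[of _ A] by auto
qed

abbreviation B where "B \<equiv> quotient_algebra F2 (relation_ideal F2 R2)"

definition cls :: "(gen list \<Rightarrow> 'r) \<Rightarrow> (gen list \<Rightarrow> 'r) set" where
  "cls f = relation_ideal F1 R1 +>\<^bsub>F1\<^esub> f"

abbreviation inj :: "(gen list \<Rightarrow> 'r) set \<Rightarrow> ((gen list \<Rightarrow> 'r) set \<Rightarrow> 'k) set" where
  "inj \<equiv> extend_elt \<phi> A"

lemma cls_closed [simp]: "f \<in> carrier F1 \<Longrightarrow> cls f \<in> carrier A"
  unfolding cls_def A_eq by (rule q1.proj_closed)

lemma inj_def': "inj a = relation_ideal F2 R2 +>\<^bsub>F2\<^esub> monoid_basis a"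
  by (simp add: extend_elt_def)

lemma basis_F2 [simp]: "a \<in> carrier A \<Longrightarrow> monoid_basis a \<in> carrier F2"
  by (rule monoid_basis_closed)

lemma inj_closed [simp]: "a \<in> carrier A \<Longrightarrow> inj a \<in> carrier B"
  unfolding inj_def' by (rule q2.proj_closed) simp

lemma inj_mult: "a \<in> carrier A \<Longrightarrow> b \<in> carrier A \<Longrightarrow> inj (a \<otimes>\<^bsub>A\<^esub> b) = inj a \<otimes>\<^bsub>B\<^esub> inj b"
  unfolding inj_def' by (simp add: basis_mult[OF A.monoid_axioms] flip: q2.proj_mult)

lemma inj_one: "inj \<one>\<^bsub>A\<^esub> = \<one>\<^bsub>B\<^esub>"
  unfolding inj_def' using q2.proj_one by (simp add: monoid_algebra_simps)

lemma inj_add: "a \<in> carrier A \<Longrightarrow> b \<in> carrier A \<Longrightarrow> inj (a \<oplus>\<^bsub>A\<^esub> b) = inj a \<oplus>\<^bsub>B\<^esub> inj b"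
proof -
  assume ab: "a \<in> carrier A" "b \<in> carrier A"
  then have "(monoid_basis (a \<oplus>\<^bsub>A\<^esub> b), monoid_basis a \<oplus>\<^bsub>F2\<^esub> monoid_basis b) \<in> R2"
    unfolding tensor_relations_def by blast
  from q2.proj_relation[OF this] show ?thesis
    unfolding inj_def' using ab by (simp add: q2.proj_add)
qed

lemma inj_smult: "a \<in> carrier A \<Longrightarrow> inj (c \<odot>\<^bsub>A\<^esub> a) = \<phi> c \<odot>\<^bsub>B\<^esub> inj a"
proof -
  assume a: "a \<in> carrier A"
  then have "(monoid_basis (c \<odot>\<^bsub>A\<^esub> a), \<phi> c \<odot>\<^bsub>F2\<^esub> monoid_basis a) \<in> R2"
    unfolding tensor_relations_def by blast
  from q2.proj_relation[OF this] show ?thesis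
    unfolding inj_def' using a by (simp add: q2.proj_smult)
qed

abbreviation u where "u \<equiv> b_gen \<phi> x \<gamma> \<delta> n"

lemma u_eq: "u g = inj (cls (monoid_basis [g]))"
  by (simp add: b_gen_def presented_generator_def cls_def)

lemma u_closed: "g \<in> gens n \<Longrightarrow> u g \<in> carrier B"
  unfolding u_eq by (simp add: basis_F1)

lemma cls_mult: "f \<in> carrier F1 \<Longrightarrow> g \<in> carrier F1 \<Longrightarrow> cls (f \<otimes>\<^bsub>F1\<^esub> g) = cls f \<otimes>\<^bsub>A\<^esub> cls g"
  unfolding cls_def A_eq by (rule q1.proj_mult)

lemma cls_add: "f \<in> carrier F1 \<Longrightarrow> g \<in> carrier F1 \<Longrightarrow> cls (f \<oplus>\<^bsub>F1\<^esub> g) = cls f \<oplus>\<^bsub>A\<^esub> cls g"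
  unfolding cls_def A_eq by (rule q1.proj_add)

lemma cls_smult: "f \<in> carrier F1 \<Longrightarrow> cls (c \<odot>\<^bsub>F1\<^esub> f) = c \<odot>\<^bsub>A\<^esub> cls f"
  unfolding cls_def A_eq by (rule q1.proj_smult)

lemma word_val_cls: "w \<in> lists (gens n) \<Longrightarrow> word_val B u w = inj (cls (monoid_basis w))"
proof (induction w)
  case Nil
  have "cls (monoid_basis []) = \<one>\<^bsub>A\<^esub>"
    using q1.proj_one by (simp add: cls_def A_eq monoid_algebra_simps free_monoid_def)
  then show ?case by (simp add: word_val_def inj_one)
next
  case (Cons g w)
  have "[g] \<in> carrier (free_monoid (gens n))" "w \<in> carrier (free_monoid (gens n))"
    "[g] \<otimes>\<^bsub>free_monoid (gens n)\<^esub> w = g # w"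
    using Cons.prems by (auto simp: free_monoid_def)
  then have "monoid_basis (g # w) = monoid_basis [g] \<otimes>\<^bsub>F1\<^esub> monoid_basis w"
    by (simp add: basis_mult[OF monoid_free_monoid])
  then have "inj (cls (monoid_basis (g # w))) = u g \<otimes>\<^bsub>B\<^esub> inj (cls (monoid_basis w))"
    using Cons.prems by (simp add: u_eq cls_mult inj_mult basis_F1)
  then show ?case using Cons by (simp add: word_val_def)
qed

lemma word_val_rule:
  assumes "(l, c, r) \<in> blob_rules q2 \<gamma> \<delta> n"
  shows "word_val B u l = \<phi> c \<odot>\<^bsub>B\<^esub> word_val B u r"
proof -
  note lr = blob_rules_lists[OF assms]
  have "(monom_word 1 l, monom_word c r) \<in> R1"
    unfolding b_relations_eq using assms by blast
  from q1.proj_relation[OF this] have "cls (monoid_basis l) = c \<odot>\<^bsub>A\<^esub> cls (monoid_basis r)"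
    using lr by (simp add: monom_word_F1 basis_F1 flip: cls_def cls_smult)
  then show ?thesis using lr by (simp add: word_val_cls inj_smult basis_F1)
qed

text \<open>Words span over k, phrased as an induction principle. The argument passes through both
  quotients: from words to \<open>A\<close>, then from elements of \<open>A\<close> to
  \<open>B\<close>.\<close>

lemma word_span:
  assumes X: "X \<in> carrier B"
    and words: "\<And>w. w \<in> lists (gens n) \<Longrightarrow> word_val B u w \<in> W"
    and add: "\<And>Y Z. Y \<in> W \<Longrightarrow> Z \<in> W \<Longrightarrow> Y \<oplus>\<^bsub>B\<^esub> Z \<in> W"
    and smult: "\<And>c Y. Y \<in> W \<Longrightarrow> c \<odot>\<^bsub>B\<^esub> Y \<in> W"
    and W: "W \<subseteq> carrier B"
  shows "X \<in> W"
proof -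
  have zeroB: "\<zero>\<^bsub>B\<^esub> \<in> W"
    using smult[OF words[of "[]"], of 0] W words[of "[]"] by auto
  have zF1: "\<zero>\<^bsub>F1\<^esub> \<in> carrier F1" "cls \<zero>\<^bsub>F1\<^esub> = \<zero>\<^bsub>A\<^esub>"
    using cls_smult[of "\<zero>\<^bsub>F1\<^esub>" 0] by auto
  have zA: "inj \<zero>\<^bsub>A\<^esub> = \<zero>\<^bsub>B\<^esub>"
    using inj_smult[of "\<zero>\<^bsub>A\<^esub>" 0] by (simp add: map_0)
  have 1: "f \<in> carrier F1 \<Longrightarrow> f \<in> {f \<in> carrier F1. inj (cls f) \<in> W}" for f
  proof (erule monoid_algebra_span)
    fix w assume "w \<in> carrier (free_monoid (gens n))"
    then have "w \<in> lists (gens n)" by (simp add: free_monoid_def)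
    then show "monoid_basis w \<in> {f \<in> carrier F1. inj (cls f) \<in> W}"
      using words[of w] by (simp add: word_val_cls basis_F1)
  qed (use zF1 zA zeroB add smult in \<open>auto simp: cls_add inj_add cls_smult inj_smult\<close>)
  have 2: "inj a \<in> W" if a: "a \<in> carrier A" for a
  proof -
    obtain f where "f \<in> carrier F1" "a = cls f"
      using a unfolding A_eq cls_def by (rule q1.quotientE)
    then show ?thesis using 1 by blast
  qed
  have zF2: "relation_ideal F2 R2 +>\<^bsub>F2\<^esub> \<zero>\<^bsub>F2\<^esub> = \<zero>\<^bsub>B\<^esub>"
    using q2.proj_smult[of "\<zero>\<^bsub>F2\<^esub>" 0] by simp
  have 3: "f \<in> carrier F2 \<Longrightarrow> f \<in> {f \<in> carrier F2. relation_ideal F2 R2 +>\<^bsub>F2\<^esub> f \<in> W}" for f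
    by (erule monoid_algebra_span)
      (use zF2 zeroB add smult 2 in \<open>auto simp: q2.proj_add q2.proj_smult inj_def'\<close>)
  obtain f where "f \<in> carrier F2" "X = relation_ideal F2 R2 +>\<^bsub>F2\<^esub> f"
    using X by (rule q2.quotientE)
  then show ?thesis using 3 by blast
qed

text \<open>A function on words that respects each rule in every context descends to a linear
  functional. It is extended by \<open>pairing\<close> along \<phi>, factored through the relations,
  extended linearly to the symbols on \<open>A\<close>, and factored through the tensor
  relators.\<close>

lemma word_functional:
  fixes t0 :: "gen list \<Rightarrow> 'k"
  assumes t0: "\<And>l c r v w. \<lbrakk>(l, c, r) \<in> blob_rules q2 \<gamma> \<delta> n; v \<in> lists (gens n); w \<in> lists (gens n)\<rbrakk> \<Longrightarrow>
    t0 (v @ l @ w) = \<phi> c * t0 (v @ r @ w)"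
  obtains T where "additive_map B T" "\<And>X c. X \<in> carrier B \<Longrightarrow> T (c \<odot>\<^bsub>B\<^esub> X) = c * T X"
    "\<And>w. w \<in> lists (gens n) \<Longrightarrow> T (word_val B u w) = t0 w"
proof -
  have cl: "finite (support f)" "support f \<subseteq> lists (gens n)" if "f \<in> carrier F1" for f
    using that by (auto simp: monoid_algebra_simps free_monoid_def)
  have pm: "pairing \<phi> (f \<otimes>\<^bsub>F1\<^esub> g) t = pairing \<phi> f (\<lambda>a. pairing \<phi> g (\<lambda>b. t (a @ b)))"
    if "f \<in> carrier F1" "g \<in> carrier F1" for f g and t :: "gen list \<Rightarrow> 'k"
    using pairing_mult(3)[OF cl(1)[OF that(1)] cl(1)[OF that(2)], of "free_monoid (gens n)" t]
    by (simp add: free_monoid_def)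
  let ?t1 = "\<lambda>f. pairing \<phi> f t0"
  have t1: "additive_map F1 ?t1"
    by unfold_locales (simp add: monoid_algebra_simps(4) pairing_add cl(1))
  have t1_smult: "?t1 (c \<odot>\<^bsub>F1\<^esub> f) = \<phi> c * ?t1 f" if "f \<in> carrier F1" for c f
    using that by (simp add: monoid_algebra_simps(5) pairing_smult cl(1))
  have "?t1 (f \<otimes>\<^bsub>F1\<^esub> l \<otimes>\<^bsub>F1\<^esub> g) = ?t1 (f \<otimes>\<^bsub>F1\<^esub> r \<otimes>\<^bsub>F1\<^esub> g)"
    if lr: "(l, r) \<in> R1" and fg: "f \<in> carrier F1" "g \<in> carrier F1" for l r f g
  proof -
    obtain l' c r' where l: "(l', c, r') \<in> blob_rules q2 \<gamma> \<delta> n" "l = 1 \<odot>\<^bsub>F1\<^esub> monoid_basis l'" "r = c \<odot>\<^bsub>F1\<^esub> monoid_basis r'"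
      using lr unfolding b_relations_eq monom_word_F1 by blast
    have b: "monoid_basis l' \<in> carrier F1" "monoid_basis r' \<in> carrier F1"
      using blob_rules_lists[OF l(1)] basis_F1 by auto
    have e: "pairing \<phi> (f \<otimes>\<^bsub>F1\<^esub> monoid_basis w \<otimes>\<^bsub>F1\<^esub> g) t0 = pairing \<phi> f (\<lambda>a. pairing \<phi> g (\<lambda>b. t0 (a @ w @ b)))"
      if "monoid_basis w \<in> carrier F1" for w
      using fg that by (simp add: F1.m_assoc pm pairing_basis)
    have "?t1 (f \<otimes>\<^bsub>F1\<^esub> l \<otimes>\<^bsub>F1\<^esub> g) = pairing \<phi> f (\<lambda>a. pairing \<phi> g (\<lambda>b. t0 (a @ l' @ b)))"
      using e[OF b(1)] l(2) b by simp
    also have "\<dots> = pairing \<phi> f (\<lambda>a. pairing \<phi> g (\<lambda>b. \<phi> c * t0 (a @ r' @ b)))"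
    proof (intro pairing_cong)
      fix a b assume "a \<in> support f" "b \<in> support g"
      then have "a \<in> lists (gens n)" "b \<in> lists (gens n)" using cl(2) fg by auto
      then show "t0 (a @ l' @ b) = \<phi> c * t0 (a @ r' @ b)" by (rule t0[OF l(1)])
    qed
    also have "\<dots> = \<phi> c * ?t1 (f \<otimes>\<^bsub>F1\<^esub> monoid_basis r' \<otimes>\<^bsub>F1\<^esub> g)"
      by (simp only: e[OF b(2)] pairing_fun_mult)
    also have "\<dots> = ?t1 (f \<otimes>\<^bsub>F1\<^esub> r \<otimes>\<^bsub>F1\<^esub> g)"
      using fg b by (simp add: l(3) F1.mult_smult F1.smult_mult t1_smult)
    finally show ?thesis .
  qed
  from q1.lift_additive[OF t1 this] obtain T1 where T1: "additive_map A T1" "\<And>f. f \<in> carrier F1 \<Longrightarrow> T1 (cls f) = ?t1 f"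
    unfolding A_eq cls_def by blast
  interpret T1: additive_map A T1 by (rule T1(1))
  have T1_smult: "T1 (c \<odot>\<^bsub>A\<^esub> a) = \<phi> c * T1 a" if a: "a \<in> carrier A" for c a
  proof -
    obtain f where "f \<in> carrier F1" "a = cls f"
      using a unfolding A_eq cls_def by (rule q1.quotientE)
    then show ?thesis using T1(2)[of "c \<odot>\<^bsub>F1\<^esub> f"] T1(2)[of f] by (simp add: t1_smult cls_smult)
  qed
  interpret id: comm_ring_map "\<lambda>c::'k. c" by (rule comm_ring_map_id)
  have cl2: "finite (support f)" "support f \<subseteq> carrier A" if "f \<in> carrier F2" for f
    using that by (auto simp: monoid_algebra_simps)
  let ?t2 = "\<lambda>f. pairing (\<lambda>c. c) f T1"
  have pm2: "pairing (\<lambda>c. c) (f \<otimes>\<^bsub>F2\<^esub> g) t = pairing (\<lambda>c. c) f (\<lambda>a. pairing (\<lambda>c. c) g (\<lambda>b. t (a \<otimes>\<^bsub>A\<^esub> b)))"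
    if "f \<in> carrier F2" "g \<in> carrier F2" for f g and t :: "(gen list \<Rightarrow> 'r) set \<Rightarrow> 'k"
    by (rule id.pairing_mult(3)[OF cl2(1)[OF that(1)] cl2(1)[OF that(2)]])
  have t2: "additive_map F2 ?t2"
    by unfold_locales (simp add: monoid_algebra_simps(4) id.pairing_add cl2(1))
  have t2_smult: "?t2 (c \<odot>\<^bsub>F2\<^esub> f) = c * ?t2 f" if "f \<in> carrier F2" for c f
    using that by (simp add: monoid_algebra_simps(5) id.pairing_smult cl2(1))
  \<comment> \<open>With the relator as a basis element in the middle, the functional becomes a
    double sum of values of \<open>T1\<close>, and the tensor relators reduce to semilinearity of
    \<open>T1\<close>.\<close>
  have key: "?t2 (f \<otimes>\<^bsub>F2\<^esub> monoid_basis a \<otimes>\<^bsub>F2\<^esub> g)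
      = pairing (\<lambda>c. c) f (\<lambda>v. pairing (\<lambda>c. c) g (\<lambda>w. T1 (v \<otimes>\<^bsub>A\<^esub> a \<otimes>\<^bsub>A\<^esub> w)))"
    if fg: "f \<in> carrier F2" "g \<in> carrier F2" and a: "a \<in> carrier A" for f g a
  proof -
    have "?t2 (f \<otimes>\<^bsub>F2\<^esub> monoid_basis a \<otimes>\<^bsub>F2\<^esub> g)
        = pairing (\<lambda>c. c) f (\<lambda>v. pairing (\<lambda>c. c) g (\<lambda>w. T1 (v \<otimes>\<^bsub>A\<^esub> (a \<otimes>\<^bsub>A\<^esub> w))))"
      using fg a by (simp add: F2.m_assoc pm2 id.pairing_basis)
    also have "\<dots> = pairing (\<lambda>c. c) f (\<lambda>v. pairing (\<lambda>c. c) g (\<lambda>w. T1 (v \<otimes>\<^bsub>A\<^esub> a \<otimes>\<^bsub>A\<^esub> w)))"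
    proof (intro id.pairing_cong)
      fix v w assume "v \<in> support f" "w \<in> support g"
      then have "v \<in> carrier A" "w \<in> carrier A" using cl2(2) fg by auto
      then show "T1 (v \<otimes>\<^bsub>A\<^esub> (a \<otimes>\<^bsub>A\<^esub> w)) = T1 (v \<otimes>\<^bsub>A\<^esub> a \<otimes>\<^bsub>A\<^esub> w)"
        using a by (simp add: A.m_assoc)
    qed
    finally show ?thesis .
  qed
  have "?t2 (f \<otimes>\<^bsub>F2\<^esub> l \<otimes>\<^bsub>F2\<^esub> g) = ?t2 (f \<otimes>\<^bsub>F2\<^esub> r \<otimes>\<^bsub>F2\<^esub> g)"
    if lr: "(l, r) \<in> R2" and fg: "f \<in> carrier F2" "g \<in> carrier F2" for l r f g
  proof -
    interpret t2: additive_map F2 ?t2 by (rule t2)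
    consider a b where "a \<in> carrier A" "b \<in> carrier A" "l = monoid_basis (a \<oplus>\<^bsub>A\<^esub> b)" "r = monoid_basis a \<oplus>\<^bsub>F2\<^esub> monoid_basis b"
      | c a where "a \<in> carrier A" "l = monoid_basis (c \<odot>\<^bsub>A\<^esub> a)" "r = \<phi> c \<odot>\<^bsub>F2\<^esub> monoid_basis a"
      using lr unfolding tensor_relations_def by blast
    then show ?thesis
    proof cases
      case (1 a b)
      have "?t2 (f \<otimes>\<^bsub>F2\<^esub> l \<otimes>\<^bsub>F2\<^esub> g) =
        pairing (\<lambda>c. c) f (\<lambda>v. pairing (\<lambda>c. c) g (\<lambda>w. T1 (v \<otimes>\<^bsub>A\<^esub> a \<otimes>\<^bsub>A\<^esub> w) + T1 (v \<otimes>\<^bsub>A\<^esub> b \<otimes>\<^bsub>A\<^esub> w)))"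
        unfolding 1(3) key[OF fg A.a_closed[OF 1(1,2)]]
      proof (intro id.pairing_cong)
        fix v w assume "v \<in> support f" "w \<in> support g"
        then have "v \<in> carrier A" "w \<in> carrier A" using cl2(2) fg by auto
        then show "T1 (v \<otimes>\<^bsub>A\<^esub> (a \<oplus>\<^bsub>A\<^esub> b) \<otimes>\<^bsub>A\<^esub> w) = T1 (v \<otimes>\<^bsub>A\<^esub> a \<otimes>\<^bsub>A\<^esub> w) + T1 (v \<otimes>\<^bsub>A\<^esub> b \<otimes>\<^bsub>A\<^esub> w)"
          using 1 by (simp add: A.l_distr A.r_distr T1.additive)
      qed
      also have "\<dots> = ?t2 (f \<otimes>\<^bsub>F2\<^esub> monoid_basis a \<otimes>\<^bsub>F2\<^esub> g) + ?t2 (f \<otimes>\<^bsub>F2\<^esub> monoid_basis b \<otimes>\<^bsub>F2\<^esub> g)"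
        by (simp only: id.pairing_fun_add key[OF fg 1(1)] key[OF fg 1(2)])
      also have "\<dots> = ?t2 (f \<otimes>\<^bsub>F2\<^esub> r \<otimes>\<^bsub>F2\<^esub> g)"
        using 1(1,2) fg by (simp add: 1(4) F2.l_distr F2.r_distr t2.additive)
      finally show ?thesis .
    next
      case (2 c a)
      have "?t2 (f \<otimes>\<^bsub>F2\<^esub> l \<otimes>\<^bsub>F2\<^esub> g) =
        pairing (\<lambda>c. c) f (\<lambda>v. pairing (\<lambda>c. c) g (\<lambda>w. \<phi> c * T1 (v \<otimes>\<^bsub>A\<^esub> a \<otimes>\<^bsub>A\<^esub> w)))"
        unfolding 2(2) key[OF fg A.smult_closed[OF 2(1)]]
      proof (intro id.pairing_cong)
        fix v w assume "v \<in> support f" "w \<in> support g"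
        then have "v \<in> carrier A" "w \<in> carrier A" using cl2(2) fg by auto
        then show "T1 (v \<otimes>\<^bsub>A\<^esub> (c \<odot>\<^bsub>A\<^esub> a) \<otimes>\<^bsub>A\<^esub> w) = \<phi> c * T1 (v \<otimes>\<^bsub>A\<^esub> a \<otimes>\<^bsub>A\<^esub> w)"
          using 2 by (simp add: A.mult_smult A.smult_mult T1_smult)
      qed
      also have "\<dots> = \<phi> c * ?t2 (f \<otimes>\<^bsub>F2\<^esub> monoid_basis a \<otimes>\<^bsub>F2\<^esub> g)"
        by (simp only: id.pairing_fun_mult key[OF fg 2(1)])
      also have "\<dots> = ?t2 (f \<otimes>\<^bsub>F2\<^esub> r \<otimes>\<^bsub>F2\<^esub> g)"
        using 2(1) fg by (simp add: 2(3) F2.mult_smult F2.smult_mult t2_smult)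
      finally show ?thesis .
    qed
  qed
  from q2.lift_additive[OF t2 this] obtain T where T: "additive_map B T"
      "\<And>f. f \<in> carrier F2 \<Longrightarrow> T (relation_ideal F2 R2 +>\<^bsub>F2\<^esub> f) = ?t2 f"
    by blast
  show ?thesis
  proof (rule that[OF T(1)])
    fix X c assume "X \<in> carrier B"
    then obtain f where "f \<in> carrier F2" "X = relation_ideal F2 R2 +>\<^bsub>F2\<^esub> f" by (rule q2.quotientE)
    then show "T (c \<odot>\<^bsub>B\<^esub> X) = c * T X"
      using T(2)[of "c \<odot>\<^bsub>F2\<^esub> f"] T(2)[of f] by (simp add: t2_smult q2.proj_smult)
  next
    fix w assume w: "w \<in> lists (gens n)"
    have "T (word_val B u w) = T1 (cls (monoid_basis w))"
      using w T(2)[of "monoid_basis (cls (monoid_basis w))"]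
      by (simp add: word_val_cls inj_def' basis_F1 id.pairing_basis)
    then show "T (word_val B u w) = t0 w"
      using T1(2)[OF basis_F1[OF w]] by (simp add: pairing_basis)
  qed
qed

lemma b_alg_eq: "b_alg \<phi> x \<gamma> \<delta> n = B"
  by (simp add: b_alg_def extend_scalars_def)

end

subsection \<open>Subspaces and left ideals\<close>

context scalar_ring
begin

abbreviation lspan where "lspan \<equiv> linear_span A"

definition subspace :: "'a set \<Rightarrow> bool" where
  "subspace W \<longleftrightarrow> W \<subseteq> carrier A \<and> \<zero> \<in> W \<and> (\<forall>x\<in>W. \<forall>y\<in>W. x \<oplus> y \<in> W) \<and> (\<forall>c. \<forall>x\<in>W. c \<odot> x \<in> W)"

lemma subspaceD:
  assumes "subspace W"
  shows "W \<subseteq> carrier A" "\<zero> \<in> W" "x \<in> W \<Longrightarrow> y \<in> W \<Longrightarrow> x \<oplus> y \<in> W" "x \<in> W \<Longrightarrow> c \<odot> x \<in> W"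
  using assms by (auto simp: subspace_def)

lemma subspaceI:
  assumes "W \<subseteq> carrier A" "\<zero> \<in> W" "\<And>x y. x \<in> W \<Longrightarrow> y \<in> W \<Longrightarrow> x \<oplus> y \<in> W" "\<And>c x. x \<in> W \<Longrightarrow> c \<odot> x \<in> W"
  shows "subspace W"
  using assms by (auto simp: subspace_def)

lemma neg_smult: "x \<in> carrier A \<Longrightarrow> \<ominus> x = (- 1) \<odot> x"
proof -
  assume x: "x \<in> carrier A"
  then have "(- 1) \<odot> x \<oplus> x = \<zero>" using add_smult[of x "- 1" 1] by simp
  then show ?thesis using x by (simp add: minus_equality)
qed

lemma subspace_subgroup: "subspace W \<Longrightarrow> additive_subgroup W A"
  by (intro additive_subgroupI add.subgroupI) (auto simp: subspace_def neg_smult)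

lemma finsum_in_subspace:
  assumes "subspace W" "finite S" "\<And>i. i \<in> S \<Longrightarrow> f i \<in> W"
  shows "(\<Oplus>i\<in>S. f i) \<in> W"
  using assms(2,3)
proof (induction S)
  case (insert i S)
  then have "f \<in> S \<rightarrow> carrier A" "f i \<in> carrier A" using subspaceD(1)[OF assms(1)] by auto
  then show ?case using insert subspaceD(3)[OF assms(1)] by simp
qed (use subspaceD(2)[OF assms(1)] in simp)

lemma in_spanI: "finite T \<Longrightarrow> T \<subseteq> S \<Longrightarrow> (\<Oplus>v\<in>T. c v \<odot> v) \<in> lspan S"
  unfolding linear_span_def by (rule CollectI, intro exI conjI) (rule refl, assumption+)

lemma spanE:
  assumes "x \<in> lspan S"
  obtains c T where "x = (\<Oplus>v\<in>T. c v \<odot> v)" "finite T" "T \<subseteq> S"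
  using assms unfolding linear_span_def by (elim CollectE exE conjE)

lemma span_least: "subspace W \<Longrightarrow> S \<subseteq> W \<Longrightarrow> lspan S \<subseteq> W"
proof
  fix x assume W: "subspace W" "S \<subseteq> W" and "x \<in> lspan S"
  then obtain c T where x: "x = (\<Oplus>v\<in>T. c v \<odot> v)" "finite T" "T \<subseteq> S" by (elim spanE)
  show "x \<in> W" unfolding x(1)
    by (rule finsum_in_subspace[OF W(1) x(2)]) (use W x(3) subspaceD(4)[OF W(1)] in blast)
qed

lemma span_superset: "S \<subseteq> carrier A \<Longrightarrow> S \<subseteq> lspan S"
proof
  fix x assume S: "S \<subseteq> carrier A" and x: "x \<in> S"
  then have "x \<in> carrier A" by auto
  then show "x \<in> lspan S" using in_spanI[of "{x}" S "\<lambda>_. 1"] x by simp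
qed

lemma subspace_span:
  assumes S: "S \<subseteq> carrier A"
  shows "subspace (lspan S)"
proof (rule subspaceI)
  have cl: "(\<lambda>v. c v \<odot> v) \<in> T \<rightarrow> carrier A" if "T \<subseteq> S" for c T
    using that S by auto
  show "lspan S \<subseteq> carrier A"
    by (rule subsetI, erule spanE) (simp add: cl finsum_closed)
  show "\<zero> \<in> lspan S"
    using in_spanI[of "{}" S] by simp
  fix x c assume "x \<in> lspan S"
  then obtain d T where x: "x = (\<Oplus>v\<in>T. d v \<odot> v)" "finite T" "T \<subseteq> S"
    by (rule spanE)
  have "c \<odot> x = (\<Oplus>v\<in>T. (c * d v) \<odot> v)"
    unfolding x(1) smult_finsum[OF cl[OF x(3)]]
    by (rule finsum_cong') (use x(3) S in \<open>auto simp: smult_smult\<close>)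
  then show "c \<odot> x \<in> lspan S"
    using in_spanI[OF x(2,3)] by simp
next
  have cl: "(\<lambda>v. c v \<odot> v) \<in> T \<rightarrow> carrier A" if "T \<subseteq> S" for c T
    using that S by auto
  fix x y assume xy: "x \<in> lspan S" "y \<in> lspan S"
  obtain c T where x: "x = (\<Oplus>v\<in>T. c v \<odot> v)" "finite T" "T \<subseteq> S"
    using xy(1) by (rule spanE)
  obtain d T' where y: "y = (\<Oplus>v\<in>T'. d v \<odot> v)" "finite T'" "T' \<subseteq> S"
    using xy(2) by (rule spanE)
  let ?T = "T \<union> T'"
  have pad: "(\<Oplus>v\<in>V. c v \<odot> v) = (\<Oplus>v\<in>V'. (if v \<in> V then c v else 0) \<odot> v)"
    if "finite V'" "V' \<subseteq> S" "V \<subseteq> V'" for c V V'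
    by (rule add.finprod_mono_neutral_cong_left) (use that S in auto)
  have "x = (\<Oplus>v\<in>?T. (if v \<in> T then c v else 0) \<odot> v)"
    unfolding x(1) by (rule pad) (use x y in auto)
  moreover have "y = (\<Oplus>v\<in>?T. (if v \<in> T' then d v else 0) \<odot> v)"
    unfolding y(1) by (rule pad) (use x y in auto)
  ultimately have "x \<oplus> y = (\<Oplus>v\<in>?T. (if v \<in> T then c v else 0) \<odot> v \<oplus> (if v \<in> T' then d v else 0) \<odot> v)"
    using finsum_addf[OF cl[of ?T] cl[of ?T]] x y by simp
  also have "\<dots> = (\<Oplus>v\<in>?T. ((if v \<in> T then c v else 0) + (if v \<in> T' then d v else 0)) \<odot> v)"
    by (rule finsum_cong') (use x(3) y(3) S in \<open>auto simp: add_smult\<close>)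
  finally have "x \<oplus> y = (\<Oplus>v\<in>?T. ((if v \<in> T then c v else 0) + (if v \<in> T' then d v else 0)) \<odot> v)" .
  then show "x \<oplus> y \<in> lspan S"
    using in_spanI[of ?T S] x y by simp
qed

lemma span_mono: "S \<subseteq> T \<Longrightarrow> T \<subseteq> carrier A \<Longrightarrow> lspan S \<subseteq> lspan T"
  using span_least[OF subspace_span] span_superset by blast

lemma set_add_iff: "x \<in> S <+>\<^bsub>A\<^esub> T \<longleftrightarrow> (\<exists>s\<in>S. \<exists>t\<in>T. x = s \<oplus> t)"
  by (auto simp: set_add_def')

lemma subspace_set_add:
  assumes S: "subspace S" and T: "subspace T"
  shows "subspace (S <+>\<^bsub>A\<^esub> T)"
proof (rule subspaceI)
  note s = subspaceD[OF S] and t = subspaceD[OF T]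
  show "S <+>\<^bsub>A\<^esub> T \<subseteq> carrier A"
  proof
    fix x assume "x \<in> S <+>\<^bsub>A\<^esub> T"
    then obtain a b where "a \<in> S" "b \<in> T" "x = a \<oplus> b" unfolding set_add_iff by blast
    then show "x \<in> carrier A" using s(1) t(1) by auto
  qed
  show "\<zero> \<in> S <+>\<^bsub>A\<^esub> T" using s(2) t(2) unfolding set_add_iff by (intro bexI[of _ \<zero>]) simp_all
  fix x y assume "x \<in> S <+>\<^bsub>A\<^esub> T" "y \<in> S <+>\<^bsub>A\<^esub> T"
  then obtain a b a' b' where x: "a \<in> S" "b \<in> T" "x = a \<oplus> b" and y: "a' \<in> S" "b' \<in> T" "y = a' \<oplus> b'"
    unfolding set_add_iff by blast
  have "a \<in> carrier A" "b \<in> carrier A" "a' \<in> carrier A" "b' \<in> carrier A" using x y s(1) t(1) by auto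
  then have "x \<oplus> y = (a \<oplus> a') \<oplus> (b \<oplus> b')" using x y by (simp add: a_assoc a_lcomm)
  then show "x \<oplus> y \<in> S <+>\<^bsub>A\<^esub> T" unfolding set_add_iff using s(3) t(3) x y by blast
next
  note s = subspaceD[OF S] and t = subspaceD[OF T]
  fix x c assume "x \<in> S <+>\<^bsub>A\<^esub> T"
  then obtain a b where x: "a \<in> S" "b \<in> T" "x = a \<oplus> b"
    unfolding set_add_iff by blast
  then have "a \<in> carrier A" "b \<in> carrier A" using s(1) t(1) by auto
  then have "c \<odot> x = c \<odot> a \<oplus> c \<odot> b" using x(3) by (simp add: smult_add)
  then show "c \<odot> x \<in> S <+>\<^bsub>A\<^esub> T" unfolding set_add_iff using s(4) t(4) x by blast
qed

lemma set_add_superset: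
  assumes "subspace S" "subspace T"
  shows "S \<subseteq> S <+>\<^bsub>A\<^esub> T" "T \<subseteq> S <+>\<^bsub>A\<^esub> T"
proof -
  note s = subspaceD[OF assms(1)] and t = subspaceD[OF assms(2)]
  show "S \<subseteq> S <+>\<^bsub>A\<^esub> T"
  proof
    fix x assume "x \<in> S"
    then have "x = x \<oplus> \<zero>" using s(1) by auto
    then show "x \<in> S <+>\<^bsub>A\<^esub> T" unfolding set_add_iff using \<open>x \<in> S\<close> t(2) by blast
  qed
  show "T \<subseteq> S <+>\<^bsub>A\<^esub> T"
  proof
    fix x assume "x \<in> T"
    then have "x = \<zero> \<oplus> x" using t(1) by auto
    then show "x \<in> S <+>\<^bsub>A\<^esub> T" unfolding set_add_iff using \<open>x \<in> T\<close> s(2) by blast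
  qed
qed

lemma set_add_least: "subspace W \<Longrightarrow> S \<subseteq> W \<Longrightarrow> T \<subseteq> W \<Longrightarrow> S <+>\<^bsub>A\<^esub> T \<subseteq> W"
proof
  fix x assume W: "subspace W" "S \<subseteq> W" "T \<subseteq> W" and "x \<in> S <+>\<^bsub>A\<^esub> T"
  then obtain a b where "a \<in> S" "b \<in> T" "x = a \<oplus> b" unfolding set_add_iff by blast
  then show "x \<in> W" using W subspaceD(3)[OF W(1)] by auto
qed

lemma span_Un: "S \<subseteq> carrier A \<Longrightarrow> T \<subseteq> carrier A \<Longrightarrow> lspan (S \<union> T) \<subseteq> lspan S <+>\<^bsub>A\<^esub> lspan T"
  using span_superset[of S] span_superset[of T] set_add_superset[OF subspace_span subspace_span, of S T]
  by (intro span_least subspace_set_add subspace_span) blast+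

lemma subspace_zero: "subspace {\<zero>}"
  by (rule subspaceI) auto

lemma set_add_zero: "S \<subseteq> carrier A \<Longrightarrow> S <+>\<^bsub>A\<^esub> {\<zero>} = S"
proof -
  assume S: "S \<subseteq> carrier A"
  have "x \<in> S <+>\<^bsub>A\<^esub> {\<zero>} \<longleftrightarrow> x \<in> S" for x
    unfolding set_add_iff using S by (auto simp: subset_iff)
  then show ?thesis by blast
qed

definition left_ideal :: "'a set \<Rightarrow> bool" where
  "left_ideal I \<longleftrightarrow> subspace I \<and> (\<forall>a\<in>carrier A. \<forall>x\<in>I. a \<otimes> x \<in> I)"

lemma left_genideal_least: "left_ideal I \<Longrightarrow> S \<subseteq> I \<Longrightarrow> left_genideal A S \<subseteq> I"
  unfolding left_genideal_def left_ideal_def by (rule Inter_lower) (simp add: subspace_subgroup)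

lemma left_genideal_superset: "S \<subseteq> left_genideal A S"
  unfolding left_genideal_def by (rule Inter_greatest) simp

text \<open>The generated left ideal is an intersection of additive subgroups; closure under scalars
  comes from left multiplication by c times the unit.\<close>

lemma left_ideal_left_genideal:
  assumes "S \<subseteq> carrier A"
  shows "left_ideal (left_genideal A S)"
proof -
  have c: "left_ideal (carrier A)" unfolding left_ideal_def by (auto intro: subspaceI)
  have m: "a \<otimes> x \<in> left_genideal A S" if "a \<in> carrier A" "x \<in> left_genideal A S" for a x
    unfolding left_genideal_def
  proof (rule InterI)
    fix I assume I: "I \<in> {I. additive_subgroup I A \<and> (\<forall>a\<in>carrier A. \<forall>x\<in>I. a \<otimes> x \<in> I) \<and> S \<subseteq> I}"
    then have "x \<in> I" using that(2) unfolding left_genideal_def by (rule InterD[rotated])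
    then show "a \<otimes> x \<in> I" using I that(1) by blast
  qed
  have sub: "left_genideal A S \<subseteq> carrier A" using left_genideal_least[OF c assms] .
  have "subspace (left_genideal A S)"
  proof (rule subspaceI[OF sub])
    show "\<zero> \<in> left_genideal A S"
      unfolding left_genideal_def by (rule InterI) (auto intro: additive_subgroup.zero_closed)
    show "x \<oplus> y \<in> left_genideal A S" if xy: "x \<in> left_genideal A S" "y \<in> left_genideal A S" for x y
      unfolding left_genideal_def
    proof (rule InterI)
      fix I assume I: "I \<in> {I. additive_subgroup I A \<and> (\<forall>a\<in>carrier A. \<forall>x\<in>I. a \<otimes> x \<in> I) \<and> S \<subseteq> I}"
      then have "x \<in> I" "y \<in> I" using xy unfolding left_genideal_def by (meson InterD)+
      then show "x \<oplus> y \<in> I" using I additive_subgroup.a_closed[of I A x y] by simp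
    qed
    show "c \<odot> x \<in> left_genideal A S" if x: "x \<in> left_genideal A S" for c x
    proof -
      have "x \<in> carrier A" using x sub by blast
      then show ?thesis using m[OF smult_closed[OF one_closed] x, of c] smult_eq_mult[of x c] by simp
    qed
  qed
  then show ?thesis using m by (simp add: left_ideal_def)
qed

lemma ideal_subspace:
  assumes "ideal I A"
  shows "subspace I" "left_ideal I"
proof -
  interpret ideal I A by fact
  have "c \<odot> x \<in> I" if "x \<in> I" for c x
    using smult_eq_mult[of x c] I_l_closed[OF that, of "c \<odot> \<one>"] Icarr[OF that] by simp
  then show "subspace I" by (intro subspaceI) (auto simp: Icarr)
  then show "left_ideal I" using I_l_closed by (simp add: left_ideal_def)
qed

lemma subspace_idealI:
  assumes "subspace I" "\<And>a x. a \<in> carrier A \<Longrightarrow> x \<in> I \<Longrightarrow> a \<otimes> x \<in> I"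
    "\<And>a x. a \<in> carrier A \<Longrightarrow> x \<in> I \<Longrightarrow> x \<otimes> a \<in> I"
  shows "ideal I A"
  using subspace_subgroup[OF assms(1)] assms(2,3)
  by (intro idealI ring_axioms) (auto simp: additive_subgroup.a_subgroup)

lemma left_ideal_add: "left_ideal I \<Longrightarrow> left_ideal J \<Longrightarrow> left_ideal (I <+>\<^bsub>A\<^esub> J)"
proof -
  assume I: "left_ideal I" and J: "left_ideal J"
  have "a \<otimes> x \<in> I <+>\<^bsub>A\<^esub> J" if a: "a \<in> carrier A" and xIJ: "x \<in> I <+>\<^bsub>A\<^esub> J" for a x
  proof -
    obtain y z where x: "y \<in> I" "z \<in> J" "x = y \<oplus> z" using xIJ unfolding set_add_iff by blast
    then have "y \<in> carrier A" "z \<in> carrier A" using I J subspaceD(1) unfolding left_ideal_def by blast+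
    then have "a \<otimes> x = a \<otimes> y \<oplus> a \<otimes> z" using a x by (simp add: r_distr)
    then show ?thesis unfolding set_add_iff using I J a x unfolding left_ideal_def by blast
  qed
  then show ?thesis using I J subspace_set_add unfolding left_ideal_def by blast
qed

text \<open>Independence modulo J is certified by a functional for each vector that is 1 there and
  vanishes on the other vectors and on J.\<close>

lemma independent_modI:
  assumes S: "S \<subseteq> carrier A"
    and T: "\<And>v. v \<in> S \<Longrightarrow> \<exists>t. additive_map A t \<and> (\<forall>x\<in>carrier A. \<forall>c. t (c \<odot> x) = c * t x) \<and>
      t v = (1::'k) \<and> (\<forall>w\<in>S. w \<noteq> v \<longrightarrow> t w = 0) \<and> (\<forall>w\<in>J. t w = 0)"
  shows "independent_mod A S J"
  unfolding independent_mod_def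
proof (intro allI impI ballI, elim conjE)
  fix V c v assume V: "finite V" "V \<subseteq> S" "(\<Oplus>v\<in>V. c v \<odot> v) \<in> J" and v: "v \<in> V"
  obtain t where t: "additive_map A t" "\<forall>x\<in>carrier A. \<forall>c. t (c \<odot> x) = c * t x" "t v = 1"
    "\<forall>w\<in>S. w \<noteq> v \<longrightarrow> t w = 0" "\<forall>w\<in>J. t w = 0"
    using T V v by blast
  interpret t: additive_map A t by (rule t(1))
  have "t (\<Oplus>v\<in>V. c v \<odot> v) = (\<Sum>w\<in>V. c w * t w)"
    using V(1,2)
  proof (induction V)
    case (insert w V)
    then have "(\<lambda>v. c v \<odot> v) \<in> V \<rightarrow> carrier A" "w \<in> carrier A" using S by auto
    then show ?case using insert t(2) by (simp add: t.additive)
  qed simp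
  also have "\<dots> = (\<Sum>w\<in>V. if w = v then c v else 0)"
    by (rule sum.cong) (use V t in auto)
  also have "\<dots> = c v" using V v by simp
  finally show "c v = 0" using t(5) V by simp
qed

end

lemma (in additive_map) additive_finsum:
  "finite S \<Longrightarrow> f \<in> S \<rightarrow> carrier A \<Longrightarrow> t (\<Oplus>i\<in>S. f i) = (\<Sum>i\<in>S. t (f i))"
  by (induction S rule: finite_induct) (auto simp: additive Pi_def)

subsection \<open>Spanning sets\<close>

lemma (in blob_rewriting) eqv_rule:
  assumes "(l, c, r) \<in> blob_rules q2 \<gamma> \<delta> N"
  shows "eqv c l r"
  using assms eqv_UeU unfolding blob_rules_def
  by (auto intro: eqv_UU eqv_UUU eqv_comm eqv_ee eqv_Ue)

lemma blob_rewriting_of_rules: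
  assumes "\<And>v. eqv 1 v v" "\<And>a b v w x. eqv a v w \<Longrightarrow> eqv b w x \<Longrightarrow> eqv (a * b) v x"
    "\<And>v w. eqv 1 v w \<Longrightarrow> eqv 1 w v" "\<And>a v w x y. eqv a v w \<Longrightarrow> eqv a (x @ v @ y) (x @ w @ y)"
    and rule: "\<And>l c r. (l, c, r) \<in> blob_rules q2 \<gamma> \<delta> N \<Longrightarrow> eqv c l r"
  shows "blob_rewriting N eqv q2 \<gamma> \<delta>"
  by unfold_locales (rule assms(1), erule (1) assms(2), erule assms(3), erule assms(4),
    (rule rule, simp add: blob_rules_def, blast?)+)

lemma blob_rules_intros:
  "1 \<le> i \<Longrightarrow> i < n \<Longrightarrow> ([U i, U i], q2, [U i]) \<in> blob_rules q2 \<gamma> \<delta> n"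
  "\<lbrakk>1 \<le> i; i < n; 1 \<le> j; j < n; j = i + 1 \<or> i = j + 1\<rbrakk> \<Longrightarrow> ([U i, U j, U i], 1, [U i]) \<in> blob_rules q2 \<gamma> \<delta> n"
  "\<lbrakk>1 \<le> i; i < n; 1 \<le> j; j < n; j \<noteq> i + 1; i \<noteq> j + 1\<rbrakk> \<Longrightarrow> ([U i, U j], 1, [U j, U i]) \<in> blob_rules q2 \<gamma> \<delta> n"
  "1 < n \<Longrightarrow> ([U 1, Gen_e, U 1], \<gamma>, [U 1]) \<in> blob_rules q2 \<gamma> \<delta> n"
  "([Gen_e, Gen_e], \<delta>, [Gen_e]) \<in> blob_rules q2 \<gamma> \<delta> n"
  "1 \<le> i \<Longrightarrow> i < n \<Longrightarrow> i \<noteq> 1 \<Longrightarrow> ([U i, Gen_e], 1, [Gen_e, U i]) \<in> blob_rules q2 \<gamma> \<delta> n"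
  by (simp_all add: blob_rules_def)

lemma blob_rules_cases [consumes 1]:
  assumes "(l, c, r) \<in> blob_rules q2 \<gamma> \<delta> n"
  obtains i where "l = [U i, U i]" "c = q2" "r = [U i]" "1 \<le> i" "i < n"
  | i j where "l = [U i, U j, U i]" "c = 1" "r = [U i]" "1 \<le> i" "i < n" "1 \<le> j" "j < n" "j = i + 1 \<or> i = j + 1"
  | i j where "l = [U i, U j]" "c = 1" "r = [U j, U i]" "1 \<le> i" "i < n" "1 \<le> j" "j < n" "j \<noteq> i + 1" "i \<noteq> j + 1"
  | "l = [U 1, Gen_e, U 1]" "c = \<gamma>" "r = [U 1]" "1 < n"
  | "l = [Gen_e, Gen_e]" "c = \<delta>" "r = [Gen_e]"
  | i where "l = [U i, Gen_e]" "c = 1" "r = [Gen_e, U i]" "1 \<le> i" "i < n" "i \<noteq> 1"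
  using assms unfolding blob_rules_def by (elim UnE CollectE exE conjE insertE emptyE) simp_all

text \<open>The relations are symmetric under reversal. The exchange of U_i and e returns with its
  sides swapped, which is harmless as its scalar is 1.\<close>

lemma blob_rules_rev:
  assumes "(l, c, r) \<in> blob_rules q2 \<gamma> \<delta> n"
  shows "(rev l, c, rev r) \<in> blob_rules q2 \<gamma> \<delta> n \<or> c = 1 \<and> (rev r, 1, rev l) \<in> blob_rules q2 \<gamma> \<delta> n"
  using assms
proof (cases rule: blob_rules_cases)
  case (1 i)
  then show ?thesis by (auto intro: blob_rules_intros)
next
  case (2 i j)
  then show ?thesis by (auto intro: blob_rules_intros)
next
  case (3 i j)
  then show ?thesis using blob_rules_intros(3)[of j n i q2 \<gamma> \<delta>] by (intro disjI1) simp
next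
  case 4
  then show ?thesis using blob_rules_intros(4)[of n \<gamma> q2 \<delta>] by (intro disjI1) simp
next
  case 5
  then show ?thesis using blob_rules_intros(5)[of \<delta> q2 \<gamma> n] by (intro disjI1) simp
next
  case (6 i)
  then show ?thesis using blob_rules_intros(6)[of i n q2 \<gamma> \<delta>] by (intro disjI2) simp
qed

context blob_rewriting
begin

text \<open>A turn at i equals one at b conjugated by strings; this follows by repeatedly inserting
  U_i = U_i U_(i-1) U_i.\<close>

lemma U_conj:
  assumes "1 \<le> b" "b \<le> i" "i < N"
  shows "[U i] \<approx> dn i b @ rev (dn i (Suc b))"
  using assms(2,3)
proof (induction i rule: dec_induct)
  case base
  then show ?case by (simp add: eqv_refl)
next
  case (step i)
  have "[U (Suc i)] \<approx> [U (Suc i), U i, U (Suc i)]"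
    using eqv_sym[OF eqv_UUU[of "Suc i" i]] step assms(1) by simp
  also have "\<dots> \<approx> [U (Suc i)] @ (dn i b @ rev (dn i (Suc b))) @ [U (Suc i)]"
    using eqv_ctx[OF step.IH, of "[U (Suc i)]" "[U (Suc i)]"] step by simp
  finally show ?case
    using step assms(1) dn_Cons[of b "Suc i"] dn_Cons[of "Suc b" "Suc i"] by simp
qed

text \<open>A turn among the through lines is moved to the first two of them, where it becomes one
  more cup. The product then factors through the unblobbed word with two through lines fewer, whose
  weight is 2 - |m| <= 0.\<close>

lemma turn_lower:
  assumes m: "m \<in> weights N" and i: "int N - \<bar>m\<bar> + 1 \<le> int i" "i < N"
  shows "2 - \<bar>m\<bar> \<in> weights N \<and> \<bar>2 - \<bar>m\<bar>\<bar> < \<bar>m\<bar> \<and> (\<exists>x y. set x \<subseteq> gens N \<and> set y \<subseteq> gens N \<and>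
    [U i] @ F_word N m \<approx> x @ F_word N (2 - \<bar>m\<bar>) @ y)"
proof -
  obtain c where c: "N = nat \<bar>m\<bar> + 2 * c" using m by (rule weightsE)
  have m2: "\<bar>m\<bar> \<ge> 2" using i by linarith
  have ic: "2 * c + 1 \<le> i" using i c by linarith
  obtain R where R: "F_word N m = cups c @ R" "set R \<subseteq> gens N"
  proof -
    have "F_word N m = cups c @ (if m > 0 then [Gen_e] @ evens c @ cups c else [])"
      using c by (auto simp: F_word_pos F_word_neg blobbed_cups_def)
    then show ?thesis using that set_F_word[OF m] i by fastforce
  qed
  have F': "F_word N (2 - \<bar>m\<bar>) = cups (Suc c)"
  proof -
    have "(N - nat (- (2 - \<bar>m\<bar>))) div 2 = Suc c" using c m2 by linarith
    then show ?thesis using m2 by (simp add: F_word_neg)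
  qed
  let ?d = "rev (dn i (2 * c + 2))"
  have "[U i] @ F_word N m \<approx> (dn i (2 * c + 1) @ ?d) @ cups c @ R"
    using eqv_post[OF U_conj[of "2 * c + 1" i], of "cups c @ R"] ic i R by simp
  also have "\<dots> \<approx> dn i (2 * c + 1) @ (cups c @ ?d) @ R"
    using eqv_ctx[OF word_comm[of ?d "cups c"], of "dn i (2 * c + 1)" R] ic i by fastforce
  also have "\<dots> = dn i (2 * c + 2) @ ([U (2 * c + 1)] @ cups c) @ ?d @ R"
    using dn_snoc[of "2 * c + 1" i] ic by simp
  also have "\<dots> \<approx> dn i (2 * c + 2) @ cups (Suc c) @ ?d @ R"
    using eqv_ctx[OF cups_Suc'[of c], of "dn i (2 * c + 2)" "?d @ R"] ic i by simp
  finally have "[U i] @ F_word N m \<approx> dn i (2 * c + 2) @ F_word N (2 - \<bar>m\<bar>) @ (?d @ R)"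
    using F' by simp
  moreover have "set (dn i (2 * c + 2)) \<subseteq> gens N" "set (?d @ R) \<subseteq> gens N"
    using R(2) i by auto
  moreover have "2 - \<bar>m\<bar> \<in> weights N"
  proof -
    have "even (m - int N)" "\<bar>m\<bar> \<le> int N" using m by (auto simp: weights_def)
    then have "even (2 - \<bar>m\<bar> - int N)" by (cases "m \<ge> 0") auto
    moreover have "\<bar>2 - \<bar>m\<bar>\<bar> \<le> int N" using m2 \<open>\<bar>m\<bar> \<le> int N\<close> by linarith
    ultimately show ?thesis by (simp add: weights_def)
  qed
  ultimately show ?thesis using m2 by (intro conjI exI) auto
qed

lemma rev_F_word:
  assumes "m \<in> weights N"
  shows "rev (F_word N m) \<approx> F_word N m"
proof -
  obtain c where c: "N = nat \<bar>m\<bar> + 2 * c" using assms by (rule weightsE)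
  then show ?thesis
    using rev_blobbed_cups[of c] cups_rev[of c] by (cases "m > 0") (auto simp: F_word_pos F_word_neg)
qed

end

section \<open>An algebra known through its words and word functionals\<close>

lemma rev_lists [simp]: "rev w \<in> lists A \<longleftrightarrow> w \<in> lists A"
  by (simp add: in_lists_conv_set)

text \<open>The tensor construction enters only through these facts: words satisfy the rules and
  span, and any function on words compatible with the rules is realised by a linear
  functional.\<close>

locale blob_algebra = scalar_ring B for B :: "('k::field, 'a) module" (structure) +
  fixes u :: "gen \<Rightarrow> 'a" and n :: nat and q2 \<gamma> \<delta> :: 'k
  assumes n: "1 \<le> n"
    and u_closed: "g \<in> gens n \<Longrightarrow> u g \<in> carrier B"
    and word_rule: "(l, c, r) \<in> blob_rules q2 \<gamma> \<delta> n \<Longrightarrow> word_val B u l = c \<odot> word_val B u r"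
    and word_span: "\<lbrakk>X \<in> carrier B; \<And>w. w \<in> lists (gens n) \<Longrightarrow> word_val B u w \<in> W;
      \<And>Y Z. Y \<in> W \<Longrightarrow> Z \<in> W \<Longrightarrow> Y \<oplus> Z \<in> W; \<And>c Y. Y \<in> W \<Longrightarrow> c \<odot> Y \<in> W; W \<subseteq> carrier B\<rbrakk> \<Longrightarrow> X \<in> W"
    and word_functional: "(\<And>l c r v w. \<lbrakk>(l, c, r) \<in> blob_rules q2 \<gamma> \<delta> n; v \<in> lists (gens n); w \<in> lists (gens n)\<rbrakk> \<Longrightarrow>
      t0 (v @ l @ w) = c * t0 (v @ r @ w)) \<Longrightarrow>
      \<exists>T. additive_map B T \<and> (\<forall>X\<in>carrier B. \<forall>c. T (c \<odot> X) = c * T X) \<and>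
        (\<forall>w\<in>lists (gens n). T (word_val B u w) = (t0 w :: 'k))"
begin

abbreviation val where "val \<equiv> word_val B u"

lemma val_closed [simp]: "w \<in> lists (gens n) \<Longrightarrow> val w \<in> carrier B"
  by (induction w) (auto simp: word_val_def u_closed)

lemma val_append: "v \<in> lists (gens n) \<Longrightarrow> w \<in> lists (gens n) \<Longrightarrow> val (v @ w) = val v \<otimes> val w"
proof (induction v)
  case Nil
  then show ?case using val_closed by (simp add: word_val_def)
next
  case (Cons g v)
  then have "val ((g # v) @ w) = u g \<otimes> (val v \<otimes> val w)" by (simp add: word_val_def)
  also have "\<dots> = (u g \<otimes> val v) \<otimes> val w" using Cons.prems by (simp add: m_assoc u_closed)
  finally show ?case by (simp add: word_val_def)
qed

lemma val_single: "g \<in> gens n \<Longrightarrow> val [g] = u g"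
  by (simp add: word_val_def u_closed)

lemma val_Nil: "val [] = \<one>"
  by (simp add: word_val_def)

text \<open>
  Letters outside \<open>gens n\<close> are read as \<open>\<one>\<close>, so that the congruence below lives on all words.
  It is closed under reversal by definition, before the anti-automorphism is available.
\<close>

definition keep :: "gen list \<Rightarrow> gen list" where
  "keep w = filter (\<lambda>g. g \<in> gens n) w"

lemma keep_lists [simp]: "keep w \<in> lists (gens n)"
  by (auto simp: keep_def)

lemma keep_id: "w \<in> lists (gens n) \<Longrightarrow> keep w = w"
  by (auto simp: keep_def filter_id_conv)

lemma keep_append: "keep (v @ w) = keep v @ keep w"
  and keep_rev: "keep (rev w) = rev (keep w)"
  by (simp_all add: keep_def rev_filter)

definition eqv :: "'k \<Rightarrow> gen list \<Rightarrow> gen list \<Rightarrow> bool" where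
  "eqv c v w \<longleftrightarrow> val (keep v) = c \<odot> val (keep w) \<and> val (keep (rev v)) = c \<odot> val (keep (rev w))"

lemma eqvD:
  assumes "eqv c v w" "v \<in> lists (gens n)" "w \<in> lists (gens n)"
  shows "val v = c \<odot> val w" "val (rev v) = c \<odot> val (rev w)"
  using assms by (simp_all add: eqv_def keep_id)

lemma val_ctx:
  assumes "val v = c \<odot> val w" "v \<in> lists (gens n)" "w \<in> lists (gens n)" "x \<in> lists (gens n)" "y \<in> lists (gens n)"
  shows "val (x @ v @ y) = c \<odot> val (x @ w @ y)"
  using assms by (simp add: val_append smult_mult mult_smult)

lemma eqv_rules: "(l, c, r) \<in> blob_rules q2 \<gamma> \<delta> n \<Longrightarrow> eqv c l r"
proof -
  assume r: "(l, c, r) \<in> blob_rules q2 \<gamma> \<delta> n"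
  have lr: "l \<in> lists (gens n)" "r \<in> lists (gens n)" using blob_rules_lists[OF r] by auto
  from blob_rules_rev[OF r] have "val (rev l) = c \<odot> val (rev r)"
  proof
    assume "c = 1 \<and> (rev r, 1, rev l) \<in> blob_rules q2 \<gamma> \<delta> n"
    then show ?thesis using word_rule[of "rev r" 1 "rev l"] lr by simp
  qed (rule word_rule)
  then show ?thesis using word_rule[OF r] lr by (simp add: eqv_def keep_id)
qed

sublocale rw: blob_rewriting n eqv q2 \<gamma> \<delta>
proof (rule blob_rewriting_of_rules)
  fix v w x y a b
  show "eqv 1 v v" by (simp add: eqv_def)
  show "eqv a v w \<Longrightarrow> eqv b w x \<Longrightarrow> eqv (a * b) v x"
    by (simp add: eqv_def smult_smult)
  show "eqv 1 v w \<Longrightarrow> eqv 1 w v" by (simp add: eqv_def)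
  show "eqv a v w \<Longrightarrow> eqv a (x @ v @ y) (x @ w @ y)"
    using val_ctx[of "keep v" a "keep w" "keep x" "keep y"]
      val_ctx[of "keep (rev v)" a "keep (rev w)" "keep (rev y)" "keep (rev x)"]
    by (simp add: eqv_def keep_append)
qed (rule eqv_rules)

section \<open>Coefficient functionals of diagrams\<close>

sublocale D: blob_params q2 \<gamma> \<delta> .

definition coord :: "(bool \<times> nat) state \<Rightarrow> gen list \<Rightarrow> 'k" where
  "coord s w = (if snd (D.word_act True w (1, vac)) = s then fst (D.word_act True w (1, vac)) else 0)"

definition T :: "(bool \<times> nat) state \<Rightarrow> 'a \<Rightarrow> 'k" where
  "T s = (SOME t. additive_map B t \<and> (\<forall>X\<in>carrier B. \<forall>c. t (c \<odot> X) = c * t X) \<and>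
    (\<forall>w\<in>lists (gens n). t (val w) = coord s w))"

text \<open>Words related by a rule act on the identity diagram with proportional results, so the
  coefficient of s is compatible with the rules in any context.\<close>

lemma T: "additive_map B (T s)" "X \<in> carrier B \<Longrightarrow> T s (c \<odot> X) = c * T s X"
  "w \<in> lists (gens n) \<Longrightarrow> T s (val w) = coord s w"
proof -
  interpret dr: blob_rewriting n "D.diagram_eqv True" q2 \<gamma> \<delta> by (rule D.blob_rewriting_diagram)
  have "\<exists>t. additive_map B t \<and> (\<forall>X\<in>carrier B. \<forall>c. t (c \<odot> X) = c * t X) \<and>
    (\<forall>w\<in>lists (gens n). t (val w) = coord s w)"
  proof (rule word_functional)
    fix l c r v w assume "(l, c, r) \<in> blob_rules q2 \<gamma> \<delta> n"
    then have "D.diagram_eqv True c (v @ l @ w) (v @ r @ w)"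
      using dr.eqv_ctx[OF dr.eqv_rule] by blast
    from this[unfolded D.diagram_eqv_def, rule_format, of "(1, vac)"]
    have "D.word_act True (v @ l @ w) (1, vac) = D.scale c (D.word_act True (v @ r @ w) (1, vac))"
      using perfect_vac by (simp del: D.word_act_append)
    then show "coord s (v @ l @ w) = c * coord s (v @ r @ w)"
      by (simp add: coord_def D.scale_def del: D.word_act_append)
  qed
  from someI_ex[OF this] show "additive_map B (T s)" "X \<in> carrier B \<Longrightarrow> T s (c \<odot> X) = c * T s X"
    "w \<in> lists (gens n) \<Longrightarrow> T s (val w) = coord s w"
    unfolding T_def by blast+
qed

text \<open>Equal values have equal coefficients at s; the coefficient 1 is nonzero and therefore
  determines the diagram as well.\<close>

lemma state_eq:
  assumes "val v = val w" "v \<in> lists (gens n)" "w \<in> lists (gens n)" "D.word_act True w (1, vac) = (1, s)"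
  shows "D.word_act True v (1, vac) = (1, s)"
proof -
  have "coord s v = coord s w" using T(3)[OF assms(2)] T(3)[OF assms(3)] assms(1) by metis
  then have "coord s v = 1" using assms(4) by (simp add: coord_def)
  then show ?thesis by (cases "D.word_act True v (1, vac)") (auto simp: coord_def split: if_splits)
qed

section \<open>Spanning by the products built from pairs of walks\<close>

abbreviation F where "F m \<equiv> F_word n m"

lemma lists_level_gens: "set w \<subseteq> level_gens n \<Longrightarrow> w \<in> lists (gens n)"
  using level_gens_subset[of n] by auto

lemma walk_word_lists: "p \<in> walks n m \<Longrightarrow> walk_word p \<in> lists (gens n)"
  using lists_level_gens set_walk_word by blast

lemma F_lists: "m \<in> weights n \<Longrightarrow> F m \<in> lists (gens n)"
  using set_F_word n by blast

text \<open>One concrete choice of the factor words. It is made up to \<open>eqv\<close>, so that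
  the mirrored equation holds too, before an anti-automorphism exists.\<close>

definition cw :: "int \<Rightarrow> int list \<Rightarrow> gen list" where
  "cw m p = (SOME a. a \<in> lists (gens n) \<and> eqv 1 (walk_word p) (a @ F m))"

lemma cw:
  assumes "p \<in> walks n m"
  shows "cw m p \<in> lists (gens n)" "eqv 1 (walk_word p) (cw m p @ F m)"
proof -
  have "\<exists>a. a \<in> lists (gens n) \<and> eqv 1 (walk_word p) (a @ F m)"
    using rw.walk_word_factor[OF assms order_refl] lists_level_gens by blast
  from someI_ex[OF this] show "cw m p \<in> lists (gens n)" "eqv 1 (walk_word p) (cw m p @ F m)"
    unfolding cw_def by blast+
qed

definition sqw :: "int \<Rightarrow> int list \<Rightarrow> int list \<Rightarrow> gen list" where
  "sqw m p p' = cw m p @ F m @ rev (cw m p')"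

lemma sqw_lists [simp]: "p \<in> walks n m \<Longrightarrow> p' \<in> walks n m \<Longrightarrow> sqw m p p' \<in> lists (gens n)"
  using cw(1)[of p m] cw(1)[of p' m] F_lists[OF walks_weights[of p n m]] by (simp add: sqw_def)

definition sq :: "int \<Rightarrow> 'a set" where
  "sq m = {val (sqw m p p') | p p'. p \<in> walks n m \<and> p' \<in> walks n m}"

lemma sq_closed: "sq m \<subseteq> carrier B"
  unfolding sq_def using sqw_lists val_closed by blast

lemma rev_F: "m \<in> weights n \<Longrightarrow> val (rev (F m)) = val (F m)"
  using eqvD(1)[OF rw.rev_F_word, of m] F_lists[of m] by simp

definition prec :: "int \<Rightarrow> int \<Rightarrow> bool" where
  "prec m' m \<longleftrightarrow> \<bar>m'\<bar> < \<bar>m\<bar> \<or> m < 0 \<and> m' = - m"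

lemma prec_trans: "prec a b \<Longrightarrow> prec b c \<Longrightarrow> prec a c"
  unfolding prec_def by linarith

text \<open>The reduction theorem in its algebraic form: each failure to reach a walk is now a
  two-sided or left factorisation through an F word of smaller weight.\<close>

lemma red_left:
  assumes m: "m \<in> weights n" and x: "x \<in> lists (gens n)"
  obtains (walk) c p where "p \<in> walks n m" "eqv c (x @ F m) (cw m p @ F m)"
  | (turn) c y z where "\<bar>m\<bar> \<ge> 2" "2 - \<bar>m\<bar> \<in> weights n" "\<bar>2 - \<bar>m\<bar>\<bar> < \<bar>m\<bar>" "y \<in> lists (gens n)" "z \<in> lists (gens n)"
      "eqv c (x @ F m) (y @ F (2 - \<bar>m\<bar>) @ z)"
  | (blob) c y where "m < 0" "y \<in> lists (gens n)" "eqv c (x @ F m) (y @ F (- m))"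
proof -
  have "rw.red n m (x @ F m)"
    using rw.word_reduces[OF n order_refl m] x by (simp add: in_lists_conv_set subset_iff)
  then show ?thesis
  proof (cases rule: rw.redE)
    case (walk a p)
    then show ?thesis using that(1)[OF walk(1)] rw.eqv_trans[OF walk(2) cw(2)[OF walk(1)]] by simp
  next
    case (turn a y i)
    obtain x' y' where t: "2 - \<bar>m\<bar> \<in> weights n" "\<bar>2 - \<bar>m\<bar>\<bar> < \<bar>m\<bar>" "set x' \<subseteq> gens n" "set y' \<subseteq> gens n"
      "eqv 1 ([U i] @ F m) (x' @ F (2 - \<bar>m\<bar>) @ y')"
      using rw.turn_lower[OF m turn(2,3)] by blast
    have "eqv a (x @ F m) ((y @ x') @ F (2 - \<bar>m\<bar>) @ y')"
      using rw.eqv_trans[OF turn(4) rw.eqv_pre[OF t(5)]] by simp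
    moreover have "\<bar>m\<bar> \<ge> 2" using turn(2,3) by linarith
    ultimately show ?thesis
      using that(2)[of "y @ x'" y' a] t turn(1) by (auto simp: in_lists_conv_set)
  next
    case (blob a y)
    then show ?thesis using that(3)[of y a] by (auto simp: in_lists_conv_set)
  qed
qed

definition lower :: "int set \<Rightarrow> 'a set" where
  "lower D = lspan (\<Union>m\<in>D. sq m)"

lemma union_closed: "(\<Union>m\<in>D. sq m) \<subseteq> carrier B"
  using sq_closed by blast

lemma subspace_lower: "subspace (lower D)"
  unfolding lower_def by (rule subspace_span[OF union_closed])

lemma lower_mono: "D \<subseteq> D' \<Longrightarrow> lower D \<subseteq> lower D'"
  unfolding lower_def by (rule span_mono[OF _ union_closed]) blast

lemma sq_lower: "m \<in> D \<Longrightarrow> sq m \<subseteq> lower D"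
  unfolding lower_def using span_superset[OF union_closed] by blast

definition below :: "int \<Rightarrow> int set" where
  "below m = {m' \<in> weights n. prec m' m}"

text \<open>The left factor is reduced first. Unless this leads to a smaller weight, it has become
  the factor of a walk, and reducing the reversed right factor turns the product into one of the
  chosen ones or again into smaller weight.\<close>

lemma word_in_lower:
  assumes "m \<in> weights n" "x \<in> lists (gens n)" "y \<in> lists (gens n)"
  shows "val (x @ F m @ y) \<in> lower (insert m (below m))"
  using assms
\<comment> \<open>The rank orders weights by absolute value and places -k just above k.\<close>
proof (induction "2 * nat \<bar>m\<bar> + (if m < 0 then 1 else 0)" arbitrary: m x y rule: less_induct)
  case less
  note m = less.prems(1) and x = less.prems(2) and y = less.prems(3)
  have IH: "val (v @ F m' @ w) \<in> lower (insert m (below m))"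
    if m': "m' \<in> weights n" "prec m' m" and vw: "v \<in> lists (gens n)" "w \<in> lists (gens n)" for m' v w
  proof -
    have "2 * nat \<bar>m'\<bar> + (if m' < 0 then 1 else 0) < 2 * nat \<bar>m\<bar> + (if m < 0 then 1 else 0)"
      using m'(2) by (auto simp: prec_def)
    from less.hyps[OF this m'(1) vw] have "val (v @ F m' @ w) \<in> lower (insert m' (below m'))" .
    moreover have "insert m' (below m') \<subseteq> insert m (below m)"
      using m' prec_trans by (auto simp: below_def)
    ultimately show ?thesis using lower_mono by blast
  qed
  note sub = subspaceD[OF subspace_lower[of "insert m (below m)"]]
  have Fm: "F m' \<in> lists (gens n)" if "m' \<in> weights n" for m' using F_lists that .
  from m x show ?case
  proof (cases rule: red_left)
    case (turn c v w)
    have "val (x @ F m @ y) = c \<odot> val (v @ F (2 - \<bar>m\<bar>) @ (w @ y))"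
      using val_ctx[OF eqvD(1)[OF turn(6)], of "[]" y] x y turn Fm[OF m] Fm[OF turn(2)] by simp
    moreover have "val (v @ F (2 - \<bar>m\<bar>) @ (w @ y)) \<in> lower (insert m (below m))"
      by (rule IH) (use turn y in \<open>auto simp: prec_def\<close>)
    ultimately show ?thesis using sub(4) by simp
  next
    case (blob c v)
    have "val (x @ F m @ y) = c \<odot> val (v @ F (- m) @ y)"
      using val_ctx[OF eqvD(1)[OF blob(3)], of "[]" y] x y blob Fm[OF m] Fm[OF weights_minus[OF m]] by simp
    moreover have "val (v @ F (- m) @ y) \<in> lower (insert m (below m))"
      by (rule IH) (use blob y weights_minus[OF m] in \<open>auto simp: prec_def\<close>)
    ultimately show ?thesis using sub(4) by simp
  next
    case (walk c p)
    note cp = cw(1)[OF walk(1)]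
    have e: "val (x @ F m @ y) = c \<odot> val (cw m p @ F m @ y)"
      using val_ctx[OF eqvD(1)[OF walk(2)], of "[]" y] x y cp Fm[OF m] by simp
    \<comment> \<open>The right factor is treated as a left factor of the reversed word; the second
      half of \<open>eqv\<close> and the symmetry of F bring the result back.\<close>
    have "val (cw m p @ F m @ y) \<in> lower (insert m (below m))"
      using m y[folded rev_lists[of y]]
    proof (cases rule: red_left)
      case (walk d p')
      note cp' = cw(1)[OF walk(1)]
      have "val (rev (F m) @ y) = d \<odot> val (rev (F m) @ rev (cw m p'))"
        using eqvD(2)[OF walk(2)] y cp' Fm[OF m] by simp
      then have "val (F m @ y) = d \<odot> val (F m @ rev (cw m p'))"
        using rev_F[OF m] y cp' Fm[OF m] by (simp add: val_append)
      then have "val (cw m p @ F m @ y) = d \<odot> val (sqw m p p')"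
        using val_ctx[of "F m @ y" d "F m @ rev (cw m p')" "cw m p" "[]"] y cp cp' Fm[OF m]
        by (simp add: sqw_def)
      moreover have "val (sqw m p p') \<in> sq m"
        unfolding sq_def using walk(1) \<open>p \<in> walks n m\<close> by blast
      ultimately show ?thesis using sub(4) sq_lower[of m "insert m (below m)"] by auto
    next
      case (turn d v w)
      have "val (rev (F m) @ y) = d \<odot> val (rev w @ rev (F (2 - \<bar>m\<bar>)) @ rev v)"
        using eqvD(2)[OF turn(6)] y turn Fm[OF m] Fm[OF turn(2)] by simp
      then have "val (F m @ y) = d \<odot> val (rev w @ F (2 - \<bar>m\<bar>) @ rev v)"
        using rev_F[OF m] rev_F[OF turn(2)] y turn Fm[OF m] Fm[OF turn(2)] by (simp add: val_append)
      then have "val (cw m p @ F m @ y) = d \<odot> val ((cw m p @ rev w) @ F (2 - \<bar>m\<bar>) @ rev v)"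
        using val_ctx[of "F m @ y" d "rev w @ F (2 - \<bar>m\<bar>) @ rev v" "cw m p" "[]"] y cp turn Fm[OF m] Fm[OF turn(2)]
        by simp
      moreover have "val ((cw m p @ rev w) @ F (2 - \<bar>m\<bar>) @ rev v) \<in> lower (insert m (below m))"
        by (rule IH) (use turn cp in \<open>auto simp: prec_def\<close>)
      ultimately show ?thesis using sub(4) by simp
    next
      case (blob d v)
      have "val (rev (F m) @ y) = d \<odot> val (rev (F (- m)) @ rev v)"
        using eqvD(2)[OF blob(3)] y blob Fm[OF m] Fm[OF weights_minus[OF m]] by simp
      then have "val (F m @ y) = d \<odot> val (F (- m) @ rev v)"
        using rev_F[OF m] rev_F[OF weights_minus[OF m]] y blob Fm[OF m] Fm[OF weights_minus[OF m]]
        by (simp add: val_append)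
      then have "val (cw m p @ F m @ y) = d \<odot> val (cw m p @ F (- m) @ rev v)"
        using val_ctx[of "F m @ y" d "F (- m) @ rev v" "cw m p" "[]"] y cp blob Fm[OF m] Fm[OF weights_minus[OF m]]
        by simp
      moreover have "val (cw m p @ F (- m) @ rev v) \<in> lower (insert m (below m))"
        by (rule IH) (use blob cp weights_minus[OF m] in \<open>auto simp: prec_def\<close>)
      ultimately show ?thesis using sub(4) by simp
    qed
    then show ?thesis using e sub(4) by simp
  qed
qed

text \<open>Both factors are extended from generators by linearity, first x from S to its span, then
  a from words to the whole algebra.\<close>

lemma mult_span:
  assumes S: "S \<subseteq> carrier B" and V: "subspace V"
    and w: "\<And>w x. w \<in> lists (gens n) \<Longrightarrow> x \<in> S \<Longrightarrow> val w \<otimes> x \<in> V"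
    and a: "a \<in> carrier B" and x: "x \<in> lspan S"
  shows "a \<otimes> x \<in> V"
proof -
  note sub = subspaceD[OF V]
  have xc: "x \<in> carrier B" using x subspaceD(1)[OF subspace_span[OF S]] by blast
  let ?W = "\<lambda>w. {y \<in> carrier B. val w \<otimes> y \<in> V}"
  have "subspace (?W w)" if "w \<in> lists (gens n)" for w
    by (rule subspaceI) (use sub that in \<open>auto simp: r_distr mult_smult\<close>)
  then have "lspan S \<subseteq> ?W w" if "w \<in> lists (gens n)" for w
    using that S w by (intro span_least) auto
  then have "val w \<otimes> x \<in> V" if "w \<in> lists (gens n)" for w
    using x that by blast
  then have "a \<in> {a \<in> carrier B. a \<otimes> x \<in> V}"
    by (intro word_span[OF a]) (use xc sub in \<open>auto simp: l_distr smult_mult\<close>)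
  then show ?thesis by simp
qed

lemma span_mult:
  assumes S: "S \<subseteq> carrier B" and V: "subspace V"
    and w: "\<And>w x. w \<in> lists (gens n) \<Longrightarrow> x \<in> S \<Longrightarrow> x \<otimes> val w \<in> V"
    and a: "a \<in> carrier B" and x: "x \<in> lspan S"
  shows "x \<otimes> a \<in> V"
proof -
  note sub = subspaceD[OF V]
  have xc: "x \<in> carrier B" using x subspaceD(1)[OF subspace_span[OF S]] by blast
  let ?W = "\<lambda>w. {y \<in> carrier B. y \<otimes> val w \<in> V}"
  have "subspace (?W w)" if "w \<in> lists (gens n)" for w
    by (rule subspaceI) (use sub that in \<open>auto simp: l_distr smult_mult\<close>)
  then have "lspan S \<subseteq> ?W w" if "w \<in> lists (gens n)" for w
    using that S w by (intro span_least) auto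
  then have "x \<otimes> val w \<in> V" if "w \<in> lists (gens n)" for w
    using x that by blast
  then have "a \<in> {a \<in> carrier B. x \<otimes> a \<in> V}"
    by (intro word_span[OF a]) (use xc sub in \<open>auto simp: r_distr mult_smult\<close>)
  then show ?thesis by simp
qed

lemma sqE:
  assumes "x \<in> sq m"
  obtains p p' where "p \<in> walks n m" "p' \<in> walks n m" "x = val (sqw m p p')"
  using assms by (auto simp: sq_def)

lemma sq_mult:
  assumes "x \<in> sq m" "w \<in> lists (gens n)"
  shows "val w \<otimes> x \<in> lower (insert m (below m))" "x \<otimes> val w \<in> lower (insert m (below m))"
proof -
  obtain p p' where p: "p \<in> walks n m" "p' \<in> walks n m" "x = val (sqw m p p')"
    using assms(1) by (rule sqE)
  note c = cw(1)[OF p(1)] cw(1)[OF p(2)] and m = walks_weights[OF p(1)]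
  have "val w \<otimes> x = val ((w @ cw m p) @ F m @ rev (cw m p'))"
    using p(3) val_append[OF assms(2) sqw_lists[OF p(1,2)]] by (simp add: sqw_def)
  then show "val w \<otimes> x \<in> lower (insert m (below m))"
    using word_in_lower[OF m, of "w @ cw m p" "rev (cw m p')"] c assms(2) by simp
  have "x \<otimes> val w = val (cw m p @ F m @ (rev (cw m p') @ w))"
    using p(3) val_append[OF sqw_lists[OF p(1,2)] assms(2)] by (simp add: sqw_def)
  then show "x \<otimes> val w \<in> lower (insert m (below m))"
    using word_in_lower[OF m, of "cw m p" "rev (cw m p') @ w"] c assms(2) by simp
qed

text \<open>Multiplying a product of weight m by a word stays within weight m and the weights below
  it, so a set of weights closed downwards spans a two-sided ideal.\<close>

lemma ideal_lower:
  assumes D: "\<And>m. m \<in> D \<Longrightarrow> below m \<subseteq> D"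
  shows "ideal (lower D) B"
proof (rule subspace_idealI[OF subspace_lower])
  have *: "val w \<otimes> x \<in> lower D \<and> x \<otimes> val w \<in> lower D" if w: "w \<in> lists (gens n)" and x: "x \<in> (\<Union>m\<in>D. sq m)" for w x
  proof -
    obtain m where m: "m \<in> D" "x \<in> sq m" using x by blast
    then have "lower (insert m (below m)) \<subseteq> lower D" using D[OF m(1)] by (intro lower_mono) auto
    then show ?thesis using sq_mult[OF m(2) w] by blast
  qed
  fix a x assume ax: "a \<in> carrier B" "x \<in> lower D"
  show "a \<otimes> x \<in> lower D"
    by (rule mult_span[OF union_closed subspace_lower _ ax(1) ax(2)[unfolded lower_def]]) (use * in blast)
  show "x \<otimes> a \<in> lower D"
    by (rule span_mult[OF union_closed subspace_lower _ ax(1) ax(2)[unfolded lower_def]]) (use * in blast)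
qed

lemma below_below: "m' \<in> below m \<Longrightarrow> below m' \<subseteq> below m"
  using prec_trans by (auto simp: below_def)

lemma ideal_below: "ideal (lower (below m)) B" "ideal (lower (insert m (below m))) B"
  by (rule ideal_lower, use below_below in blast)+

lemma lower_weights: "lower (weights n) = carrier B"
proof
  show "lower (weights n) \<subseteq> carrier B" using subspaceD(1)[OF subspace_lower] .
  note sub = subspaceD[OF subspace_lower[of "weights n"]]
  have m: "- int n \<in> weights n" by (simp add: weights_def)
  \<comment> \<open>At weight -n the F word is empty, so every word has the form covered by
    \<open>word_in_lower\<close>.\<close>
  have F0: "F (- int n) = []" using n by (simp add: F_word_neg)
  have "insert (- int n) (below (- int n)) \<subseteq> weights n" using m by (auto simp: below_def)
  then have le: "lower (insert (- int n) (below (- int n))) \<subseteq> lower (weights n)" by (rule lower_mono)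
  have w: "val w \<in> lower (weights n)" if "w \<in> lists (gens n)" for w
    using word_in_lower[OF m that, of "[]"] le F0 by auto
  show "carrier B \<subseteq> lower (weights n)"
  proof
    fix X assume "X \<in> carrier B"
    then show "X \<in> lower (weights n)"
      by (rule word_span[where W = "lower (weights n)"]) (fact w sub(3) sub(4) sub(1))+
  qed
qed

section \<open>Duality between the products and their diagrams\<close>

lemma walk_state_val:
  assumes "p \<in> walks n m" "w \<in> lists (gens n)" "val w = val (walk_word p)"
  shows "D.word_act True w (1, vac) = (1, walk_state n m p)"
  using state_eq[OF assms(3,2) walk_word_lists[OF assms(1)] D.walk_word_act[OF assms(1)]] .

lemma val_cw: "p \<in> walks n m \<Longrightarrow> val (cw m p @ F m) = val (walk_word p)"
  using eqvD(1)[OF cw(2)] cw(1) F_lists[OF walks_weights] walk_word_lists by simp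

definition st :: "int \<Rightarrow> int list \<Rightarrow> int list \<Rightarrow> (bool \<times> nat) state" where
  "st m p p' = snd (D.word_act True (sqw m p p') (1, vac))"

lemma st:
  assumes p: "p \<in> walks n m" "p' \<in> walks n m"
  shows "D.word_act True (sqw m p p') (1, vac) = (1, st m p p')"
    "view True (st m p p') = view True (walk_state n m p)"
    "view False (st m p p') = swap (view True (walk_state n m p'))"
proof -
  note m = walks_weights[OF p(1)]
  obtain q where q: "q \<in> walks n m" "eqv 1 (F m) (walk_word q)"
    using rw.F_word_walk[OF m order_refl] by blast
  have Fq: "val (F m) = val (walk_word q)"
    using eqvD(1)[OF q(2) F_lists[OF m] walk_word_lists[OF q(1)]] walk_word_lists[OF q(1)] by simp
  have F1: "D.word_act True (F m) (1, vac) = (1, walk_state n m q)"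
    using walk_state_val[OF q(1) F_lists[OF m] Fq] .
  have F2: "D.word_act True (rev (F m)) (1, vac) = (1, walk_state n m q)"
    using walk_state_val[OF q(1), of "rev (F m)"] rev_F[OF m] Fq F_lists[OF m] by simp
  have a: "D.word_act True (cw m r @ F m) (1, vac) = (1, walk_state n m r)" if "r \<in> walks n m" for r
    using walk_state_val[OF that _ val_cw[OF that]] cw(1)[OF that] F_lists[OF m] by simp
  obtain s where s: "D.word_act True (cw m p @ F m @ rev (cw m p')) (1, vac) = (1, s)"
    "view True s = view True (walk_state n m p)" "view False s = swap (view True (walk_state n m p'))"
    using D.square_state[OF F1 F2 a[OF p(1)] view_bottom_walk_state[OF p(1) q(1)]
      a[OF p(2)] view_bottom_walk_state[OF p(2) q(1)]] by blast
  moreover have "st m p p' = s" unfolding st_def sqw_def s(1) by simp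
  ultimately show "D.word_act True (sqw m p p') (1, vac) = (1, st m p p')"
    "view True (st m p p') = view True (walk_state n m p)"
    "view False (st m p p') = swap (view True (walk_state n m p'))"
    unfolding sqw_def by simp_all
qed

text \<open>Every product has coefficient 1 at its diagram; the two halves of the diagram recover
  the two walks, and either walk recovers the weight.\<close>

lemma coord_st:
  assumes p: "p \<in> walks n m" "p' \<in> walks n m" and q: "q \<in> walks n l" "q' \<in> walks n l"
  shows "coord (st m p p') (sqw l q q') = (if q = p \<and> q' = p' then 1 else 0)"
proof -
  have "st l q q' = st m p p' \<longleftrightarrow> q = p \<and> q' = p'"
  proof
    assume e: "st l q q' = st m p p'"
    have "view True (walk_state n l q) = view True (walk_state n m p)"
      using st(2)[OF p] st(2)[OF q] e by simp
    then have qp: "q = p" using view_top_walk_state_inj[OF q(1) p(1)] by simp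
    have "swap (view True (walk_state n l q')) = swap (view True (walk_state n m p'))"
      using st(3)[OF p] st(3)[OF q] e by simp
    then have "view True (walk_state n l q') = view True (walk_state n m p')"
      using swap_swap by metis
    then have "q' = p'" using view_top_walk_state_inj[OF q(2) p(2)] by simp
    with qp show "q = p \<and> q' = p'" by simp
  next
    assume "q = p \<and> q' = p'"
    then show "st l q q' = st m p p'" using weights_of_walk[OF p(1)] weights_of_walk[OF q(1)] by simp
  qed
  then show ?thesis unfolding coord_def st(1)[OF q] by simp
qed

lemma finite_weights [simp]: "finite (weights n)"
  by (rule finite_subset[of _ "{- int n..int n}"]) (auto simp: weights_def)

lemma finite_walks [simp]: "finite (walks k m)"
proof (induction k arbitrary: m)
  case (Suc k)
  have "walks (Suc k) m \<subseteq> (\<lambda>q. q @ [m]) ` (walks k (m - 1) \<union> walks k (m + 1))"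
    by (auto simp: walks_Suc_iff)
  then show ?case using Suc by (meson finite_UnI finite_imageI finite_subset)
qed auto

definition idx :: "(int \<times> int list \<times> int list) set" where
  "idx = (SIGMA m:weights n. walks n m \<times> walks n m)"

lemma finite_idx [simp]: "finite idx"
  by (simp add: idx_def)

definition basis :: "int \<times> int list \<times> int list \<Rightarrow> 'a" where
  "basis i = (case i of (m, p, p') \<Rightarrow> val (sqw m p p'))"

definition dual :: "int \<times> int list \<times> int list \<Rightarrow> 'a \<Rightarrow> 'k" where
  "dual i = (case i of (m, p, p') \<Rightarrow> T (st m p p'))"

lemma basis_closed [simp]: "i \<in> idx \<Longrightarrow> basis i \<in> carrier B"
  by (auto simp: idx_def basis_def)

lemma dual_additive: "additive_map B (dual i)"
  and dual_smult: "X \<in> carrier B \<Longrightarrow> dual i (c \<odot> X) = c * dual i X"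
  by (cases i; simp add: dual_def T)+

lemma dual_basis:
  assumes "i \<in> idx" "j \<in> idx"
  shows "dual i (basis j) = (if i = j then 1 else 0)"
proof -
  obtain m p p' where i: "i = (m, p, p')" "p \<in> walks n m" "p' \<in> walks n m"
    using assms(1) by (auto simp: idx_def)
  obtain l q q' where j: "j = (l, q, q')" "q \<in> walks n l" "q' \<in> walks n l"
    using assms(2) by (auto simp: idx_def)
  have "dual i (basis j) = (if q = p \<and> q' = p' then 1 else 0)"
    unfolding i(1) j(1) dual_def basis_def prod.case
    using T(3)[OF sqw_lists[OF j(2,3)]] coord_st[OF i(2,3) j(2,3)] by simp
  moreover have "q = p \<and> q' = p' \<longleftrightarrow> i = j"
    using i j weights_of_walk[OF i(2)] weights_of_walk[OF j(2)] by auto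
  ultimately show ?thesis by simp
qed

text \<open>The formula is linear in X and holds on the products by duality, and these span.\<close>

lemma expansion:
  assumes X: "X \<in> carrier B"
  shows "X = (\<Oplus>i\<in>idx. dual i X \<odot> basis i)"
proof -
  let ?e = "\<lambda>X. \<Oplus>i\<in>idx. dual i X \<odot> basis i"
  let ?W = "{X \<in> carrier B. X = ?e X}"
  have Pi: "(\<lambda>i. c i \<odot> basis i) \<in> idx \<rightarrow> carrier B" for c by auto
  interpret d: additive_map B "dual i" for i by (rule dual_additive)
  have "subspace ?W"
  proof (rule subspaceI)
    show "\<zero> \<in> ?W" by (simp add: add.finprod_one_eqI)
    fix X Y assume XY: "X \<in> ?W" "Y \<in> ?W"
    then have c: "X \<in> carrier B" "Y \<in> carrier B" by auto
    have "?e (X \<oplus> Y) = (\<Oplus>i\<in>idx. dual i X \<odot> basis i \<oplus> dual i Y \<odot> basis i)"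
      by (rule finsum_cong') (use c in \<open>auto simp: d.additive add_smult\<close>)
    also have "\<dots> = ?e X \<oplus> ?e Y"
      by (rule finsum_addf[OF Pi Pi])
    also have "\<dots> = X \<oplus> Y" using XY by simp
    finally show "X \<oplus> Y \<in> ?W" using c by simp
  next
    fix X c assume X: "X \<in> ?W"
    then have Xc: "X \<in> carrier B" by simp
    have "c \<odot> X = c \<odot> ?e X" using X by simp
    also have "\<dots> = (\<Oplus>i\<in>idx. c \<odot> (dual i X \<odot> basis i))"
      by (rule smult_finsum[OF Pi])
    also have "\<dots> = ?e (c \<odot> X)"
      by (rule finsum_cong') (use Xc in \<open>auto simp: dual_smult smult_smult\<close>)
    finally show "c \<odot> X \<in> ?W" using Xc by simp
  qed auto
  moreover have "(\<Union>m\<in>weights n. sq m) \<subseteq> ?W"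
  proof
    fix x assume "x \<in> (\<Union>m\<in>weights n. sq m)"
    then obtain j where j: "j \<in> idx" "x = basis j"
      by (auto simp: sq_def idx_def basis_def)
    have "?e (basis j) = (\<Oplus>i\<in>idx. if j = i then basis i else \<zero>)"
      by (rule finsum_cong') (use j dual_basis in auto)
    also have "\<dots> = basis j" using finsum_singleton[OF j(1) finite_idx, of basis] by auto
    finally show "x \<in> ?W" using j by simp
  qed
  ultimately have "lower (weights n) \<subseteq> ?W" unfolding lower_def by (rule span_least)
  then show ?thesis using X lower_weights by blast
qed

lemma separate:
  assumes "X \<in> carrier B" "Y \<in> carrier B" "\<And>i. i \<in> idx \<Longrightarrow> dual i X = dual i Y"
  shows "X = Y"
proof -
  have "(\<Oplus>i\<in>idx. dual i X \<odot> basis i) = (\<Oplus>i\<in>idx. dual i Y \<odot> basis i)"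
    by (rule finsum_cong') (use assms in auto)
  with expansion[OF assms(1)] have "X = (\<Oplus>i\<in>idx. dual i Y \<odot> basis i)" by (rule trans)
  then show ?thesis using expansion[OF assms(2), symmetric] by (rule trans)
qed

end

context blob_algebra
begin

subsection \<open>The anti-automorphism\<close>

lemma coord_rev: "coord s (rev w) = coord (swap s) w"
proof -
  have "D.word_act True (rev w) (1, vac) = apsnd swap (D.word_act True w (1, vac))"
    using D.word_act_vac[of True "rev w" 1] D.word_act_swap[of True w 1 vac] by simp
  moreover have "swap t = s \<longleftrightarrow> t = swap s" for t by auto
  ultimately show ?thesis by (cases "D.word_act True w (1, vac)") (simp add: coord_def)
qed

text \<open>Reversal is defined on the basis of products, which makes it linear from the start; its
  agreement with word reversal is then a theorem.\<close>

definition rv :: "'a \<Rightarrow> 'a" where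
  "rv X = (\<Oplus>i\<in>idx. dual i X \<odot> (case i of (m, p, p') \<Rightarrow> val (rev (sqw m p p'))))"

lemma rev_basis_Pi: "(\<lambda>i. c i \<odot> (case i of (m, p, p') \<Rightarrow> val (rev (sqw m p p')))) \<in> idx \<rightarrow> carrier B"
  by (auto simp: idx_def)

lemma rv_closed: "rv X \<in> carrier B"
  unfolding rv_def by (rule finsum_closed[OF rev_basis_Pi])

lemma rv_add: "X \<in> carrier B \<Longrightarrow> Y \<in> carrier B \<Longrightarrow> rv (X \<oplus> Y) = rv X \<oplus> rv Y"
proof -
  assume c: "X \<in> carrier B" "Y \<in> carrier B"
  interpret d: additive_map B "dual i" for i by (rule dual_additive)
  let ?r = "\<lambda>i. case i of (m, p, p') \<Rightarrow> val (rev (sqw m p p'))"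
  have r: "?r i \<in> carrier B" if "i \<in> idx" for i using that by (auto simp: idx_def)
  have "rv (X \<oplus> Y) = (\<Oplus>i\<in>idx. dual i X \<odot> ?r i \<oplus> dual i Y \<odot> ?r i)"
    unfolding rv_def by (rule finsum_cong') (use c r in \<open>auto simp: d.additive add_smult\<close>)
  also have "\<dots> = rv X \<oplus> rv Y"
    unfolding rv_def by (rule finsum_addf[OF rev_basis_Pi rev_basis_Pi])
  finally show ?thesis .
qed

lemma rv_smult: "X \<in> carrier B \<Longrightarrow> rv (c \<odot> X) = c \<odot> rv X"
proof -
  assume X: "X \<in> carrier B"
  let ?r = "\<lambda>i. case i of (m, p, p') \<Rightarrow> val (rev (sqw m p p'))"
  have r: "?r i \<in> carrier B" if "i \<in> idx" for i using that by (auto simp: idx_def)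
  have "c \<odot> rv X = (\<Oplus>i\<in>idx. c \<odot> (dual i X \<odot> ?r i))"
    unfolding rv_def by (rule smult_finsum[OF rev_basis_Pi])
  also have "\<dots> = rv (c \<odot> X)"
    unfolding rv_def by (rule finsum_cong') (use X r in \<open>auto simp: dual_smult smult_smult\<close>)
  finally show ?thesis by simp
qed

text \<open>Reversing a word mirrors its diagram, so the coefficient at s becomes the coefficient at
  \<open>swap s\<close>. Applying this to each term of the expansion of \<open>val w\<close> gives
  equal coordinates. Functionals exist for all diagrams, so the mirrored ones may be used
  freely.\<close>

lemma rv_val:
  assumes w: "w \<in> lists (gens n)"
  shows "rv (val w) = val (rev w)"
proof (rule separate[OF rv_closed])
  show "val (rev w) \<in> carrier B" using w by simp
  fix i assume i: "i \<in> idx"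
  then obtain m p p' where mp: "i = (m, p, p')" "p \<in> walks n m" "p' \<in> walks n m"
    by (auto simp: idx_def)
  let ?s = "st m p p'" and ?r = "\<lambda>i. case i of (m, p, p') \<Rightarrow> val (rev (sqw m p p'))"
  have d: "dual i = T ?s" by (simp add: dual_def mp(1))
  interpret t: additive_map B "T s" for s by (rule T(1))
  have r: "?r j \<in> carrier B" "T ?s (?r j) = T (swap ?s) (basis j)" if "j \<in> idx" for j
    using that by (auto simp: idx_def basis_def T(3) coord_rev)
  have Pi: "(\<lambda>j. dual j (val w) \<odot> basis j) \<in> idx \<rightarrow> carrier B" by auto
  have "T ?s (rv (val w)) = (\<Sum>j\<in>idx. T ?s (dual j (val w) \<odot> ?r j))"
    unfolding rv_def by (rule t.additive_finsum[OF finite_idx rev_basis_Pi])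
  also have "\<dots> = (\<Sum>j\<in>idx. T (swap ?s) (dual j (val w) \<odot> basis j))"
    by (rule sum.cong) (simp_all add: T(2) r)
  also have "\<dots> = T (swap ?s) (val w)"
    using t.additive_finsum[OF finite_idx Pi, of "swap ?s"] expansion[OF val_closed[OF w]] by simp
  also have "\<dots> = T ?s (val (rev w))"
    using w by (simp add: T(3) coord_rev)
  finally show "dual i (rv (val w)) = dual i (val (rev w))" by (simp add: d)
qed

lemma word_ext:
  assumes X: "X \<in> carrier B" and w: "\<And>w. w \<in> lists (gens n) \<Longrightarrow> f (val w) = g (val w)"
    and f: "\<And>X Y. X \<in> carrier B \<Longrightarrow> Y \<in> carrier B \<Longrightarrow> f (X \<oplus> Y) = f X \<oplus> f Y" "\<And>X c. X \<in> carrier B \<Longrightarrow> f (c \<odot> X) = c \<odot> f X"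
    and g: "\<And>X Y. X \<in> carrier B \<Longrightarrow> Y \<in> carrier B \<Longrightarrow> g (X \<oplus> Y) = g X \<oplus> g Y" "\<And>X c. X \<in> carrier B \<Longrightarrow> g (c \<odot> X) = c \<odot> g X"
  shows "f X = g X"
proof -
  have "X \<in> {X \<in> carrier B. f X = g X}"
    by (rule word_span[OF X]) (use w f g in auto)
  then show ?thesis by simp
qed

lemma rv_mult_val:
  assumes "X \<in> carrier B" "w \<in> lists (gens n)"
  shows "rv (X \<otimes> val w) = val (rev w) \<otimes> rv X"
proof (rule word_ext[OF assms(1), where f = "\<lambda>X. rv (X \<otimes> val w)" and g = "\<lambda>X. val (rev w) \<otimes> rv X"])
  fix v assume v: "v \<in> lists (gens n)"
  have "rv (val v \<otimes> val w) = rv (val (v @ w))" using val_append[OF v assms(2)] by simp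
  also have "\<dots> = val (rev w @ rev v)" using rv_val[of "v @ w"] v assms(2) by simp
  also have "\<dots> = val (rev w) \<otimes> rv (val v)" using val_append[of "rev w" "rev v"] rv_val[OF v] v assms(2) by simp
  finally show "rv (val v \<otimes> val w) = val (rev w) \<otimes> rv (val v)" .
qed (use assms(2) rv_closed in \<open>simp_all add: rv_add rv_smult l_distr r_distr smult_mult mult_smult\<close>)

lemma rv_mult:
  assumes X: "X \<in> carrier B" and Y: "Y \<in> carrier B"
  shows "rv (X \<otimes> Y) = rv Y \<otimes> rv X"
  by (rule word_ext[OF Y, where f = "\<lambda>Y. rv (X \<otimes> Y)" and g = "\<lambda>Y. rv Y \<otimes> rv X"])
    (use X rv_closed in \<open>simp_all add: rv_mult_val rv_val rv_add rv_smult l_distr r_distr smult_mult mult_smult\<close>)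

lemma rv_rv: "X \<in> carrier B \<Longrightarrow> rv (rv X) = X"
  by (rule word_ext[where f = "\<lambda>X. rv (rv X)" and g = "\<lambda>X. X"]) (use rv_closed in \<open>simp_all add: rv_val rv_add rv_smult\<close>)

text \<open>The description in \<open>reverse_map\<close> denotes something because
  \<open>rv\<close> satisfies it, and it is unique because an anti-automorphism fixing the
  generators is forced on words, which span.\<close>

lemma reverse_map_val:
  assumes "w \<in> lists (gens n)"
  shows "reverse_map B u n (val w) = val (rev w)"
proof -
  let ?f = "restrict rv (carrier B)"
  let ?P = "\<lambda>f. linear_anti_automorphism B f \<and> (\<forall>g\<in>gens n. f (u g) = u g) \<and> f \<in> extensional (carrier B)"
  have "bij_betw rv (carrier B) (carrier B)"
    by (rule bij_betw_byWitness[of _ rv]) (use rv_rv rv_closed in auto)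
  then have "bij_betw ?f (carrier B) (carrier B)"
    by (simp add: bij_betw_cong[of _ ?f rv])
  then have P: "?P ?f"
    using rv_val[of "[]"] rv_val[of "[g]" for g] u_closed
    by (auto simp: linear_anti_automorphism_def val_Nil val_single rv_add rv_smult rv_mult)
  have uniq: "f = ?f" if f: "?P f" for f
  proof -
    note l = f[THEN conjunct1, unfolded linear_anti_automorphism_def]
    have fw: "f (val w) = val (rev w)" if "w \<in> lists (gens n)" for w
      using that
    proof (induction w)
      case Nil
      then show ?case using l by (simp add: val_Nil)
    next
      case (Cons g w)
      then have "f (val (g # w)) = f (val w) \<otimes> f (u g)"
        using l val_append[of "[g]" w] by (simp add: val_single u_closed)
      also have "\<dots> = val (rev w) \<otimes> val [g]"
        using Cons f by (simp add: val_single)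
      also have "\<dots> = val (rev (g # w))"
        using Cons.hyps val_append[of "rev w" "[g]"] by simp
      finally show ?case .
    qed
    have "f X = ?f X" if X: "X \<in> carrier B" for X
    proof -
      have "f X = rv X"
        by (rule word_ext[OF X, where f = f and g = rv]) (use l in \<open>simp_all add: fw rv_val rv_add rv_smult\<close>)
      then show ?thesis using X by simp
    qed
    then show ?thesis using f by (intro extensionalityI[of f "carrier B"]) auto
  qed
  have "reverse_map B u n = ?f"
    unfolding reverse_map_def using P uniq by (rule the_equality)
  then show ?thesis using assms by (simp add: rv_val)
qed

end

subsection \<open>Bases of the left ideals\<close>

context scalar_ring
begin

lemma subspace_sum_of_ideals:
  assumes D: "finite D" and I: "\<And>i. i \<in> D \<Longrightarrow> subspace (I i)"
  shows "subspace (sum_of_ideals A I D)" "j \<in> D \<Longrightarrow> I j \<subseteq> sum_of_ideals A I D"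
proof -
  have Pi: "f \<in> D \<rightarrow> carrier A" if "\<forall>i\<in>D. f i \<in> I i" for f
  proof
    fix i assume "i \<in> D"
    then show "f i \<in> carrier A" using that subspaceD(1)[OF I[of i]] by blast
  qed
  have intro: "(\<Oplus>i\<in>D. f i) \<in> sum_of_ideals A I D" if "\<forall>i\<in>D. f i \<in> I i" for f
    unfolding sum_of_ideals_def using that by blast
  show "subspace (sum_of_ideals A I D)"
  proof (rule subspaceI)
    show "sum_of_ideals A I D \<subseteq> carrier A"
    proof
      fix x assume "x \<in> sum_of_ideals A I D"
      then obtain f where f: "\<forall>i\<in>D. f i \<in> I i" "x = (\<Oplus>i\<in>D. f i)"
        unfolding sum_of_ideals_def by blast
      then show "x \<in> carrier A" using finsum_closed[OF Pi[OF f(1)]] by simp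
    qed
    show "\<zero> \<in> sum_of_ideals A I D"
      using intro[of "\<lambda>_. \<zero>"] subspaceD(2)[OF I] by simp
    fix x y assume "x \<in> sum_of_ideals A I D" "y \<in> sum_of_ideals A I D"
    then obtain f g where f: "\<forall>i\<in>D. f i \<in> I i" "x = (\<Oplus>i\<in>D. f i)" and g: "\<forall>i\<in>D. g i \<in> I i" "y = (\<Oplus>i\<in>D. g i)"
      unfolding sum_of_ideals_def by blast
    have "x \<oplus> y = (\<Oplus>i\<in>D. f i \<oplus> g i)"
      unfolding f(2) g(2) by (rule finsum_addf[OF Pi[OF f(1)] Pi[OF g(1)], symmetric])
    then show "x \<oplus> y \<in> sum_of_ideals A I D"
      using intro[of "\<lambda>i. f i \<oplus> g i"] f(1) g(1) subspaceD(3)[OF I] by simp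
  next
    fix c x assume "x \<in> sum_of_ideals A I D"
    then obtain f where f: "\<forall>i\<in>D. f i \<in> I i" "x = (\<Oplus>i\<in>D. f i)"
      unfolding sum_of_ideals_def by blast
    have "c \<odot> x = (\<Oplus>i\<in>D. c \<odot> f i)"
      unfolding f(2) by (rule smult_finsum[OF Pi[OF f(1)]])
    then show "c \<odot> x \<in> sum_of_ideals A I D"
      using intro[of "\<lambda>i. c \<odot> f i"] f(1) subspaceD(4)[OF I] by simp
  qed
  assume j: "j \<in> D"
  show "I j \<subseteq> sum_of_ideals A I D"
  proof
    fix x assume x: "x \<in> I j"
    then have xc: "x \<in> carrier A" using subspaceD(1)[OF I[OF j]] by blast
    have "(\<Oplus>i\<in>D. if j = i then x else \<zero>) = x"
      using finsum_singleton[OF j D, of "\<lambda>_. x"] xc by simp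
    then show "x \<in> sum_of_ideals A I D"
      using intro[of "\<lambda>i. if j = i then x else \<zero>"] x subspaceD(2)[OF I] by simp
  qed
qed

end

context blob_algebra
begin

lemma walk_set_eq: "walk_set B u n m = (\<lambda>p. val (cw m p @ F m)) ` walks n m"
  unfolding walk_set_def setcompr_eq_image by (simp add: val_cw cong: image_cong)

lemma walk_set_closed: "walk_set B u n m \<subseteq> carrier B"
  unfolding walk_set_def using val_closed[OF walk_word_lists] by blast

lemma walk_set_lower: "m \<in> weights n \<Longrightarrow> walk_set B u n m \<subseteq> lower (insert m (below m))"
proof
  fix s assume m: "m \<in> weights n" and "s \<in> walk_set B u n m"
  then obtain p where p: "p \<in> walks n m" "s = val (cw m p @ F m)"
    unfolding walk_set_eq by blast
  show "s \<in> lower (insert m (below m))"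
    using word_in_lower[OF m cw(1)[OF p(1)], of "[]"] p(2) by simp
qed

text \<open>A diagram whose top half comes from a walk of weight m cannot arise from a product of
  another weight, as the top half determines the walk and hence its end.\<close>

lemma T_below:
  assumes p: "p \<in> walks n m" and s: "view True s = view True (walk_state n m p)" and X: "X \<in> lower (below m)"
  shows "T s X = 0"
proof -
  interpret t: additive_map B "T s" by (rule T(1))
  have "subspace {X \<in> carrier B. T s X = 0}"
    by (rule subspaceI) (auto simp: t.additive T(2))
  moreover have "(\<Union>m'\<in>below m. sq m') \<subseteq> {X \<in> carrier B. T s X = 0}"
  proof
    fix Y assume "Y \<in> (\<Union>m'\<in>below m. sq m')"
    then obtain l q q' where l: "prec l m" and q: "q \<in> walks n l" "q' \<in> walks n l" "Y = val (sqw l q q')"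
      by (auto simp: below_def sq_def)
    have "st l q q' \<noteq> s"
    proof
      assume "st l q q' = s"
      then have "view True (walk_state n l q) = view True (walk_state n m p)"
        using st(2)[OF q(1,2)] s by simp
      then have "q = p" by (rule view_top_walk_state_inj[OF q(1) p])
      then have "l = m" using weights_of_walk[OF p] weights_of_walk[OF q(1)] by simp
      then show False using l by (auto simp: prec_def)
    qed
    then have "coord s (sqw l q q') = 0"
      unfolding coord_def st(1)[OF q(1,2)] by simp
    then show "Y \<in> {X \<in> carrier B. T s X = 0}"
      using q T(3)[OF sqw_lists[OF q(1,2)]] by simp
  qed
  ultimately have "lower (below m) \<subseteq> {X \<in> carrier B. T s X = 0}"
    unfolding lower_def by (rule span_least)
  then show ?thesis using X by blast
qed

lemma independent_walk_set:
  assumes J: "J \<subseteq> lower (below m)"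
  shows "independent_mod B (walk_set B u n m) J"
proof (rule independent_modI[OF walk_set_closed])
  fix v assume "v \<in> walk_set B u n m"
  then obtain p where p: "p \<in> walks n m" "v = val (walk_word p)"
    unfolding walk_set_def by blast
  let ?t = "T (walk_state n m p)"
  have c: "?t (val (walk_word q)) = (if walk_state n m q = walk_state n m p then 1 else 0)"
    if "q \<in> walks n m" for q
    unfolding T(3)[OF walk_word_lists[OF that]] coord_def D.walk_word_act[OF that] by simp
  have "?t w = 0" if w: "w \<in> walk_set B u n m" "w \<noteq> v" for w
  proof -
    obtain q where q: "q \<in> walks n m" "w = val (walk_word q)"
      using w(1) unfolding walk_set_def by blast
    have "walk_state n m q \<noteq> walk_state n m p"
      using view_top_walk_state_inj[OF q(1) p(1)] q(2) p(2) w(2) by auto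
    then show ?thesis using c[OF q(1)] q(2) by simp
  qed
  moreover have "?t w = 0" if "w \<in> J" for w
    using T_below[OF p(1) refl] that J by blast
  moreover have "?t v = 1" using c[OF p(1)] p(2) by simp
  ultimately show "\<exists>t. additive_map B t \<and> (\<forall>x\<in>carrier B. \<forall>c. t (c \<odot> x) = c * t x) \<and>
      t v = 1 \<and> (\<forall>w\<in>walk_set B u n m. w \<noteq> v \<longrightarrow> t w = 0) \<and> (\<forall>w\<in>J. t w = 0)"
    using T(1,2) by blast
qed

text \<open>Modulo J it suffices that words map S into its span; the span plus J is then already a
  left ideal containing S.\<close>

lemma left_genideal_span:
  assumes S: "S \<subseteq> carrier B" and J: "left_ideal J"
    and w: "\<And>w s. w \<in> lists (gens n) \<Longrightarrow> s \<in> S \<Longrightarrow> val w \<otimes> s \<in> lspan S <+>\<^bsub>B\<^esub> J"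
  shows "lspan S <+>\<^bsub>B\<^esub> J = left_genideal B S <+>\<^bsub>B\<^esub> J"
proof
  have Js: "subspace J" using J by (simp add: left_ideal_def)
  note sub = subspace_set_add[OF subspace_span[OF S] Js]
  note L = left_ideal_left_genideal[OF S]
  then have Ls: "subspace (left_genideal B S)" by (simp add: left_ideal_def)
  have LJ: "subspace (left_genideal B S <+>\<^bsub>B\<^esub> J)" by (rule subspace_set_add[OF Ls Js])
  have "lspan S \<subseteq> left_genideal B S"
    by (rule span_least[OF Ls left_genideal_superset])
  then show "lspan S <+>\<^bsub>B\<^esub> J \<subseteq> left_genideal B S <+>\<^bsub>B\<^esub> J"
    using set_add_superset[OF Ls Js] by (intro set_add_least[OF LJ]) auto
  have "left_ideal (lspan S <+>\<^bsub>B\<^esub> J)"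
    unfolding left_ideal_def
  proof (intro conjI ballI sub)
    fix a x assume a: "a \<in> carrier B" and "x \<in> lspan S <+>\<^bsub>B\<^esub> J"
    then obtain y z where yz: "y \<in> lspan S" "z \<in> J" "x = y \<oplus> z" unfolding set_add_iff by blast
    have "y \<in> carrier B" "z \<in> carrier B"
      using yz subspaceD(1)[OF subspace_span[OF S]] subspaceD(1)[OF Js] by auto
    then have "a \<otimes> x = a \<otimes> y \<oplus> a \<otimes> z" using a yz(3) by (simp add: r_distr)
    moreover have "a \<otimes> y \<in> lspan S <+>\<^bsub>B\<^esub> J"
      by (rule mult_span[OF S sub w a yz(1)])
    moreover have "a \<otimes> z \<in> lspan S <+>\<^bsub>B\<^esub> J"
      using J a yz(2) set_add_superset(2)[OF subspace_span[OF S] Js] unfolding left_ideal_def by blast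
    ultimately show "a \<otimes> x \<in> lspan S <+>\<^bsub>B\<^esub> J" using subspaceD(3)[OF sub] by simp
  qed
  moreover have "S \<subseteq> lspan S <+>\<^bsub>B\<^esub> J"
    using span_superset[OF S] set_add_superset(1)[OF subspace_span[OF S] Js] by blast
  ultimately have "left_genideal B S \<subseteq> lspan S <+>\<^bsub>B\<^esub> J" by (rule left_genideal_least)
  then show "left_genideal B S <+>\<^bsub>B\<^esub> J \<subseteq> lspan S <+>\<^bsub>B\<^esub> J"
    using set_add_superset(2)[OF subspace_span[OF S] Js] by (intro set_add_least[OF sub])
qed

text \<open>The common form of the four statements about left ideals. J must be large enough to
  absorb turns and blobs, for spanning, and must lie in the span of products of smaller weight, for
  independence.\<close>

lemma walk_basis:
  assumes m: "m \<in> weights n" and J: "left_ideal J" "J \<subseteq> lower (below m)"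
    and turn: "\<And>y z. \<lbrakk>\<bar>m\<bar> \<ge> 2; y \<in> lists (gens n); z \<in> lists (gens n)\<rbrakk> \<Longrightarrow> val (y @ F (2 - \<bar>m\<bar>) @ z) \<in> J"
    and blob: "\<And>y. m < 0 \<Longrightarrow> y \<in> lists (gens n) \<Longrightarrow> val (y @ F (- m)) \<in> J"
  shows "basis_mod B (walk_set B u n m) (left_genideal B (walk_set B u n m) <+>\<^bsub>B\<^esub> J) J"
proof -
  let ?S = "walk_set B u n m"
  have Js: "subspace J" using J by (simp add: left_ideal_def)
  have Ls: "subspace (left_genideal B ?S)"
    using left_ideal_left_genideal[OF walk_set_closed] by (simp add: left_ideal_def)
  note sub = subspaceD[OF subspace_set_add[OF subspace_span[OF walk_set_closed] Js]]
  note sup = set_add_superset[OF subspace_span[OF walk_set_closed] Js]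
  have "val w \<otimes> s \<in> lspan ?S <+>\<^bsub>B\<^esub> J" if w: "w \<in> lists (gens n)" and s: "s \<in> ?S" for w s
  proof -
    obtain p where p: "p \<in> walks n m" "s = val (cw m p @ F m)"
      using s unfolding walk_set_eq by blast
    note Fm = F_lists[OF m]
    have ws: "val w \<otimes> s = val ((w @ cw m p) @ F m)"
      using val_append[OF w, of "cw m p @ F m"] cw(1)[OF p(1)] Fm p(2) by simp
    have x: "w @ cw m p \<in> lists (gens n)" using w cw(1)[OF p(1)] by simp
    from m x show ?thesis
    proof (cases rule: red_left)
      case (walk c q)
      then have "val w \<otimes> s = c \<odot> val (cw m q @ F m)"
        unfolding ws using eqvD(1)[OF walk(2)] x Fm cw(1)[OF walk(1)] by simp
      moreover have "val (cw m q @ F m) \<in> lspan ?S <+>\<^bsub>B\<^esub> J"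
        using span_superset[OF walk_set_closed, of m] sup(1)[of m] walk(1) unfolding walk_set_eq by blast
      ultimately show ?thesis using sub(4) by simp
    next
      case (turn c y z)
      then have "val w \<otimes> s = c \<odot> val (y @ F (2 - \<bar>m\<bar>) @ z)"
        unfolding ws using eqvD(1)[OF turn(6)] x Fm F_lists[OF turn(2)] by simp
      moreover have "val (y @ F (2 - \<bar>m\<bar>) @ z) \<in> lspan ?S <+>\<^bsub>B\<^esub> J"
        using assms(4)[OF turn(1,4,5)] sup(2) by blast
      ultimately show ?thesis using sub(4) by simp
    next
      case (blob c y)
      then have "val w \<otimes> s = c \<odot> val (y @ F (- m))"
        unfolding ws using eqvD(1)[OF blob(3)] x Fm F_lists[OF weights_minus[OF m]] by simp
      moreover have "val (y @ F (- m)) \<in> lspan ?S <+>\<^bsub>B\<^esub> J"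
        using assms(5)[OF blob(1,2)] sup(2) by blast
      ultimately show ?thesis using sub(4) by simp
    qed
  qed
  then have "lspan ?S <+>\<^bsub>B\<^esub> J = left_genideal B ?S <+>\<^bsub>B\<^esub> J"
    by (rule left_genideal_span[OF walk_set_closed J(1)])
  then show ?thesis
    unfolding basis_mod_def
    using set_add_superset[OF Ls Js] left_genideal_superset[of ?S] independent_walk_set[OF J(2)] by blast
qed

lemma walk_basis_01:
  assumes m: "m \<in> weights n" "m = 0 \<or> m = 1"
  shows "basis_mod B (walk_set B u n m) (left_genideal B (walk_set B u n m)) {\<zero>}"
proof -
  have "left_ideal {\<zero>}" using subspace_zero by (simp add: left_ideal_def)
  then have "basis_mod B (walk_set B u n m) (left_genideal B (walk_set B u n m) <+>\<^bsub>B\<^esub> {\<zero>}) {\<zero>}"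
    by (rule walk_basis[OF m(1)]) (use m(2) subspaceD(2)[OF subspace_lower] in auto)
  then show ?thesis
    using set_add_zero[of "left_genideal B (walk_set B u n m)"]
      left_ideal_left_genideal[OF walk_set_closed, of m] subspaceD(1) unfolding left_ideal_def by simp
qed

text \<open>The F word itself is a walk word, so its left multiples lie in the left ideal generated
  by the walk words.\<close>

lemma blob_in_left_ideal:
  assumes m: "m \<in> weights n" and y: "y \<in> lists (gens n)"
  shows "val (y @ F m) \<in> left_genideal B (walk_set B u n m)"
proof -
  obtain q where q: "q \<in> walks n m" "eqv 1 (F m) (walk_word q)"
    using rw.F_word_walk[OF m order_refl] by blast
  have "val (F m) = val (walk_word q)"
    using eqvD(1)[OF q(2) F_lists[OF m] walk_word_lists[OF q(1)]] walk_word_lists[OF q(1)] by simp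
  then have "val (F m) \<in> left_genideal B (walk_set B u n m)"
    using left_genideal_superset[of "walk_set B u n m"] q(1) unfolding walk_set_def by auto
  then show ?thesis
    using left_ideal_left_genideal[OF walk_set_closed] val_closed[OF y] val_append[OF y F_lists[OF m]]
    unfolding left_ideal_def by simp
qed

lemma left_genideal_below:
  assumes "m' \<in> below m"
  shows "left_genideal B (walk_set B u n m') \<subseteq> lower (below m)"
proof (rule left_genideal_least[OF ideal_subspace(2)[OF ideal_below(1)]])
  have "insert m' (below m') \<subseteq> below m" using assms below_below by blast
  then have "lower (insert m' (below m')) \<subseteq> lower (below m)" by (rule lower_mono)
  then show "walk_set B u n m' \<subseteq> lower (below m)"
    using walk_set_lower[of m'] assms by (auto simp: below_def)
qed

lemma turn_ideal:
  assumes m: "m \<in> weights n" "\<bar>m\<bar> \<ge> 2"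
  defines "J \<equiv> genideal B {val (E_word n (nat (\<bar>m\<bar> - 2)))}"
  shows "ideal J B" "J \<subseteq> lower (below m)"
    "y \<in> lists (gens n) \<Longrightarrow> z \<in> lists (gens n) \<Longrightarrow> val (y @ F (2 - \<bar>m\<bar>) @ z) \<in> J"
proof -
  have e: "E_word n (nat (\<bar>m\<bar> - 2)) = F (2 - \<bar>m\<bar>)" using m(2) by (simp add: F_word_def)
  have w: "2 - \<bar>m\<bar> \<in> weights n"
  proof -
    have "even (m - int n)" "\<bar>m\<bar> \<le> int n" using m(1) by (auto simp: weights_def)
    then have "even (2 - \<bar>m\<bar> - int n)" by (cases "m \<ge> 0") auto
    moreover have "\<bar>2 - \<bar>m\<bar>\<bar> \<le> int n" using m(2) \<open>\<bar>m\<bar> \<le> int n\<close> by linarith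
    ultimately show ?thesis by (simp add: weights_def)
  qed
  note Fl = F_lists[OF w]
  show i: "ideal J B" unfolding J_def e by (rule genideal_ideal) (use Fl in simp)
  have b: "2 - \<bar>m\<bar> \<in> below m" using w m(2) by (auto simp: below_def prec_def)
  then have "insert (2 - \<bar>m\<bar>) (below (2 - \<bar>m\<bar>)) \<subseteq> below m" using below_below by blast
  then have "lower (insert (2 - \<bar>m\<bar>) (below (2 - \<bar>m\<bar>))) \<subseteq> lower (below m)" by (rule lower_mono)
  then have "val (F (2 - \<bar>m\<bar>)) \<in> lower (below m)"
    using word_in_lower[OF w, of "[]" "[]"] by auto
  then show "J \<subseteq> lower (below m)"
    unfolding J_def e by (intro genideal_minimal[OF ideal_below(1)]) simp
  assume yz: "y \<in> lists (gens n)" "z \<in> lists (gens n)"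
  have "val (F (2 - \<bar>m\<bar>)) \<in> J"
    unfolding J_def e using genideal_self[of "{val (F (2 - \<bar>m\<bar>))}"] Fl by simp
  then have "val y \<otimes> (val (F (2 - \<bar>m\<bar>)) \<otimes> val z) \<in> J"
    using ideal.I_l_closed[OF i] ideal.I_r_closed[OF i] val_closed yz by blast
  then show "val (y @ F (2 - \<bar>m\<bar>) @ z) \<in> J"
    using yz Fl by (simp add: val_append)
qed

lemma walk_basis_neg1:
  assumes m: "- 1 \<in> weights n"
  shows "basis_mod B (walk_set B u n (- 1))
    (left_genideal B (walk_set B u n (- 1)) <+>\<^bsub>B\<^esub> left_genideal B (walk_set B u n 1)) (left_genideal B (walk_set B u n 1))"
proof -
  have m': "1 \<in> weights n" using weights_minus[OF m] by simp
  then have "1 \<in> below (- 1)" by (simp add: below_def prec_def)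
  then show ?thesis
    using blob_in_left_ideal[OF m'] left_genideal_below
    by (intro walk_basis[OF m] left_ideal_left_genideal[OF walk_set_closed]) auto
qed

lemma walk_basis_ge2:
  assumes m: "m \<in> weights n" "m \<ge> 2"
  defines "J \<equiv> genideal B {val (E_word n (nat (m - 2)))}"
  shows "basis_mod B (walk_set B u n m) (left_genideal B (walk_set B u n m) <+>\<^bsub>B\<^esub> J) J"
proof -
  have e: "J = genideal B {val (E_word n (nat (\<bar>m\<bar> - 2)))}" using m(2) by (simp add: J_def)
  have m2: "\<bar>m\<bar> \<ge> 2" using m(2) by simp
  note t = turn_ideal[OF m(1) m2, folded e]
  show ?thesis
    by (rule walk_basis[OF m(1) ideal_subspace(2)[OF t(1)] t(2)]) (rule t(3), assumption+, use m(2) in simp)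
qed

lemma walk_basis_less_neg1:
  assumes m: "m \<in> weights n" "m < - 1"
  defines "J \<equiv> left_genideal B (walk_set B u n (- m)) <+>\<^bsub>B\<^esub> genideal B {val (E_word n (nat (\<bar>m\<bar> - 2)))}"
  shows "basis_mod B (walk_set B u n m) (left_genideal B (walk_set B u n m) <+>\<^bsub>B\<^esub> J) J"
proof -
  have m2: "\<bar>m\<bar> \<ge> 2" using m(2) by simp
  note t = turn_ideal[OF m(1) m2] and m' = weights_minus[OF m(1)]
  note L = left_ideal_left_genideal[OF walk_set_closed, of "- m"] and I = ideal_subspace(2)[OF t(1)]
  then have Ls: "subspace (left_genideal B (walk_set B u n (- m)))"
    and Is: "subspace (genideal B {val (E_word n (nat (\<bar>m\<bar> - 2)))})"
    by (simp_all add: left_ideal_def)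
  note sup = set_add_superset[OF Ls Is, folded J_def]
  have "- m \<in> below m" using m' m(2) by (simp add: below_def prec_def)
  then have "left_genideal B (walk_set B u n (- m)) \<subseteq> lower (below m)" by (rule left_genideal_below)
  then have Jl: "J \<subseteq> lower (below m)"
    unfolding J_def by (rule set_add_least[OF subspace_lower _ t(2)])
  have Ji: "left_ideal J" unfolding J_def by (rule left_ideal_add[OF L I])
  show ?thesis
  proof (rule walk_basis[OF m(1) Ji Jl])
    fix y z assume "y \<in> lists (gens n)" "z \<in> lists (gens n)"
    then show "val (y @ F (2 - \<bar>m\<bar>) @ z) \<in> J" using t(3) sup(2) by blast
  next
    fix y assume "y \<in> lists (gens n)"
    then show "val (y @ F (- m)) \<in> J" using blob_in_left_ideal[OF m'] sup(1) by blast
  qed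
qed

end

subsection \<open>Bases of the two-sided ideals\<close>

context blob_algebra
begin

lemma square_eq:
  assumes w: "m \<in> weights n" "a \<in> lists (gens n)" "b \<in> lists (gens n)"
  shows "val a \<otimes> val (F m) \<otimes> reverse_map B u n (val b) = val (a @ F m @ rev b)"
  using w F_lists[OF w(1)] by (simp add: reverse_map_val val_append m_assoc)

text \<open>The product depends on a and b only through the values of a F and b F: the
  anti-automorphism moves the second equation to the right-hand side, and F is symmetric.\<close>

lemma square_cong:
  assumes m: "m \<in> weights n" and w: "a \<in> lists (gens n)" "a' \<in> lists (gens n)" "b \<in> lists (gens n)" "b' \<in> lists (gens n)"
    and a: "val (a @ F m) = val (a' @ F m)" and b: "val (b @ F m) = val (b' @ F m)"
  shows "val (a @ F m @ rev b) = val (a' @ F m @ rev b')"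
proof -
  note Fm = F_lists[OF m]
  have "val (rev (F m) @ rev b) = val (rev (F m) @ rev b')"
    using reverse_map_val[of "b @ F m"] reverse_map_val[of "b' @ F m"] b w Fm by simp
  then have Fb: "val (F m @ rev b) = val (F m @ rev b')"
    using w Fm rev_F[OF m] by (simp add: val_append)
  have "val (a @ F m @ rev b) = val (a' @ F m @ rev b)"
    using val_append[of "a @ F m" "rev b"] val_append[of "a' @ F m" "rev b"] a w Fm by simp
  also have "\<dots> = val (a' @ F m @ rev b')"
    using val_append[of a' "F m @ rev b"] val_append[of a' "F m @ rev b'"] Fb w Fm by simp
  finally show ?thesis .
qed

lemma is_factor_set_cw:
  assumes m: "m \<in> weights n"
  shows "is_factor_set B u n m (cw m ` walks n m)"
  unfolding is_factor_set_def
proof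
  show "cw m ` walks n m \<subseteq> lists (gens n)" using cw(1) by blast
  have "val (cw m p @ F m) = val (cw m p) \<otimes> val (F m)" if "p \<in> walks n m" for p
    using val_append[OF cw(1)[OF that] F_lists[OF m]] .
  then show "walk_set B u n m = {val a \<otimes> val (F m) |a. a \<in> cw m ` walks n m}"
    unfolding walk_set_eq setcompr_eq_image by (simp add: image_image cong: image_cong)
qed

text \<open>The set of products does not depend on the admissible choice of factor words, so results
  for the choice \<open>cw\<close> hold for all choices.\<close>

lemma square_set_eq:
  assumes m: "m \<in> weights n" and s: "is_factor_set B u n m s"
  shows "square_set B u n m s = sq m"
proof -
  have sl: "a \<in> lists (gens n)" if "a \<in> s" for a using s that unfolding is_factor_set_def by blast
  have ap: "val (a @ F m) = val a \<otimes> val (F m)" if "a \<in> s" for a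
    using val_append[OF sl[OF that] F_lists[OF m]] .
  have W: "(\<lambda>p. val (cw m p @ F m)) ` walks n m = (\<lambda>a. val (a @ F m)) ` s"
    using s unfolding is_factor_set_def walk_set_eq setcompr_eq_image by (simp add: ap cong: image_cong)
  have 1: "\<exists>p\<in>walks n m. val (a @ F m) = val (cw m p @ F m)" if "a \<in> s" for a
    using W that by blast
  have 2: "\<exists>a\<in>s. val (cw m p @ F m) = val (a @ F m)" if "p \<in> walks n m" for p
    using W that by blast
  show ?thesis
  proof
    show "square_set B u n m s \<subseteq> sq m"
    proof
      fix x assume "x \<in> square_set B u n m s"
      then obtain a b where ab: "a \<in> s" "b \<in> s" "x = val a \<otimes> val (F m) \<otimes> reverse_map B u n (val b)"
        unfolding square_set_def by blast
      obtain p p' where p: "p \<in> walks n m" "val (a @ F m) = val (cw m p @ F m)"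
        "p' \<in> walks n m" "val (b @ F m) = val (cw m p' @ F m)"
        using 1 ab by blast
      have "x = val (sqw m p p')"
        unfolding ab(3) square_eq[OF m sl[OF ab(1)] sl[OF ab(2)]] sqw_def
        by (rule square_cong[OF m sl[OF ab(1)] cw(1)[OF p(1)] sl[OF ab(2)] cw(1)[OF p(3)] p(2,4)])
      then show "x \<in> sq m" unfolding sq_def using p by blast
    qed
    show "sq m \<subseteq> square_set B u n m s"
    proof
      fix x assume "x \<in> sq m"
      then obtain p p' where p: "p \<in> walks n m" "p' \<in> walks n m" "x = val (sqw m p p')" by (rule sqE)
      obtain a b where a: "a \<in> s" "val (cw m p @ F m) = val (a @ F m)"
        and b: "b \<in> s" "val (cw m p' @ F m) = val (b @ F m)"
        using 2 p by blast
      have "x = val a \<otimes> val (F m) \<otimes> reverse_map B u n (val b)"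
        unfolding p(3) square_eq[OF m sl[OF a(1)] sl[OF b(1)]] sqw_def
        by (rule square_cong[OF m cw(1)[OF p(1)] sl[OF a(1)] cw(1)[OF p(2)] sl[OF b(1)] a(2) b(2)])
      then show "x \<in> square_set B u n m s" unfolding square_set_def using a b by blast
    qed
  qed
qed

text \<open>The individual ideals may be smaller than the span of everything below, but each lies in
  it and together they contain all products of the weights concerned.\<close>

lemma sum_of_ideals_below: "sum_of_ideals B (\<lambda>m'. genideal B (sq m')) (below m) = lower (below m)"
proof
  have fin: "finite (below m)" unfolding below_def by simp
  have sub: "subspace (genideal B (sq m'))" for m'
    by (rule ideal_subspace(1)[OF genideal_ideal[OF sq_closed]])
  have le: "genideal B (sq m') \<subseteq> lower (below m)" if "m' \<in> below m" for m'
    by (rule genideal_minimal[OF ideal_below(1) sq_lower[OF that]])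
  show "sum_of_ideals B (\<lambda>m'. genideal B (sq m')) (below m) \<subseteq> lower (below m)"
  proof
    fix x assume "x \<in> sum_of_ideals B (\<lambda>m'. genideal B (sq m')) (below m)"
    then obtain f where f: "x = (\<Oplus>i\<in>below m. f i)" "\<forall>i\<in>below m. f i \<in> genideal B (sq i)"
      unfolding sum_of_ideals_def by blast
    show "x \<in> lower (below m)"
      unfolding f(1) by (rule finsum_in_subspace[OF subspace_lower fin]) (use f(2) le in blast)
  qed
  show "lower (below m) \<subseteq> sum_of_ideals B (\<lambda>m'. genideal B (sq m')) (below m)"
    unfolding lower_def
  proof (rule span_least[OF subspace_sum_of_ideals(1)[OF fin sub]])
    show "(\<Union>m'\<in>below m. sq m') \<subseteq> sum_of_ideals B (\<lambda>m'. genideal B (sq m')) (below m)"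
    proof (rule UN_least)
      fix m' assume "m' \<in> below m"
      then have "genideal B (sq m') \<subseteq> sum_of_ideals B (\<lambda>m'. genideal B (sq m')) (below m)"
        using subspace_sum_of_ideals(2)[where I = "\<lambda>m'. genideal B (sq m')", OF fin sub] by simp
      then show "sq m' \<subseteq> sum_of_ideals B (\<lambda>m'. genideal B (sq m')) (below m)"
        using genideal_self[OF sq_closed] by blast
    qed
  qed
qed

lemma square_basis:
  "basis_mod B (sq m) (genideal B (sq m) <+>\<^bsub>B\<^esub> lower (below m)) (lower (below m))"
proof -
  let ?J = "lower (below m)" and ?I = "genideal B (sq m)"
  have Is: "subspace ?I" by (rule ideal_subspace(1)[OF genideal_ideal[OF sq_closed]])
  have IJ: "subspace (?I <+>\<^bsub>B\<^esub> ?J)" by (rule subspace_set_add[OF Is subspace_lower])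
  have sJ: "subspace (lspan (sq m) <+>\<^bsub>B\<^esub> ?J)"
    by (rule subspace_set_add[OF subspace_span[OF sq_closed] subspace_lower])
  note sup = set_add_superset[OF Is subspace_lower[of "below m"]]
  have sqI: "sq m \<subseteq> ?I" by (rule genideal_self[OF sq_closed])
  have "lspan (sq m) \<subseteq> ?I" by (rule span_least[OF Is sqI])
  then have 1: "lspan (sq m) <+>\<^bsub>B\<^esub> ?J \<subseteq> ?I <+>\<^bsub>B\<^esub> ?J"
    using sup by (intro set_add_least[OF IJ]) auto
  \<comment> \<open>The products of weight m together with those below already span a two-sided
    ideal, so the generated ideal contributes nothing beyond their span.\<close>
  have "?I \<subseteq> lower (insert m (below m))"
    by (rule genideal_minimal[OF ideal_below(2) sq_lower]) simp
  also have "\<dots> = lspan (sq m \<union> (\<Union>m'\<in>below m. sq m'))" by (simp add: lower_def)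
  also have "\<dots> \<subseteq> lspan (sq m) <+>\<^bsub>B\<^esub> ?J"
    unfolding lower_def by (rule span_Un[OF sq_closed union_closed])
  finally have 2: "?I <+>\<^bsub>B\<^esub> ?J \<subseteq> lspan (sq m) <+>\<^bsub>B\<^esub> ?J"
    using set_add_superset(2)[OF subspace_span[OF sq_closed] subspace_lower[of "below m"], of m]
    by (intro set_add_least[OF sJ])
  have "independent_mod B (sq m) ?J"
  proof (rule independent_modI[OF sq_closed])
    fix v assume "v \<in> sq m"
    then obtain p p' where p: "p \<in> walks n m" "p' \<in> walks n m" "v = val (sqw m p p')" by (rule sqE)
    let ?t = "T (st m p p')"
    have c: "?t (val (sqw m q q')) = (if q = p \<and> q' = p' then 1 else 0)"
      if "q \<in> walks n m" "q' \<in> walks n m" for q q'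
      using T(3)[OF sqw_lists[OF that]] coord_st[OF p(1,2) that] by simp
    have "?t w = 0" if w: "w \<in> sq m" "w \<noteq> v" for w
    proof -
      obtain q q' where q: "q \<in> walks n m" "q' \<in> walks n m" "w = val (sqw m q q')"
        using w(1) by (rule sqE)
      then show ?thesis using c[OF q(1,2)] w(2) p(3) by auto
    qed
    moreover have "?t w = 0" if "w \<in> ?J" for w
      by (rule T_below[OF p(1) st(2)[OF p(1,2)] that])
    moreover have "?t v = 1" using c[OF p(1,2)] p(3) by simp
    ultimately show "\<exists>t. additive_map B t \<and> (\<forall>x\<in>carrier B. \<forall>c. t (c \<odot> x) = c * t x) \<and>
        t v = 1 \<and> (\<forall>w\<in>sq m. w \<noteq> v \<longrightarrow> t w = 0) \<and> (\<forall>w\<in>?J. t w = 0)"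
      using T(1,2) by blast
  qed
  then show ?thesis
    unfolding basis_mod_def using sup sqI 1 2 by (intro conjI equalityI) auto
qed

lemma all_squares_basis: "basis_mod B (\<Union>m\<in>weights n. sq m) (carrier B) {\<zero>}"
proof -
  have b: "(\<Union>m\<in>weights n. sq m) = basis ` idx"
  proof (intro equalityI subsetI)
    fix x assume "x \<in> (\<Union>m\<in>weights n. sq m)"
    then obtain m p p' where "(m, p, p') \<in> idx" "x = basis (m, p, p')"
      by (auto simp: sq_def idx_def basis_def)
    then show "x \<in> basis ` idx" by blast
  next
    fix x assume "x \<in> basis ` idx"
    then show "x \<in> (\<Union>m\<in>weights n. sq m)" by (force simp: sq_def idx_def basis_def)
  qed
  have "independent_mod B (\<Union>m\<in>weights n. sq m) {\<zero>}"
  proof (rule independent_modI[OF union_closed])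
    fix v assume "v \<in> (\<Union>m\<in>weights n. sq m)"
    then obtain i where i: "i \<in> idx" "v = basis i" unfolding b by blast
    interpret t: additive_map B "dual i" by (rule dual_additive)
    have "dual i w = 0" if w: "w \<in> (\<Union>m\<in>weights n. sq m)" "w \<noteq> v" for w
    proof -
      obtain j where j: "j \<in> idx" "w = basis j" using w(1) unfolding b by blast
      then show ?thesis using dual_basis[OF i(1) j(1)] w(2) i(2) by auto
    qed
    moreover have "dual i v = 1" using dual_basis[OF i(1) i(1)] i(2) by simp
    ultimately show "\<exists>t. additive_map B t \<and> (\<forall>x\<in>carrier B. \<forall>c. t (c \<odot> x) = c * t x) \<and>
        t v = 1 \<and> (\<forall>w\<in>(\<Union>m\<in>weights n. sq m). w \<noteq> v \<longrightarrow> t w = 0) \<and> (\<forall>w\<in>{\<zero>}. t w = 0)"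
      using dual_additive[of i] dual_smult[of _ i] by (intro exI[of _ "dual i"]) simp
  qed
  moreover have "lspan (\<Union>m\<in>weights n. sq m) = carrier B"
    using lower_weights by (simp add: lower_def)
  ultimately show ?thesis
    unfolding basis_mod_def using union_closed by (simp add: set_add_zero)
qed

end

section \<open>The algebra b_n as an instance\<close>

lemma blob_rules_map:
  assumes "(l, c, r) \<in> blob_rules (\<phi> q2) (\<phi> \<gamma>) (\<phi> \<delta>) n" "\<phi> 1 = 1"
  obtains d where "c = \<phi> d" "(l, d, r) \<in> blob_rules q2 \<gamma> \<delta> n"
  using assms(1)
proof (cases rule: blob_rules_cases)
  case (1 i)
  then show ?thesis using that[of q2] blob_rules_intros(1)[of i n q2] by simp
next
  case (2 i j)
  then show ?thesis using that[of 1] blob_rules_intros(2)[of i n j q2] assms(2) by simp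
next
  case (3 i j)
  then show ?thesis using that[of 1] blob_rules_intros(3)[of i n j q2] assms(2) by simp
next
  case 4
  then show ?thesis using that[of \<gamma>] blob_rules_intros(4)[of n \<gamma>] by simp
next
  case 5
  then show ?thesis using that[of \<delta>] blob_rules_intros(5)[of \<delta>] by simp
next
  case (6 i)
  then show ?thesis using that[of 1] blob_rules_intros(6)[of i n q2] assms(2) by simp
qed

text \<open>Scalars of the relations act on the extension through their images under \<phi>, so the
  rules over the field are the images of the rules over the ring.\<close>

lemma blob_algebra_b_alg:
  fixes \<phi> :: "'r::comm_ring_1 \<Rightarrow> 'k::field"
  assumes \<phi>: "comm_ring_map \<phi>" and n: "1 \<le> n"
  shows "blob_algebra (b_alg \<phi> x \<gamma> \<delta> n) (b_gen \<phi> x \<gamma> \<delta> n) n (\<phi> (x^2 + unit_inverse (x^2))) (\<phi> \<gamma>) (\<phi> \<delta>)"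
proof -
  interpret S: blob_scalars \<phi> x \<gamma> \<delta> n using \<phi> by (rule blob_scalars.intro)
  show ?thesis
    unfolding S.b_alg_eq
  proof (intro blob_algebra.intro blob_algebra_axioms.intro)
    show "scalar_ring S.B" by (rule S.q2.quotient.scalar_ring_axioms)
    show "1 \<le> n" by (rule n)
    show "S.u g \<in> carrier S.B" if "g \<in> gens n" for g using that by (rule S.u_closed)
    show "word_val S.B S.u l = c \<odot>\<^bsub>S.B\<^esub> word_val S.B S.u r"
      if "(l, c, r) \<in> blob_rules (\<phi> (x^2 + unit_inverse (x^2))) (\<phi> \<gamma>) (\<phi> \<delta>) n" for l c r
      using that S.map_1 by (rule blob_rules_map) (simp add: S.word_val_rule)
  next
    fix X W
    assume "X \<in> carrier S.B" "\<And>w. w \<in> lists (gens n) \<Longrightarrow> word_val S.B S.u w \<in> W"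
      "\<And>Y Z. Y \<in> W \<Longrightarrow> Z \<in> W \<Longrightarrow> Y \<oplus>\<^bsub>S.B\<^esub> Z \<in> W" "\<And>c Y. Y \<in> W \<Longrightarrow> c \<odot>\<^bsub>S.B\<^esub> Y \<in> W" "W \<subseteq> carrier S.B"
    then show "X \<in> W" by (rule S.word_span)
  next
    fix t0 :: "gen list \<Rightarrow> 'k"
    assume t0: "\<And>l c r v w. \<lbrakk>(l, c, r) \<in> blob_rules (\<phi> (x^2 + unit_inverse (x^2))) (\<phi> \<gamma>) (\<phi> \<delta>) n;
      v \<in> lists (gens n); w \<in> lists (gens n)\<rbrakk> \<Longrightarrow> t0 (v @ l @ w) = c * t0 (v @ r @ w)"
    have "t0 (v @ l @ w) = \<phi> c * t0 (v @ r @ w)"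
      if lcr: "(l, c, r) \<in> blob_rules S.q2 \<gamma> \<delta> n" and vw: "v \<in> lists (gens n)" "w \<in> lists (gens n)" for l c r v w
    proof -
      have "(l, \<phi> c, r) \<in> blob_rules (\<phi> S.q2) (\<phi> \<gamma>) (\<phi> \<delta>) n"
        using lcr by (cases rule: blob_rules_cases)
          (simp_all only: S.map_1, (rule blob_rules_intros; simp)+)
      then show ?thesis using vw by (rule t0)
    qed
    then obtain T where "additive_map S.B T" "\<And>X c. X \<in> carrier S.B \<Longrightarrow> T (c \<odot>\<^bsub>S.B\<^esub> X) = c * T X"
      "\<And>w. w \<in> lists (gens n) \<Longrightarrow> T (word_val S.B S.u w) = t0 w"
      using S.word_functional[of t0] by blast
    then show "\<exists>T. additive_map S.B T \<and> (\<forall>X\<in>carrier S.B. \<forall>c. T (c \<odot>\<^bsub>S.B\<^esub> X) = c * T X) \<and>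
        (\<forall>w\<in>lists (gens n). T (word_val S.B S.u w) = t0 w)"
      by blast
  qed
qed

lemma (in ring) sum_of_ideals_cong:
  assumes "\<And>i. i \<in> D \<Longrightarrow> I i = I' i"
  shows "sum_of_ideals R I D = sum_of_ideals R I' D"
  unfolding sum_of_ideals_def using assms by auto

theorem proposition17:
  fixes \<phi> :: "'r::comm_ring_1 \<Rightarrow> 'k::field"
    and x \<gamma> \<delta> :: 'r
    and n :: nat
    and B :: "('k, ('r, 'k) b_elt) module"
    and u :: "gen \<Rightarrow> ('r, 'k) b_elt"
  assumes "\<phi> 1 = 1"
    and "\<And>a b. \<phi> (a + b) = \<phi> a + \<phi> b"
    and "\<And>a b. \<phi> (a * b) = \<phi> a * \<phi> b"
    and "x dvd 1"
    and "n \<ge> 1"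
    and "B = b_alg \<phi> x \<gamma> \<delta> n"
    and "u = b_gen \<phi> x \<gamma> \<delta> n"
  shows
    "(\<forall>m \<in> weights n.
      (m \<in> {0, 1} \<longrightarrow>
        basis_mod B (walk_set B u n m) (left_genideal B (walk_set B u n m)) {\<zero>\<^bsub>B\<^esub>}) \<and>
      (m = -1 \<longrightarrow>
        (let J = left_genideal B (walk_set B u n 1)
         in basis_mod B (walk_set B u n m) (left_genideal B (walk_set B u n m) <+>\<^bsub>B\<^esub> J) J)) \<and>
      (m \<ge> 2 \<longrightarrow>
        (let J = genideal B {word_val B u (E_word n (nat (m - 2)))}
         in basis_mod B (walk_set B u n m) (left_genideal B (walk_set B u n m) <+>\<^bsub>B\<^esub> J) J)) \<and>
      (m < -1 \<longrightarrow>
        (let J = left_genideal B (walk_set B u n (- m)) <+>\<^bsub>B\<^esub>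
                 genideal B {word_val B u (E_word n (nat (\<bar>m\<bar> - 2)))}
         in basis_mod B (walk_set B u n m) (left_genideal B (walk_set B u n m) <+>\<^bsub>B\<^esub> J) J))) \<and>
    (\<forall>m \<in> weights n. \<exists>s. is_factor_set B u n m s) \<and>
    (\<forall>s. (\<forall>m \<in> weights n. is_factor_set B u n m (s m)) \<longrightarrow>
      (\<forall>m \<in> weights n.
        (let S2 = (\<lambda>m. square_set B u n m (s m));
             J = sum_of_ideals B (\<lambda>m'. genideal B (S2 m'))
                   {m' \<in> weights n. \<bar>m'\<bar> < \<bar>m\<bar> \<or> (m < 0 \<and> m' = - m)}
         in basis_mod B (S2 m) (genideal B (S2 m) <+>\<^bsub>B\<^esub> J) J)) \<and>
      basis_mod B (\<Union>m \<in> weights n. square_set B u n m (s m)) (carrier B) {\<zero>\<^bsub>B\<^esub>})"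
proof -
  have "comm_ring_map \<phi>" by unfold_locales (fact assms(1-3))+
  then interpret blob_algebra B u n "\<phi> (x^2 + unit_inverse (x^2))" "\<phi> \<gamma>" "\<phi> \<delta>"
    unfolding assms(6,7) using assms(5) by (rule blob_algebra_b_alg)
  have walks: "(m \<in> {0, 1} \<longrightarrow>
        basis_mod B (walk_set B u n m) (left_genideal B (walk_set B u n m)) {\<zero>\<^bsub>B\<^esub>}) \<and>
      (m = -1 \<longrightarrow>
        (let J = left_genideal B (walk_set B u n 1)
         in basis_mod B (walk_set B u n m) (left_genideal B (walk_set B u n m) <+>\<^bsub>B\<^esub> J) J)) \<and>
      (m \<ge> 2 \<longrightarrow>
        (let J = genideal B {word_val B u (E_word n (nat (m - 2)))}
         in basis_mod B (walk_set B u n m) (left_genideal B (walk_set B u n m) <+>\<^bsub>B\<^esub> J) J)) \<and>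
      (m < -1 \<longrightarrow>
        (let J = left_genideal B (walk_set B u n (- m)) <+>\<^bsub>B\<^esub>
                 genideal B {word_val B u (E_word n (nat (\<bar>m\<bar> - 2)))}
         in basis_mod B (walk_set B u n m) (left_genideal B (walk_set B u n m) <+>\<^bsub>B\<^esub> J) J))"
    if m: "m \<in> weights n" for m
    unfolding Let_def
    using walk_basis_01[OF m] walk_basis_neg1 walk_basis_ge2[OF m] walk_basis_less_neg1[OF m] m
    by (intro conjI impI) auto
  have squares: "(\<forall>m \<in> weights n.
        (let S2 = (\<lambda>m. square_set B u n m (s m));
             J = sum_of_ideals B (\<lambda>m'. genideal B (S2 m'))
                   {m' \<in> weights n. \<bar>m'\<bar> < \<bar>m\<bar> \<or> (m < 0 \<and> m' = - m)}
         in basis_mod B (S2 m) (genideal B (S2 m) <+>\<^bsub>B\<^esub> J) J)) \<and>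
      basis_mod B (\<Union>m \<in> weights n. square_set B u n m (s m)) (carrier B) {\<zero>\<^bsub>B\<^esub>}"
    if s: "\<forall>m \<in> weights n. is_factor_set B u n m (s m)" for s
  proof -
    have eq: "square_set B u n m (s m) = sq m" if "m \<in> weights n" for m
      using square_set_eq[OF that] s that by blast
    \<comment> \<open>The weights in the sum are exactly \<open>below m\<close>, and on them the
      chosen sets of products are the standard ones.\<close>
    have J: "sum_of_ideals B (\<lambda>m'. genideal B (square_set B u n m' (s m')))
        {m' \<in> weights n. \<bar>m'\<bar> < \<bar>m\<bar> \<or> (m < 0 \<and> m' = - m)} = lower (below m)" for m
    proof -
      have "sum_of_ideals B (\<lambda>m'. genideal B (square_set B u n m' (s m'))) (below m) =
          sum_of_ideals B (\<lambda>m'. genideal B (sq m')) (below m)"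
        by (rule sum_of_ideals_cong) (simp add: eq below_def)
      then show ?thesis unfolding sum_of_ideals_below by (simp add: below_def prec_def)
    qed
    have "(\<Union>m \<in> weights n. square_set B u n m (s m)) = (\<Union>m \<in> weights n. sq m)"
      using eq by simp
    then show ?thesis
      unfolding Let_def J using square_basis all_squares_basis eq by simp
  qed
  show ?thesis
    using walks is_factor_set_cw squares by blast
qed

end
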